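(* Let $\mathbb{D}=\{z\in\mathbb{C}:|z|<1\}$, let $G\subset\mathbb{C}$ be a bounded Jordan domain, and let $f:\mathbb{D}\to G$ be a conformal map of $\mathbb{D}$ onto $G$. Then the following conditions are equivalent: (a) $J=\partial G$ is a symmetric quasicircle; (b) $f$ is asymptotically symmetric on $\mathbb{D}$; (c) the homeomorphic extension of $f$ to the boundary, $f|_{\mathbb{S}^1}:\mathbb{S}^1\to\partial G$, is asymptotically symmetric.
   Context: $\mathbb{S}^1=\partial\mathbb{D}$ is the unit circle. A bounded Jordan domain is the bounded component of the complement of a Jordan curve in $\mathbb{C}$. A conformal map of $\mathbb{D}$ onto such a domain $G$ extends to a homeomorphism of $\overline{\mathbb{D}}$ onto $\overline{G}$, again denoted $f$. Symmetric quasicircle: for a Jordan curve $J\subset\mathbb{C}$ and distinct $a,b\in J$, let $J(a,b)$ denote the subarc of $J$ between $a$ and $b$ of smaller diameter. $J$ is called a symmetric quasicircle (or asymptotically conformal curve) if $$\max_{w\in J(a,b)}\frac{|a-w|+|w-b|}{|a-b|}\to 1\quad\text{as } |a-b|\to 0,\ a,b\in J.$$ Asymptotically symmetric (AS): an embedding (homeomorphism onto its image) $f:X\to Y$ between metric spaces, with distances written $|\cdot-\cdot|$, is called asymptotically symmetric if for all $\epsilon>0$ and $t>0$ there exists $\delta>0$ such that for all distinct points $x,a,b\in X$ contained in a ball of radius $\delta$, $$\frac{|x-a|}{|x-b|}\leq t\implies\frac{|f(x)-f(a)|}{|f(x)-f(b)|}\leq(1+\epsilon)t.$$ Subsets of $\mathbb{C}$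 carry the Euclidean metric. *)

theory Defs
  imports "HOL-Complex_Analysis.Complex_Analysis"
begin

definition jordan_curve :: "complex set \<Rightarrow> bool" where
  "jordan_curve J \<longleftrightarrow>
     (\<exists>\<gamma>. simple_path \<gamma> \<and> pathfinish \<gamma> = pathstart \<gamma> \<and> path_image \<gamma> = J)"

definition bounded_jordan_domain :: "complex set \<Rightarrow> bool" where
  "bounded_jordan_domain G \<longleftrightarrow>
     (\<exists>J. jordan_curve J \<and> G \<in> components (- J) \<and> bounded G)"

definition conformal_onto :: "(complex \<Rightarrow> complex) \<Rightarrow> complex set \<Rightarrow> complex set \<Rightarrow> bool" where
  "conformal_onto f U G \<longleftrightarrow> f holomorphic_on U \<and> bij_betw f U G"

definition subarcs :: "complex set \<Rightarrow> complex \<Rightarrow> complex \<Rightarrow> complex set set" where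
  "subarcs J a b =
     {path_image \<gamma> | \<gamma>. arc \<gamma> \<and> path_image \<gamma> \<subseteq> J \<and> pathstart \<gamma> = a \<and> pathfinish \<gamma> = b}"

(* A Jordan curve has exactly two subarcs between two of its points.  If their diameters
   agree, an arbitrary one is chosen; this cannot happen once a and b are close enough. *)
definition smaller_subarc :: "complex set \<Rightarrow> complex \<Rightarrow> complex \<Rightarrow> complex set" where
  "smaller_subarc J a b = (ARG_MIN diameter A. A \<in> subarcs J a b)"

(* The supremum is a maximum because subarcs are compact.  The punctured filter "at 0"
   restricts the limit to distinct points a, b. *)
definition symmetric_quasicircle :: "complex set \<Rightarrow> bool" where
  "symmetric_quasicircle J \<longleftrightarrow> jordan_curve J \<and>
     ((\<lambda>(a, b). SUP w\<in>smaller_subarc J a b. (dist a w + dist w b) / dist a b) \<longlongrightarrow> 1)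
       (inf (filtercomap (\<lambda>(a, b). dist a b) (at 0)) (principal (J \<times> J)))"

(* The balls are those of the metric space X, so their centres lie in X. *)
definition asymptotically_symmetric_on ::
    "'a::metric_space set \<Rightarrow> ('a \<Rightarrow> 'b::metric_space) \<Rightarrow> bool" where
  "asymptotically_symmetric_on X f \<longleftrightarrow>
     (\<exists>g. homeomorphism X (f ` X) f g) \<and>
     (\<forall>\<epsilon>>0. \<forall>t>0. \<exists>\<delta>>0. \<forall>x\<in>X. \<forall>a\<in>X. \<forall>b\<in>X.
        x \<noteq> a \<and> x \<noteq> b \<and> a \<noteq> b \<and> (\<exists>c\<in>X. {x, a, b} \<subseteq> ball c \<delta>) \<longrightarrow>
        dist x a / dist x b \<le> t \<longrightarrow>
        dist (f x) (f a) / dist (f x) (f b) \<le> (1 + \<epsilon>) * t)"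

(* By continuity such an F is determined by f on the closed unit disc. *)
definition homeomorphic_extension ::
    "(complex \<Rightarrow> complex) \<Rightarrow> complex set \<Rightarrow> (complex \<Rightarrow> complex) \<Rightarrow> bool" where
  "homeomorphic_extension f G F \<longleftrightarrow>
     (\<exists>g. homeomorphism (cball 0 1) (closure G) F g) \<and> (\<forall>z\<in>ball 0 1. F z = f z)"

end

theory Submission imports Defs begin

text \<open>
  The three conditions are proved in the cycle (a) \<open>\<Longrightarrow>\<close> (b) \<open>\<Longrightarrow>\<close> (c) \<open>\<Longrightarrow>\<close> (a). The bridge between the
  shape of the boundary and the behaviour of \<open>f\<close> is an infinitesimal condition: the pre-Schwarzian
  derivative satisfies \<open>(1 - |z|) f''(z) / f'(z) \<longlonglongrightarrow> 0\<close> as \<open>|z| \<longlonglongrightarrow> 1\<close>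
  (\<open>vanishing_pre_schwarzian\<close>), which says that \<open>f\<close> is nearly affine on hyperbolic discs of fixed
  size near the unit circle.

  (a) gives the infinitesimal condition (\<open>symmetric_quasicircle_imp_vanishing\<close>). Near a point
  \<open>f z\<close> close to the boundary, and at the scale of its distance to the boundary, a symmetric
  quasicircle looks like a straight line (\<open>symmetric_quasicircle_nearly_straight\<close>). Hence if
  \<open>|z\<^sub>n| \<longlonglongrightarrow> 1\<close>, then the maps \<open>f\<close>, precomposed with disc automorphisms taking \<open>0\<close> to \<open>z\<^sub>n\<close> and
  normalised affinely, form a normal family by Schottky's theorem, and every limit is a conformal map
  onto a half-plane, so a Moebius map \<open>w \<mapsto> 2 v w / (1 + v w)\<close> with \<open>|v| = 1\<close>
  (\<open>rescaling_limit\<close>). What remains is to see where its pole lies: the pre-Schwarzian condition says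
  precisely that the pole is at the point of the circle reached from \<open>0\<close> in the direction of the
  centre of the original disc. If it were elsewhere, then the conformal radius \<open>(1 - |z|\<^sup>2) |f'(z)|\<close>
  would decrease somewhere along a radius on the way from the boundary to the centre. But it is
  bounded below on compact sets and tends to \<open>0\<close> at the boundary, so it would have a minimum at an
  interior point of the radius close to the boundary; rescaling at that minimum gives a limit map
  that has no such minimum (\<open>pole_location\<close>).

  The infinitesimal condition gives (b)
  (\<open>vanishing_pre_schwarzian_imp_asymptotically_symmetric\<close>). A point \<open>x\<close> of the disc and a scale
  \<open>r\<close> determine the point \<open>z = (1 - r) x\<close> at distance at least \<open>r\<close> from the circle. Integrating the
  pre-Schwarzian derivative along a radius shows that \<open>f'\<close> grows at most like a small negative power of
  the distance to the circle, which is integrable, so that \<open>f y - f x\<close> equals \<open>f'(z) (y - x)\<close> up to a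
  small multiple of \<open>|f'(z)| r\<close> whenever \<open>|y - x|\<close> is comparable to \<open>r\<close>
  (\<open>linear_approximation\<close>).

  (b) gives (c) (\<open>asymptotically_symmetric_extension\<close>). Asymptotic symmetry with small ratios
  makes \<open>f\<close> uniformly continuous, so it extends to the closed disc, and the inequality passes to the
  limit. If two points of the circle had a common image, then the image of their chord would be a Jordan
  curve that meets the boundary curve only once; this forces the extension to be constant on an arc, contrary to
  asymptotic symmetry (\<open>injective_on_sphere\<close>).

  (c) gives (a) (\<open>boundary_asymptotically_symmetric_imp_symmetric_quasicircle\<close>). A point on a short
  circular arc splits its chord nearly additively, asymptotic symmetry with finitely many ratios
  carries this over to the image arc, and the image of a short arc is the smaller subarc.
\<close>

section \<open>Subarcs of Jordan curves\<close>

text \<open>Pulled back to the parameter interval, \<open>S\<close> is a connected set that contains both \<open>0\<close> and \<open>1\<close>.\<close>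
lemma connected_subset_arc_eq:
  fixes \<gamma> :: "real \<Rightarrow> 'a::t2_space"
  assumes "arc \<gamma>" "connected S" "S \<subseteq> path_image \<gamma>" "pathstart \<gamma> \<in> S" "pathfinish \<gamma> \<in> S"
  shows "S = path_image \<gamma>"
proof -
  obtain h where h: "homeomorphism {0..1} (path_image \<gamma>) \<gamma> h"
    using homeomorphism_arc[OF assms(1)] by blast
  have "connected (h ` S)"
    using h assms(2,3) by (intro connected_continuous_image) (auto simp: homeomorphism_def elim: continuous_on_subset)
  moreover have "h (\<gamma> 0) = 0" "h (\<gamma> 1) = 1" using h by (auto simp: homeomorphism_def)
  then have "0 \<in> h ` S" "1 \<in> h ` S"
    using assms(4,5) unfolding pathstart_def pathfinish_def by (metis image_eqI)+
  ultimately have "{0..1} \<subseteq> h ` S" by (intro connected_contains_Icc)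
  then have "\<gamma> ` {0..1} \<subseteq> \<gamma> ` h ` S" by blast
  also have "\<dots> \<subseteq> S" using h assms(3) by (auto simp: homeomorphism_def subset_iff)
  finally show ?thesis using assms(3) by (auto simp: path_image_def)
qed

text \<open>An arc in \<open>J\<close> from \<open>a\<close> to \<open>b\<close> stays connected without its endpoints, so its interior lies on one
  side of the decomposition of \<open>J\<close> at \<open>a\<close> and \<open>b\<close>, and then it must fill that side.\<close>
lemma subarcs_of_double_arc:
  assumes u: "arc u" "pathstart u = a" "pathfinish u = b"
    and d: "arc d" "pathstart d = b" "pathfinish d = a"
    and int: "path_image u \<inter> path_image d = {a, b}"
    and un: "path_image u \<union> path_image d = J"
  shows "subarcs J a b = {path_image u, path_image d}"
proof (intro equalityI subsetI)
  fix A assume "A \<in> {path_image u, path_image d}"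
  then show "A \<in> subarcs J a b"
  proof
    assume "A = path_image u"
    then show ?thesis using u un unfolding subarcs_def by blast
  next
    assume "A \<in> {path_image d}"
    then have "A = path_image (reversepath d)" by simp
    then show ?thesis using d un arc_reversepath[of d] unfolding subarcs_def
      by (intro CollectI exI[of _ "reversepath d"]) auto
  qed
next
  fix A assume "A \<in> subarcs J a b"
  then obtain \<gamma> where \<gamma>: "arc \<gamma>" "path_image \<gamma> = A" "A \<subseteq> J" "pathstart \<gamma> = a" "pathfinish \<gamma> = b"
    unfolding subarcs_def by blast
  let ?A = "A - {a, b}"
  have conn: "connected ?A"
    using connected_simple_path_endless[OF arc_imp_simple_path[OF \<gamma>(1)]] \<gamma> by simp
  have closed: "closed (path_image u)" "closed (path_image d)"
    using u d by (auto intro: closed_arc_image)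
  have "?A \<subseteq> path_image u \<union> path_image d" using \<gamma> un by auto
  then have "path_image u \<inter> ?A = {} \<or> path_image d \<inter> ?A = {}"
    using conn closed int unfolding connected_closed by blast
  moreover have ends: "a \<in> A" "b \<in> A" using \<gamma> pathstart_in_path_image pathfinish_in_path_image by metis+
  have abi: "a \<in> path_image u" "b \<in> path_image u" "a \<in> path_image d" "b \<in> path_image d" using int by blast+
  have cA: "connected A" using connected_arc_image \<gamma> by metis
  ultimately have "A \<subseteq> path_image d \<or> A \<subseteq> path_image u" using \<gamma> un abi by blast
  then show "A \<in> {path_image u, path_image d}"
    using connected_subset_arc_eq[OF u(1) cA] connected_subset_arc_eq[OF d(1) cA] u d ends by auto
qed

text \<open>The minimum of the diameters is attained because there are only two subarcs to compare.\<close>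
lemma smaller_subarc:
  assumes "jordan_curve J" "a \<in> J" "b \<in> J" "a \<noteq> b"
  shows "smaller_subarc J a b \<in> subarcs J a b"
    and "\<And>A. A \<in> subarcs J a b \<Longrightarrow> diameter (smaller_subarc J a b) \<le> diameter A"
proof -
  obtain \<gamma> where \<gamma>: "simple_path \<gamma>" "pathfinish \<gamma> = pathstart \<gamma>" "path_image \<gamma> = J"
    using assms(1) unfolding jordan_curve_def by blast
  obtain u d where ud: "arc u" "arc d" "pathstart u = a" "pathfinish u = b"
     "pathstart d = b" "pathfinish d = a"
     "(path_image u) \<inter> (path_image d) = {a,b}"
     "(path_image u) \<union> (path_image d) = path_image \<gamma>"
    using exists_double_arc[OF \<gamma>(1,2), of a b] assms \<gamma>(3) by metis
  have eq: "subarcs J a b = {path_image u, path_image d}"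
    by (rule subarcs_of_double_arc) (use ud \<gamma> in auto)
  have "\<exists>A. is_arg_min diameter (\<lambda>A. A \<in> subarcs J a b) A"
    unfolding eq is_arg_min_def
    by (metis insert_iff not_less order.asym singletonD)
  then have "is_arg_min diameter (\<lambda>A. A \<in> subarcs J a b) (smaller_subarc J a b)"
    unfolding smaller_subarc_def arg_min_def by (rule someI_ex)
  then show "smaller_subarc J a b \<in> subarcs J a b"
    and "\<And>A. A \<in> subarcs J a b \<Longrightarrow> diameter (smaller_subarc J a b) \<le> diameter A"
    unfolding is_arg_min_def by (auto simp: not_less)
qed

text \<open>The supremum in the definition is at least \<open>1\<close> by the triangle inequality, so only its upper bound
  matters, and an upper bound for the supremum is a bound for each point of the subarc.\<close>
lemma symmetric_quasicircle_iff:
  "symmetric_quasicircle J \<longleftrightarrow> jordan_curve J \<and>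
     (\<forall>\<epsilon>>0. \<exists>\<delta>>0. \<forall>a\<in>J. \<forall>b\<in>J. a \<noteq> b \<and> dist a b < \<delta> \<longrightarrow>
        (\<forall>w\<in>smaller_subarc J a b. dist a w + dist w b \<le> (1 + \<epsilon>) * dist a b))"
  (is "_ \<longleftrightarrow> _ \<and> ?R")
proof (cases "jordan_curve J")
  case J: True
  define q where "q = (\<lambda>(a::complex, b) w. (dist a w + dist w b) / dist a b :: real)"
  let ?S = "\<lambda>(a, b). smaller_subarc J a b"
  let ?m = "\<lambda>ab. SUP w\<in>?S ab. q ab w"
  define F where "F = inf (filtercomap (\<lambda>(a, b). dist a b) (at 0)) (principal (J \<times> J))"
  have ev: "eventually P F \<longleftrightarrow> (\<exists>\<delta>>0. \<forall>a\<in>J. \<forall>b\<in>J. a \<noteq> b \<and> dist a b < \<delta> \<longrightarrow> P (a, b))" for P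
  proof
    assume "eventually P F"
    then obtain Q \<delta> where Q: "\<And>x. Q (case x of (a, b) \<Rightarrow> dist a b) \<Longrightarrow> x \<in> J \<times> J \<Longrightarrow> P x" and \<delta>: "0 < \<delta>"
      "\<And>x::real. x \<noteq> 0 \<Longrightarrow> dist x 0 < \<delta> \<Longrightarrow> Q x"
      unfolding F_def eventually_inf_principal eventually_filtercomap eventually_at by blast
    have "P (a, b)" if "a \<in> J" "b \<in> J" "a \<noteq> b" "dist a b < \<delta>" for a b
      by (rule Q) (use that in \<open>auto intro!: \<delta>(2)\<close>)
    then show "\<exists>\<delta>>0. \<forall>a\<in>J. \<forall>b\<in>J. a \<noteq> b \<and> dist a b < \<delta> \<longrightarrow> P (a, b)" using \<delta>(1) by blast
  next
    assume "\<exists>\<delta>>0. \<forall>a\<in>J. \<forall>b\<in>J. a \<noteq> b \<and> dist a b < \<delta> \<longrightarrow> P (a, b)"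
    then obtain \<delta> where \<delta>: "0 < \<delta>" "\<And>a b. a \<in> J \<Longrightarrow> b \<in> J \<Longrightarrow> a \<noteq> b \<Longrightarrow> dist a b < \<delta> \<Longrightarrow> P (a, b)" by blast
    show "eventually P F"
      unfolding F_def eventually_inf_principal eventually_filtercomap eventually_at
      by (rule exI[of _ "\<lambda>x. x \<noteq> 0 \<and> \<bar>x\<bar> < \<delta>"]) (use \<delta> in auto)
  qed
  have facts: "a \<in> ?S (a, b)" "bdd_above (q (a, b) ` ?S (a, b))"
    if ab: "a \<in> J" "b \<in> J" "a \<noteq> b" for a b
  proof -
    obtain \<gamma> where \<gamma>: "arc \<gamma>" "path_image \<gamma> = ?S (a, b)" "pathstart \<gamma> = a"
      using smaller_subarc(1)[OF J ab] unfolding subarcs_def by auto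
    then show "a \<in> ?S (a, b)" by (metis pathstart_in_path_image)
    have "compact (?S (a, b))" using \<gamma> compact_arc_image by metis
    then have "compact (q (a, b) ` ?S (a, b))"
      using ab by (intro compact_continuous_image) (auto simp: q_def intro!: continuous_intros)
    then show "bdd_above (q (a, b) ` ?S (a, b))" by (intro bounded_imp_bdd_above compact_imp_bounded)
  qed
  have ge1: "1 \<le> ?m (a, b)" if ab: "a \<in> J" "b \<in> J" "a \<noteq> b" for a b
  proof -
    have "1 = q (a, b) a" using ab by (simp add: q_def)
    also have "\<dots> \<le> ?m (a, b)" by (rule cSUP_upper) (use facts[OF ab] in auto)
    finally show ?thesis .
  qed
  have qle: "q (a, b) w \<le> 1 + \<epsilon> \<longleftrightarrow> dist a w + dist w b \<le> (1 + \<epsilon>) * dist a b" if "a \<noteq> b" for a b w \<epsilon>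
    using that by (simp add: q_def divide_le_eq)
  have "(?m \<longlongrightarrow> 1) F \<longleftrightarrow> ?R"
  proof
    assume lim: "(?m \<longlongrightarrow> 1) F"
    show ?R
    proof (intro allI impI)
      fix \<epsilon> :: real assume "0 < \<epsilon>"
      then have "\<forall>\<^sub>F ab in F. ?m ab < 1 + \<epsilon>" using order_tendstoD(2)[OF lim, of "1 + \<epsilon>"] by simp
      then obtain \<delta> where \<delta>: "\<delta> > 0"
        "\<And>a b. a \<in> J \<Longrightarrow> b \<in> J \<Longrightarrow> a \<noteq> b \<Longrightarrow> dist a b < \<delta> \<Longrightarrow> ?m (a, b) < 1 + \<epsilon>"
        unfolding ev by auto
      have "dist a w + dist w b \<le> (1 + \<epsilon>) * dist a b"
        if "a \<in> J" "b \<in> J" "a \<noteq> b" "dist a b < \<delta>" "w \<in> smaller_subarc J a b" for a b w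
      proof -
        have "q (a, b) w \<le> ?m (a, b)" by (rule cSUP_upper) (use facts that in auto)
        also have "\<dots> \<le> 1 + \<epsilon>" using \<delta>(2)[OF that(1-4)] by simp
        finally show ?thesis using qle that by blast
      qed
      then show "\<exists>\<delta>>0. \<forall>a\<in>J. \<forall>b\<in>J. a \<noteq> b \<and> dist a b < \<delta> \<longrightarrow>
        (\<forall>w\<in>smaller_subarc J a b. dist a w + dist w b \<le> (1 + \<epsilon>) * dist a b)" using \<delta>(1) by blast
    qed
  next
    assume R: ?R
    show "(?m \<longlongrightarrow> 1) F"
    proof (rule tendstoI)
      fix \<epsilon> :: real assume e: "0 < \<epsilon>"
      then obtain \<delta> where \<delta>: "\<delta> > 0" "\<And>a b w. a \<in> J \<Longrightarrow> b \<in> J \<Longrightarrow> a \<noteq> b \<Longrightarrow> dist a b < \<delta> \<Longrightarrow>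
          w \<in> smaller_subarc J a b \<Longrightarrow> dist a w + dist w b \<le> (1 + \<epsilon> / 2) * dist a b"
        using R by (metis half_gt_zero)
      show "\<forall>\<^sub>F ab in F. dist (?m ab) 1 < \<epsilon>"
        unfolding ev
      proof (intro exI[of _ \<delta>] conjI \<delta> ballI impI)
        fix a b assume ab: "a \<in> J" "b \<in> J" "a \<noteq> b \<and> dist a b < \<delta>"
        have "?m (a, b) \<le> 1 + \<epsilon> / 2"
          by (rule cSUP_least) (use facts(1)[of a b] ab \<delta>(2)[of a b] qle[of a b] in \<open>auto simp del: split_paired_All\<close>)
        then show "dist (?m (a, b)) 1 < \<epsilon>" using ge1[of a b] ab e by (simp add: dist_real_def)
      qed
    qed
  qed
  moreover have "(\<lambda>(a, b). SUP w\<in>smaller_subarc J a b. (dist a w + dist w b) / dist a b) = ?m"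
    by (auto simp: q_def fun_eq_iff)
  ultimately show ?thesis unfolding symmetric_quasicircle_def F_def using J by simp
qed (simp add: symmetric_quasicircle_def)

section \<open>Symmetric quasicircles are nearly straight at small scales\<close>

text \<open>Run through the curve starting at \<open>p\<close>. The points \<open>a\<close> and \<open>b\<close> are those where it leaves the open
  disc of radius \<open>r\<close> for the first time and enters it again for the last time; between them, on the
  side of \<open>p\<close>, the curve cannot leave the closed disc.\<close>
lemma arc_until_exit:
  fixes p :: complex
  assumes J: "jordan_curve J" and p: "p \<in> J" and q: "q \<in> J" "r < dist q p" and r: "0 < r"
  obtains a b u d where "arc u" "pathstart u = a" "pathfinish u = b"
    "arc d" "pathstart d = b" "pathfinish d = a"
    "path_image u \<inter> path_image d = {a, b}" "path_image u \<union> path_image d = J"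
    "p \<in> path_image d" "path_image d \<subseteq> cball p r" "dist a p = r" "dist b p = r"
proof -
  obtain \<gamma>0 where \<gamma>0: "simple_path \<gamma>0" "pathfinish \<gamma>0 = pathstart \<gamma>0" "path_image \<gamma>0 = J"
    using J unfolding jordan_curve_def by blast
  obtain s where s: "0 \<le> s" "s \<le> 1" "\<gamma>0 s = p" using p \<gamma>0(3) unfolding path_image_def by auto
  define \<gamma> where "\<gamma> = shiftpath s \<gamma>0"
  have sp: "simple_path \<gamma>" unfolding \<gamma>_def using simple_path_shiftpath \<gamma>0 s by blast
  have im: "path_image \<gamma> = J" unfolding \<gamma>_def using path_image_shiftpath \<gamma>0 s by (metis atLeastAtMost_iff)
  have st: "pathstart \<gamma> = p" "pathfinish \<gamma> = p"
    unfolding \<gamma>_def using pathstart_shiftpath[of s \<gamma>0] pathfinish_shiftpath[of s \<gamma>0] \<gamma>0 s by auto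
  then have g01: "\<gamma> 0 = p" "\<gamma> 1 = p" by (auto simp: pathstart_def pathfinish_def)
  have cont: "continuous_on {0..1} \<gamma>" using sp simple_path_imp_path path_def by blast
  let ?h = "\<lambda>t. dist (\<gamma> t) p"
  have conth: "continuous_on {0..1} ?h" by (intro continuous_intros cont)
  define E where "E = {t \<in> {0..1}. r \<le> ?h t}"
  have "E = {0..1} \<inter> ?h -` {r..}" by (auto simp: E_def)
  then have "closed E" using continuous_closed_preimage[OF conth] by simp
  moreover have "bounded E" by (rule bounded_subset[of "{0..1}"]) (auto simp: E_def)
  ultimately have "compact E" by (simp add: compact_eq_bounded_closed)
  obtain t0 where t0: "t0 \<in> {0..1}" "\<gamma> t0 = q" using q im unfolding path_image_def by auto
  have t0E: "t0 \<in> E" using t0 q by (simp add: E_def)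
  obtain t1 where t1: "t1 \<in> E" "\<And>t. t \<in> E \<Longrightarrow> t1 \<le> t"
    using compact_attains_inf[OF \<open>compact E\<close>] t0E by blast
  obtain t2 where t2: "t2 \<in> E" "\<And>t. t \<in> E \<Longrightarrow> t \<le> t2"
    using compact_attains_sup[OF \<open>compact E\<close>] t0E by blast
  have h1: "?h t1 = r"
  proof (rule ccontr)
    assume "?h t1 \<noteq> r"
    then have gt: "r < ?h t1" using t1 by (simp add: E_def)
    obtain x where x: "0 \<le> x" "x \<le> t1" "?h x = r"
      using IVT'[of ?h 0 r t1] gt r g01(1) t1(1) continuous_on_subset[OF conth, of "{0..t1}"]
      by (fastforce simp: E_def)
    then have "x \<in> E" using t1 by (auto simp: E_def)
    then have "x = t1" using t1(2) x by force
    then show False using x gt by simp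
  qed
  have h2: "?h t2 = r"
  proof (rule ccontr)
    assume "?h t2 \<noteq> r"
    then have gt: "r < ?h t2" using t2 by (simp add: E_def)
    obtain x where x: "t2 \<le> x" "x \<le> 1" "?h x = r"
      using IVT2'[of ?h 1 r t2] gt r g01(2) t2(1) continuous_on_subset[OF conth, of "{t2..1}"]
      by (fastforce simp: E_def)
    then have "x \<in> E" using t2 by (auto simp: E_def)
    then have "x = t2" using t2(2) x by force
    then show False using x gt by simp
  qed
  have bet: "t1 \<in> {0..1}" "t2 \<in> {0..1}" using t1 t2 by (auto simp: E_def)
  have "t1 \<noteq> t0" "t2 \<noteq> t0" using h1 h2 q t0 by auto
  then have lt: "t1 < t2" using t1(2)[OF t0E] t2(2)[OF t0E] by linarith
  have "t1 \<noteq> 0" "t1 \<noteq> 1" "t2 \<noteq> 0" "t2 \<noteq> 1" using h1 h2 g01 r by auto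
  then have ord: "0 < t1" "t2 < 1" "t1 < 1" "0 < t2" using bet by auto
  have inj: "x = y" if "\<gamma> x = \<gamma> y" "x \<in> {0..1}" "y \<in> {0..1}" "\<not> (x = 0 \<and> y = 1)" "\<not> (x = 1 \<and> y = 0)" for x y
    using sp that unfolding simple_path_def loop_free_def by blast
  define u where "u = subpath t1 t2 \<gamma>"
  define d1 where "d1 = subpath t2 1 \<gamma>"
  define d2 where "d2 = subpath 0 t1 \<gamma>"
  have im': "path_image u = \<gamma> ` {t1..t2}" "path_image d1 = \<gamma> ` {t2..1}" "path_image d2 = \<gamma> ` {0..t1}"
    unfolding u_def d1_def d2_def using lt ord by (auto simp: path_image_subpath)
  have arcs: "arc u" "arc d1" "arc d2"
    unfolding u_def d1_def d2_def
    by (rule arc_simple_path_subpath_interior[OF sp]; use lt ord in simp)+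
  define d where "d = d1 +++ d2"
  have ends: "pathstart u = \<gamma> t1" "pathfinish u = \<gamma> t2" "pathstart d1 = \<gamma> t2" "pathfinish d1 = p"
     "pathstart d2 = p" "pathfinish d2 = \<gamma> t1"
    unfolding u_def d1_def d2_def by (auto simp: g01)
  have int: "path_image d1 \<inter> path_image d2 \<subseteq> {pathstart d2}"
  proof
    fix z assume "z \<in> path_image d1 \<inter> path_image d2"
    then obtain x y where "x \<in> {t2..1}" "y \<in> {0..t1}" "\<gamma> x = z" "\<gamma> y = z" unfolding im' by auto
    then show "z \<in> {pathstart d2}" using inj[of x y] lt ord g01 ends by (cases "x = 1 \<and> y = 0") auto
  qed
  have d: "arc d" unfolding d_def using arc_join[OF arcs(2,3) _ int] ends by simp
  have imd: "path_image d = \<gamma> ` {t2..1} \<union> \<gamma> ` {0..t1}"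
    unfolding d_def using ends im' by (simp add: path_image_join)
  show ?thesis
  proof
    show "arc u" "arc d" by fact+
    show "pathstart u = \<gamma> t1" "pathfinish u = \<gamma> t2" "pathstart d = \<gamma> t2" "pathfinish d = \<gamma> t1"
      using ends by (auto simp: d_def)
    show "path_image u \<inter> path_image d = {\<gamma> t1, \<gamma> t2}"
    proof
      show "path_image u \<inter> path_image d \<subseteq> {\<gamma> t1, \<gamma> t2}"
      proof
        fix z assume "z \<in> path_image u \<inter> path_image d"
        then have "z \<in> \<gamma> ` {t1..t2}" "z \<in> \<gamma> ` ({t2..1} \<union> {0..t1})" unfolding im' imd image_Un by blast+
        then obtain x y where "x \<in> {t1..t2}" "y \<in> {t2..1} \<union> {0..t1}" "\<gamma> x = z" "\<gamma> y = z"
          by (metis imageE)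
        then show "z \<in> {\<gamma> t1, \<gamma> t2}" using inj[of x y] lt ord by auto
      qed
      show "{\<gamma> t1, \<gamma> t2} \<subseteq> path_image u \<inter> path_image d" unfolding im' imd using lt ord by auto
    qed
    have "{0..1} = {t1..t2} \<union> ({t2..1} \<union> {0..t1})" using lt ord by auto
    then show "path_image u \<union> path_image d = J"
      unfolding im' imd im[symmetric] path_image_def[of \<gamma>] by (simp only: image_Un)
    show "p \<in> path_image d" unfolding imd using ord g01 by force
    show "path_image d \<subseteq> cball p r"
    proof
      fix z assume "z \<in> path_image d"
      then have "z \<in> \<gamma> ` ({t2..1} \<union> {0..t1})" unfolding imd image_Un .
      then obtain y where y: "y \<in> {t2..1} \<union> {0..t1}" "\<gamma> y = z" by (metis imageE)
      have "?h y \<le> r"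
      proof (rule ccontr)
        assume "\<not> ?h y \<le> r"
        then have "y \<in> E" using y ord by (auto simp: E_def)
        then have "y = t1 \<or> y = t2" using t1(2)[of y] t2(2)[of y] y by auto
        then show False using h1 h2 \<open>\<not> ?h y \<le> r\<close> by auto
      qed
      then show "z \<in> cball p r" using y by (simp add: dist_commute)
    qed
    show "dist (\<gamma> t1) p = r" "dist (\<gamma> t2) p = r" by (fact h1 h2)+
  qed
qed

text \<open>Take the arc \<open>A\<close> through \<open>p\<close> up to the exits from the disc of radius \<open>r\<close>. The complementary arc
  contains points too far from \<open>p\<close> for the symmetry estimate, so \<open>A\<close> is the smaller subarc between
  its endpoints and obeys the estimate. Another part of the curve cannot come back close to \<open>p\<close>: the subarc joining it to \<open>p\<close>
  would pass through an exit point, which the symmetry estimate forbids.\<close>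
lemma symmetric_quasicircle_local_arc:
  assumes S: "symmetric_quasicircle J" and e: "0 < \<epsilon>"
  obtains r0 where "0 < r0"
    "\<And>p r. p \<in> J \<Longrightarrow> 0 < r \<Longrightarrow> r < r0 \<Longrightarrow> \<exists>a b A. A \<subseteq> J \<and> connected A \<and> a \<in> A \<and> b \<in> A \<and> p \<in> A \<and>
        dist a p = r \<and> dist b p = r \<and> (\<forall>w\<in>A. dist a w + dist w b \<le> (1 + \<epsilon>) * dist a b) \<and>
        J \<inter> ball p (r / (1 + \<epsilon>)) \<subseteq> A"
proof -
  have J: "jordan_curve J" using S by (simp add: symmetric_quasicircle_iff)
  obtain \<delta> where \<delta>: "0 < \<delta>" "\<And>a b w. a \<in> J \<Longrightarrow> b \<in> J \<Longrightarrow> a \<noteq> b \<Longrightarrow> dist a b < \<delta> \<Longrightarrow>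
      w \<in> smaller_subarc J a b \<Longrightarrow> dist a w + dist w b \<le> (1 + \<epsilon>) * dist a b"
    using S e unfolding symmetric_quasicircle_iff by metis
  obtain \<gamma> where \<gamma>: "simple_path \<gamma>" "path_image \<gamma> = J" using J unfolding jordan_curve_def by blast
  have "\<gamma> 0 \<noteq> \<gamma> (1/2)" using \<gamma>(1) unfolding simple_path_def loop_free_def
    by (force dest: bspec[of _ _ 0] bspec[of _ _ "1/2"])
  moreover have "\<gamma> 0 \<in> J" "\<gamma> (1/2) \<in> J" using \<gamma> by (auto simp: path_image_def)
  ultimately obtain q1 q2 where q12: "q1 \<in> J" "q2 \<in> J" "q1 \<noteq> q2" by metis
  define r0 where "r0 = min (\<delta> / 2) (dist q1 q2 / (2 * (3 + 2 * \<epsilon>)))"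
  have "0 < r0" using \<delta> q12 e by (simp add: r0_def)
  moreover have "\<exists>a b A. A \<subseteq> J \<and> connected A \<and> a \<in> A \<and> b \<in> A \<and> p \<in> A \<and>
        dist a p = r \<and> dist b p = r \<and> (\<forall>w\<in>A. dist a w + dist w b \<le> (1 + \<epsilon>) * dist a b) \<and>
        J \<inter> ball p (r / (1 + \<epsilon>)) \<subseteq> A"
    if p: "p \<in> J" and r: "0 < r" "r < r0" for p r
  proof -
    have big: "\<exists>q\<in>J. (3 + 2 * \<epsilon>) * r < dist q p"
    proof (rule ccontr)
      assume "\<not> ?thesis"
      then have "dist q1 p \<le> (3 + 2 * \<epsilon>) * r" "dist q2 p \<le> (3 + 2 * \<epsilon>) * r" using q12 by force+
      then have "dist q1 q2 \<le> (3 + 2 * \<epsilon>) * r + (3 + 2 * \<epsilon>) * r" using dist_triangle2[of q1 q2 p] by linarith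
      moreover have "r * (2 * (3 + 2 * \<epsilon>)) < dist q1 q2" using r e by (simp add: r0_def less_divide_eq)
      ultimately show False by (simp add: algebra_simps)
    qed
    then obtain q where q: "q \<in> J" "(3 + 2 * \<epsilon>) * r < dist q p" by blast
    have "1 * r \<le> (3 + 2 * \<epsilon>) * r" using e r by (intro mult_right_mono) auto
    then have "r < dist q p" using q by linarith
    then obtain a b u d where ud: "arc u" "pathstart u = a" "pathfinish u = b"
      "arc d" "pathstart d = b" "pathfinish d = a"
      "path_image u \<inter> path_image d = {a, b}" "path_image u \<union> path_image d = J"
      "p \<in> path_image d" "path_image d \<subseteq> cball p r" "dist a p = r" "dist b p = r"
      using arc_until_exit[OF J p q(1) _ r(1)] by metis
    have ab: "a \<in> path_image d" "b \<in> path_image d" "a \<in> path_image u" "b \<in> path_image u" using ud by blast+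
    have abJ: "a \<in> J" "b \<in> J" "a \<noteq> b" using ab ud arc_distinct_ends[OF ud(1)] by auto
    have dab: "dist a b \<le> 2 * r" using dist_triangle2[of a b p] ud by linarith
    then have "dist a b < \<delta>" using r by (simp add: r0_def)
    note w = \<delta>(2)[OF abJ this]
    have "smaller_subarc J a b \<in> {path_image u, path_image d}"
      using smaller_subarc(1)[OF J abJ] subarcs_of_double_arc[OF ud(1-8)] by simp
    moreover have "smaller_subarc J a b \<noteq> path_image u"
    proof
      assume eq: "smaller_subarc J a b = path_image u"
      show False
      proof (cases "q \<in> path_image u")
        case True
        have "dist a q + dist q b \<le> (1 + \<epsilon>) * dist a b" using w eq True by simp
        also have "\<dots> \<le> (1 + \<epsilon>) * (2 * r)" using dab e by (intro mult_left_mono) auto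
        finally have "dist a q \<le> (1 + \<epsilon>) * (2 * r)" using zero_le_dist[of q b] by linarith
        then have "dist q p \<le> (1 + \<epsilon>) * (2 * r) + r"
          using dist_triangle[of q p a] ud(11) dist_commute[of a q] by linarith
        then show False using q by (simp add: algebra_simps)
      next
        case False
        then have "q \<in> cball p r" using q ud by blast
        then show False using \<open>r < dist q p\<close> by (simp add: dist_commute)
      qed
    qed
    ultimately have eq: "smaller_subarc J a b = path_image d" by simp
    have "J \<inter> ball p (r / (1 + \<epsilon>)) \<subseteq> path_image d"
    proof (rule ccontr)
      assume "\<not> ?thesis"
      then obtain y where y: "y \<in> J" "y \<in> ball p (r / (1 + \<epsilon>))" "y \<notin> path_image d" by blast
      have py: "p \<noteq> y" using y ud by auto
      have ydist: "(1 + \<epsilon>) * dist p y < r" using y e by (simp add: less_divide_eq mult.commute)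
      moreover have "1 * dist p y \<le> (1 + \<epsilon>) * dist p y" using e by (intro mult_right_mono) auto
      ultimately have "dist p y < r" by linarith
      then have "dist p y < \<delta>" using r \<delta> by (simp add: r0_def)
      note w2 = \<delta>(2)[OF p y(1) py this]
      obtain \<sigma> where \<sigma>: "arc \<sigma>" "path_image \<sigma> = smaller_subarc J p y" "path_image \<sigma> \<subseteq> J" "pathstart \<sigma> = p" "pathfinish \<sigma> = y"
        using smaller_subarc(1)[OF J p y(1) py] unfolding subarcs_def by auto
      have "dist p v < r" if "v \<in> path_image \<sigma>" for v
        using w2[of v] that ydist zero_le_dist[of v y] unfolding \<sigma>(2) by linarith
      then have "a \<notin> path_image \<sigma>" "b \<notin> path_image \<sigma>" using ud by (metis dist_commute less_irrefl)+
      moreover have "connected (path_image \<sigma>)" using \<sigma> connected_arc_image by blast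
      moreover have "closed (path_image u)" "closed (path_image d)" using ud closed_arc_image by auto
      moreover have "p \<in> path_image \<sigma>" "y \<in> path_image \<sigma>" using \<sigma> pathstart_in_path_image pathfinish_in_path_image by metis+
      moreover have "path_image u \<inter> path_image d \<inter> path_image \<sigma> = {}" 
        using calculation(1,2) ud(7) by auto
      moreover have "path_image \<sigma> \<subseteq> path_image u \<union> path_image d" using \<sigma>(3) ud(8) by simp
      ultimately have "path_image u \<inter> path_image \<sigma> = {} \<or> path_image d \<inter> path_image \<sigma> = {}"
        unfolding connected_closed by blast
      moreover have "y \<in> path_image u" using y ud(8) by blast
      ultimately show False using \<open>p \<in> path_image \<sigma>\<close> \<open>y \<in> path_image \<sigma>\<close> ud(9) by blast
    qed
    then show ?thesis
      using ud ab w eq connected_arc_image[OF ud(4)]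
      by (intro exI[of _ a] exI[of _ b] exI[of _ "path_image d"]) auto
  qed
  ultimately show ?thesis by (rule that)
qed

text \<open>The normalisation puts the reference point at \<open>0\<close> and its nearest boundary point at \<open>1\<close>.
  Since \<open>1\<close> lies on the arc at distance \<open>R\<close> from both ends, the symmetry estimate makes the ends nearly
  antipodal about \<open>1\<close>, and it confines the arc to a thin ellipse around the chord. The chord line
  passes close to \<open>1\<close> and cannot enter the unit disc deeply, so it is nearly the tangent \<open>Re w = 1\<close>.
  The second conclusion holds because the arc is connected and therefore follows the chord over its
  whole length.\<close>
lemma thin_arc_nearly_vertical:
  assumes R: "2 \<le> (R::real)" and \<eta>: "0 < \<eta>"
  obtains \<epsilon> :: real where "0 < \<epsilon>" "\<epsilon> < 1"
    "\<And>a b (A::complex set). connected A \<Longrightarrow> a \<in> A \<Longrightarrow> b \<in> A \<Longrightarrow> 1 \<in> A \<Longrightarrow> dist a 1 = R \<Longrightarrow> dist b 1 = R \<Longrightarrow>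
       \<forall>w\<in>A. dist a w + dist w b \<le> (1 + \<epsilon>) * dist a b \<Longrightarrow> \<forall>w\<in>A. 1 \<le> norm w \<Longrightarrow>
       (\<forall>w\<in>A. \<bar>Re w - 1\<bar> \<le> \<eta>) \<and> (\<forall>y. \<bar>y\<bar> \<le> R / 2 \<longrightarrow> (\<exists>w\<in>A. dist w (Complex 1 y) \<le> \<eta>))"
proof -
  define \<kappa> where "\<kappa> = min 1 ((\<eta> / (1 + 4 * R))\<^sup>2)"
  have \<kappa>: "0 < \<kappa>" "\<kappa> \<le> 1" using R \<eta> by (auto simp: \<kappa>_def)
  have \<kappa>\<eta>: "\<kappa> + 2 * R * sqrt (2 * \<kappa>) \<le> \<eta>"
  proof -
    have s: "sqrt \<kappa> \<le> \<eta> / (1 + 4 * R)"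
      by (rule real_le_lsqrt) (use R \<eta> in \<open>auto simp: \<kappa>_def\<close>)
    have "sqrt (2 * \<kappa>) \<le> sqrt (4 * \<kappa>)" using \<kappa> by simp
    then have "sqrt (2 * \<kappa>) \<le> 2 * sqrt \<kappa>" by (simp add: real_sqrt_mult)
    then have "2 * R * sqrt (2 * \<kappa>) \<le> 2 * R * (2 * sqrt \<kappa>)" using R by (intro mult_left_mono) auto
    moreover have "\<kappa> \<le> sqrt \<kappa>" using \<kappa> by (intro real_le_rsqrt) (auto simp: power2_eq_square mult_left_le)
    ultimately have "\<kappa> + 2 * R * sqrt (2 * \<kappa>) \<le> sqrt \<kappa> * (1 + 4 * R)" by (simp add: algebra_simps)
    also have "\<dots> \<le> \<eta> / (1 + 4 * R) * (1 + 4 * R)" using s R by (intro mult_right_mono) auto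
    finally show ?thesis using R by simp
  qed
  \<comment> \<open>Chosen so that both the offset and the half-width of the ellipse are at most \<open>\<kappa> / 2\<close>.\<close>
  define \<epsilon> where "\<epsilon> = (\<kappa> / (2 * R))\<^sup>2 / 3"
  have "(\<kappa> / (2 * R))\<^sup>2 \<le> 1\<^sup>2" using \<kappa> R by (intro power_mono) auto
  then have \<epsilon>: "0 < \<epsilon>" "\<epsilon> < 1" using \<kappa> R by (auto simp: \<epsilon>_def)
  have \<epsilon>R: "3 * \<epsilon> * R\<^sup>2 = (\<kappa> / 2)\<^sup>2" using R by (simp add: \<epsilon>_def power_divide power_mult_distrib)
  show ?thesis
  proof (rule that[OF \<epsilon>], goal_cases)
    case (1 a b A)
    note con = 1(1) and aA = 1(2) and bA = 1(3) and one = 1(4) and ab = 1(5,6) and ell = 1(7)[rule_format] and out = 1(8)[rule_format]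
    define c where "c = dist a b / 2"
    have cR: "R \<le> (1 + \<epsilon>) * c" using ell[OF one] ab by (simp add: c_def dist_commute)
    have cR': "c \<le> R" using dist_triangle2[of a b 1] ab by (simp add: c_def)
    have c0: "0 < c" using cR R \<epsilon> by (smt (verit) mult_nonneg_nonpos)
    have c1: "R / 2 \<le> c"
    proof -
      have "(1 + \<epsilon>) * c \<le> 2 * c" using \<epsilon> c0 by (intro mult_right_mono) auto
      then show ?thesis using cR by simp
    qed
    define u where "u = (a - b) / of_real (2 * c)"
    have un: "norm u = 1" using c0 by (simp add: u_def norm_divide c_def dist_norm)
    have uu: "u * cnj u = 1" using un by (simp add: complex_norm_square[symmetric])
    define N where "N = (\<lambda>w. (w - 1) * cnj u)"
    have N: "w = 1 + u * N w" for w
      unfolding N_def using uu by (simp add: algebra_simps)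
    have Nn: "norm (N w) = dist w 1" for w by (simp add: N_def norm_mult un dist_norm)
    have Nab: "N a - N b = of_real (2 * c)"
    proof -
      have "N a - N b = (a - b) * cnj u" by (simp add: N_def algebra_simps)
      also have "a - b = of_real (2 * c) * u" using c0 by (simp add: u_def)
      finally show ?thesis using uu by (simp add: mult.assoc)
    qed
    have "Re (N a) - Re (N b) = 2 * c" "Im (N a) = Im (N b)"
      using arg_cong[OF Nab, of Re] arg_cong[OF Nab, of Im] by auto
    moreover have "(Re (N a))\<^sup>2 + (Im (N a))\<^sup>2 = R\<^sup>2" "(Re (N b))\<^sup>2 + (Im (N b))\<^sup>2 = R\<^sup>2"
      using Nn[of a] Nn[of b] ab by (metis cmod_power2)+
    ultimately have "(Re (N a))\<^sup>2 = (Re (N b))\<^sup>2" "Re (N a) \<noteq> Re (N b)" using c0 by auto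
    then have "Re (N a) = - Re (N b)" by (simp add: power2_eq_iff)
    then have Na: "Re (N a) = c" "Re (N b) = - c" using \<open>Re (N a) - Re (N b) = 2 * c\<close> by auto
    define y0 where "y0 = Im (N a)"
    have Nb: "Im (N b) = y0" using \<open>Im (N a) = Im (N b)\<close> by (simp add: y0_def)
    have eps2: "(1 + \<epsilon>)\<^sup>2 * c\<^sup>2 - c\<^sup>2 \<le> (\<kappa> / 2)\<^sup>2"
    proof -
      have "(1 + \<epsilon>)\<^sup>2 - 1 \<le> 3 * \<epsilon>" using \<epsilon> by (simp add: power2_eq_square algebra_simps)
      then have "((1 + \<epsilon>)\<^sup>2 - 1) * c\<^sup>2 \<le> 3 * \<epsilon> * R\<^sup>2" using cR' c0 \<epsilon> by (intro mult_mono power_mono) auto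
      then show ?thesis unfolding \<epsilon>R by (simp add: algebra_simps)
    qed
    have y0: "\<bar>y0\<bar> \<le> \<kappa> / 2"
    proof -
      have "R\<^sup>2 \<le> ((1 + \<epsilon>) * c)\<^sup>2" using cR R by (intro power_mono) auto
      moreover have "c\<^sup>2 + y0\<^sup>2 = R\<^sup>2" using \<open>(Re (N a))\<^sup>2 + (Im (N a))\<^sup>2 = R\<^sup>2\<close> Na by (simp add: y0_def)
      ultimately have "y0\<^sup>2 \<le> (\<kappa> / 2)\<^sup>2" using eps2 by (simp add: power_mult_distrib)
      then show ?thesis using \<kappa> by (metis abs_le_square_iff abs_of_nonneg divide_nonneg_nonneg less_imp_le zero_le_numeral)
    qed
    have strip: "\<bar>Im (N w)\<bar> \<le> \<kappa>" "\<bar>Re (N w)\<bar> \<le> 2 * R" if w: "w \<in> A" for w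
    proof -
      define P where "P = N a - N w"
      define Q where "Q = N w - N b"
      have PQ: "dist a w = norm P" "dist w b = norm Q"
      proof -
        have "P = (a - w) * cnj u" "Q = (w - b) * cnj u" by (simp_all add: P_def Q_def N_def algebra_simps)
        then show "dist a w = norm P" "dist w b = norm Q" by (simp_all add: norm_mult un dist_norm)
      qed
      have le: "norm P + norm Q \<le> (1 + \<epsilon>) * (2 * c)" using ell[OF w] PQ by (simp add: c_def)
      \<comment> \<open>Reflecting \<open>Q\<close> in the chord turns the sum of the two focal distances into one vector.\<close>
      have "norm (P + cnj Q) \<le> norm P + norm Q" using norm_triangle_ineq[of P "cnj Q"] by simp
      then have "norm (P + cnj Q) \<le> 2 * ((1 + \<epsilon>) * c)" using le by simp
      then have "(norm (P + cnj Q))\<^sup>2 \<le> (2 * ((1 + \<epsilon>) * c))\<^sup>2" by (intro power_mono) auto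
      moreover have "(norm (P + cnj Q))\<^sup>2 = 4 * (c\<^sup>2 + (y0 - Im (N w))\<^sup>2)"
        unfolding cmod_power2 by (simp add: P_def Q_def Na Nb flip: y0_def) (simp add: power2_eq_square algebra_simps)
      ultimately have "(y0 - Im (N w))\<^sup>2 \<le> (\<kappa> / 2)\<^sup>2" using eps2 by (simp add: power_mult_distrib)
      then have "\<bar>y0 - Im (N w)\<bar> \<le> \<kappa> / 2" using \<kappa> by (metis abs_le_square_iff abs_of_nonneg divide_nonneg_nonneg less_imp_le zero_le_numeral)
      then show "\<bar>Im (N w)\<bar> \<le> \<kappa>" using y0 by linarith
      have "\<bar>c - Re (N w)\<bar> \<le> norm P" "\<bar>Re (N w) + c\<bar> \<le> norm Q"
        using abs_Re_le_cmod[of P] abs_Re_le_cmod[of Q] by (simp_all add: P_def Q_def Na)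
      moreover have "(1 + \<epsilon>) * (2 * c) \<le> 2 * (2 * R)" using \<epsilon> c0 cR' by (intro mult_mono) auto
      ultimately show "\<bar>Re (N w)\<bar> \<le> 2 * R" using le by linarith
    qed
    have ivt: "\<exists>w\<in>A. Re (N w) = x" if "\<bar>x\<bar> \<le> c" for x
    proof -
      have "connected ((\<lambda>w. Re (N w)) ` A)"
        unfolding N_def by (intro connected_continuous_image con continuous_intros)
      then have "{- c..c} \<subseteq> (\<lambda>w. Re (N w)) ` A" by (rule connected_contains_Icc) (use Na aA bA in force)+
      then show ?thesis using that by (auto simp: abs_le_iff subset_iff image_iff) (metis minus_le_iff)
    qed
    define \<sigma> where "\<sigma> = Re u"
    define \<tau> where "\<tau> = Im u"
    have \<sigma>\<tau>: "\<sigma>\<^sup>2 + \<tau>\<^sup>2 = 1" using un cmod_power2[of u] by (simp add: \<sigma>_def \<tau>_def)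
    have u_eq: "u = Complex \<sigma> \<tau>" by (simp add: \<sigma>_def \<tau>_def complex_eq_iff)
    have \<sigma>1: "\<bar>\<sigma>\<bar> \<le> 1" "\<bar>\<tau>\<bar> \<le> 1" using abs_Re_le_cmod[of u] abs_Im_le_cmod[of u] un by (simp_all add: \<sigma>_def \<tau>_def)
    \<comment> \<open>The arc has a point near the foot of the perpendicular from \<open>0\<close> to the parallel of the chord through \<open>1\<close>.\<close>
    have \<sigma>: "\<sigma>\<^sup>2 \<le> 2 * \<kappa>"
    proof -
      obtain w where w: "w \<in> A" "Re (N w) = - \<sigma>" using ivt[of "- \<sigma>"] \<sigma>1 c1 R by auto
      define Y where "Y = Im (N w)"
      have "w = 1 + u * N w" by (rule N)
      also have "N w = Complex (- \<sigma>) Y" using w by (simp add: Y_def complex_eq_iff)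
      also have "1 + u * Complex (- \<sigma>) Y = (1 - of_real \<sigma> * u) + u * (\<i> * of_real Y)"
        by (simp add: complex_eq_iff)
      finally have "norm w \<le> norm (1 - of_real \<sigma> * u) + norm (u * (\<i> * of_real Y))" using norm_triangle_ineq by metis
      also have "norm (u * (\<i> * of_real Y)) \<le> \<kappa>" using strip(1)[OF w(1)] by (simp add: norm_mult un Y_def)
      finally have n: "1 - \<kappa> \<le> norm (1 - of_real \<sigma> * u)" using out[OF w(1)] by linarith
      have "(norm (1 - of_real \<sigma> * u))\<^sup>2 = (1 - \<sigma>\<^sup>2)\<^sup>2 + \<sigma>\<^sup>2 * \<tau>\<^sup>2"
        unfolding cmod_power2 u_eq by (simp add: power2_eq_square)
      also have "\<dots> = 1 - \<sigma>\<^sup>2"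
      proof -
        have t: "\<tau>\<^sup>2 = 1 - \<sigma>\<^sup>2" using \<sigma>\<tau> by simp
        show ?thesis unfolding t by (simp add: power2_eq_square algebra_simps)
      qed
      finally have "(1 - \<kappa>)\<^sup>2 \<le> 1 - \<sigma>\<^sup>2" using n \<kappa> by (metis power_mono diff_ge_0_iff_ge)
      moreover have "1 - 2 * \<kappa> \<le> (1 - \<kappa>)\<^sup>2" by (simp add: power2_eq_square algebra_simps)
      ultimately show ?thesis by linarith
    qed
    have \<sigma>s: "\<bar>\<sigma>\<bar> \<le> sqrt (2 * \<kappa>)" using \<sigma> real_le_rsqrt[of "\<bar>\<sigma>\<bar>"] by simp
    show ?case
    proof (intro conjI ballI allI impI)
      fix w assume w: "w \<in> A"
      have "Re w - 1 = \<sigma> * Re (N w) - \<tau> * Im (N w)" using arg_cong[OF N[of w], of Re] by (simp add: \<sigma>_def \<tau>_def)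
      then have "\<bar>Re w - 1\<bar> \<le> \<bar>\<sigma>\<bar> * \<bar>Re (N w)\<bar> + \<bar>\<tau>\<bar> * \<bar>Im (N w)\<bar>"
        using abs_triangle_ineq4[of "\<sigma> * Re (N w)" "\<tau> * Im (N w)"] by (simp add: abs_mult)
      also have "\<dots> \<le> sqrt (2 * \<kappa>) * (2 * R) + 1 * \<kappa>"
        using strip[OF w] \<sigma>1 \<sigma>s \<kappa> by (intro add_mono mult_mono) auto
      finally show "\<bar>Re w - 1\<bar> \<le> \<eta>" using \<kappa>\<eta> by (simp add: algebra_simps)
    next
      fix y :: real assume y: "\<bar>y\<bar> \<le> R / 2"
      define s :: real where "s = (if 0 \<le> \<tau> then 1 else - 1)"
      have s: "\<bar>s\<bar> = 1" "s * \<tau> = \<bar>\<tau>\<bar>" by (auto simp: s_def)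
      obtain w where w: "w \<in> A" "Re (N w) = y * s" using ivt[of "y * s"] y s c1 by (auto simp: abs_mult)
      define Y where "Y = Im (N w)"
      have "w = 1 + u * N w" by (rule N)
      also have "N w = Complex (y * s) Y" using w by (simp add: Y_def complex_eq_iff)
      also have "1 + u * Complex (y * s) Y = Complex 1 y + Complex (\<sigma> * y * s - \<tau> * Y) (y * (s * \<tau> - 1) + \<sigma> * Y)"
        unfolding u_eq by (simp add: complex_eq_iff algebra_simps)
      finally have "w - Complex 1 y = u * (\<i> * of_real Y) + Complex (\<sigma> * y * s) (y * (s * \<tau> - 1))"
        unfolding u_eq by (simp add: complex_eq_iff)
      then have "dist w (Complex 1 y) \<le> norm (u * (\<i> * of_real Y)) + norm (Complex (\<sigma> * y * s) (y * (s * \<tau> - 1)))"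
        unfolding dist_norm using norm_triangle_ineq by metis
      also have "norm (u * (\<i> * of_real Y)) \<le> \<kappa>" using strip(1)[OF w(1)] by (simp add: norm_mult un Y_def)
      also have "norm (Complex (\<sigma> * y * s) (y * (s * \<tau> - 1))) \<le> \<bar>\<sigma> * y * s\<bar> + \<bar>y * (s * \<tau> - 1)\<bar>"
        using cmod_le[of "Complex (\<sigma> * y * s) (y * (s * \<tau> - 1))"] by simp
      also have "\<bar>\<sigma> * y * s\<bar> = \<bar>y\<bar> * \<bar>\<sigma>\<bar>" using s by (simp add: abs_mult)
      also have "\<bar>y * (s * \<tau> - 1)\<bar> \<le> \<bar>y\<bar> * \<bar>\<sigma>\<bar>"
      proof -
        have "\<bar>\<tau>\<bar>\<^sup>2 \<le> \<bar>\<tau>\<bar>" "\<bar>\<sigma>\<bar>\<^sup>2 \<le> \<bar>\<sigma>\<bar>" using mult_left_le[of "\<bar>\<tau>\<bar>" "\<bar>\<tau>\<bar>"] mult_left_le[of "\<bar>\<sigma>\<bar>" "\<bar>\<sigma>\<bar>"] \<sigma>1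
          by (auto simp: power2_eq_square simp del: abs_mult_self_eq)
        then have "\<bar>\<bar>\<tau>\<bar> - 1\<bar> \<le> \<bar>\<sigma>\<bar>" using \<sigma>\<tau> \<sigma>1 by simp
        then show ?thesis unfolding s abs_mult by (intro mult_left_mono) auto
      qed
      finally have "dist w (Complex 1 y) \<le> \<kappa> + (\<bar>y\<bar> * \<bar>\<sigma>\<bar> + \<bar>y\<bar> * \<bar>\<sigma>\<bar>)" by simp
      also have "\<bar>y\<bar> * \<bar>\<sigma>\<bar> \<le> R * sqrt (2 * \<kappa>)" using y \<sigma>s R by (intro mult_mono) auto
      finally have "dist w (Complex 1 y) \<le> \<eta>" using \<kappa>\<eta> by simp
      then show "\<exists>w\<in>A. dist w (Complex 1 y) \<le> \<eta>" using w by blast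
    qed
  qed
qed

text \<open>In the affine coordinate \<open>(q - w0) / (p - w0)\<close>, where \<open>p\<close> is a boundary point nearest to \<open>w0\<close>,
  the curve is close to the line \<open>Re = 1\<close> at every fixed scale \<open>R\<close>, once \<open>w0\<close> is close to the curve:
  it stays near the line, and it comes near to every point of the line.\<close>
lemma symmetric_quasicircle_nearly_straight:
  assumes S: "symmetric_quasicircle J" and R: "1 \<le> R" and \<eta>: "0 < \<eta>"
  obtains d0 where "0 < d0"
    "\<And>w0 p. p \<in> J \<Longrightarrow> w0 \<notin> J \<Longrightarrow> (\<And>q. q \<in> J \<Longrightarrow> dist w0 p \<le> dist w0 q) \<Longrightarrow> dist w0 p < d0 \<Longrightarrow>
       (\<forall>q\<in>J. dist p q \<le> R * dist w0 p \<longrightarrow> \<bar>Re ((q - w0) / (p - w0)) - 1\<bar> \<le> \<eta>) \<and>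
       (\<forall>y. \<bar>y\<bar> \<le> R \<longrightarrow> (\<exists>q\<in>J. dist ((q - w0) / (p - w0)) (Complex 1 y) \<le> \<eta>))"
proof -
  have R2: "2 \<le> 2 * R" using R by simp
  obtain \<epsilon> where \<epsilon>: "0 < \<epsilon>" "\<epsilon> < 1" and thin: "\<And>a b (A::complex set). connected A \<Longrightarrow> a \<in> A \<Longrightarrow> b \<in> A \<Longrightarrow> 1 \<in> A \<Longrightarrow> dist a 1 = 2 * R \<Longrightarrow> dist b 1 = 2 * R \<Longrightarrow>
       \<forall>w\<in>A. dist a w + dist w b \<le> (1 + \<epsilon>) * dist a b \<Longrightarrow> \<forall>w\<in>A. 1 \<le> norm w \<Longrightarrow>
       (\<forall>w\<in>A. \<bar>Re w - 1\<bar> \<le> \<eta>) \<and> (\<forall>y. \<bar>y\<bar> \<le> 2 * R / 2 \<longrightarrow> (\<exists>w\<in>A. dist w (Complex 1 y) \<le> \<eta>))"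
    by (rule thin_arc_nearly_vertical[OF R2 \<eta>]; (assumption | (rule that; assumption)))
  obtain r0 where r0: "0 < r0" and loc: "\<And>p r. p \<in> J \<Longrightarrow> 0 < r \<Longrightarrow> r < r0 \<Longrightarrow> \<exists>a b A. A \<subseteq> J \<and> connected A \<and> a \<in> A \<and> b \<in> A \<and> p \<in> A \<and>
        dist a p = r \<and> dist b p = r \<and> (\<forall>w\<in>A. dist a w + dist w b \<le> (1 + \<epsilon>) * dist a b) \<and>
        J \<inter> ball p (r / (1 + \<epsilon>)) \<subseteq> A"
    by (rule symmetric_quasicircle_local_arc[OF S \<epsilon>(1)]; (assumption | (rule that; assumption)))
  show ?thesis
  proof (rule that[of "r0 / (2 * R)"])
    show "0 < r0 / (2 * R)" using r0 R by simp
    fix w0 p assume p: "p \<in> J" "w0 \<notin> J" and near: "\<And>q. q \<in> J \<Longrightarrow> dist w0 p \<le> dist w0 q"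
      and d: "dist w0 p < r0 / (2 * R)"
    define D where "D = p - w0"
    have D0: "D \<noteq> 0" using p by (auto simp: D_def)
    have nD: "norm D = dist w0 p" by (simp add: D_def dist_norm norm_minus_commute)
    have nD0: "0 < norm D" using D0 by simp
    define r where "r = 2 * R * norm D"
    have r: "0 < r" "r < r0" using nD0 R d by (auto simp: r_def nD less_divide_eq mult.commute)
    obtain a b A where A: "A \<subseteq> J" "connected A" "a \<in> A" "b \<in> A" "p \<in> A"
        "dist a p = r" "dist b p = r" "\<And>w. w \<in> A \<Longrightarrow> dist a w + dist w b \<le> (1 + \<epsilon>) * dist a b"
        "J \<inter> ball p (r / (1 + \<epsilon>)) \<subseteq> A"
      using loc[OF p(1) r] by blast
    define m where "m = (\<lambda>w. (w - w0) / D)"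
    have md: "dist (m v) (m w) = dist v w / norm D" for v w
    proof -
      have "m v - m w = (v - w) / D" by (simp add: m_def diff_divide_distrib)
      then show ?thesis by (simp add: dist_norm norm_divide)
    qed
    have mp: "m p = 1" using D0 by (simp add: m_def D_def)
    have flat: "(\<forall>w\<in>m ` A. \<bar>Re w - 1\<bar> \<le> \<eta>) \<and> (\<forall>y. \<bar>y\<bar> \<le> 2 * R / 2 \<longrightarrow> (\<exists>w\<in>m ` A. dist w (Complex 1 y) \<le> \<eta>))"
    proof (rule thin; (intro ballI)?)
      show "connected (m ` A)" unfolding m_def using D0 by (intro connected_continuous_image A continuous_intros) auto
      show "m a \<in> m ` A" "m b \<in> m ` A" using A by auto
      show "1 \<in> m ` A" using A mp by (metis image_eqI)
      show "dist (m a) 1 = 2 * R" "dist (m b) 1 = 2 * R"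
        using md[of a p] md[of b p] mp A D0 by (auto simp: r_def)
      fix w assume "w \<in> m ` A"
      then obtain v where v: "v \<in> A" "w = m v" by blast
      show "dist (m a) w + dist w (m b) \<le> (1 + \<epsilon>) * dist (m a) (m b)"
        using A(8)[OF v(1)] nD0 by (simp add: v md divide_right_mono flip: add_divide_distrib)
      have "norm D \<le> dist w0 v" using near[of v] v A nD by auto
      then show "1 \<le> norm w" using nD0 by (simp add: v m_def norm_divide dist_norm norm_minus_commute)
    qed
    show "(\<forall>q\<in>J. dist p q \<le> R * dist w0 p \<longrightarrow> \<bar>Re ((q - w0) / (p - w0)) - 1\<bar> \<le> \<eta>) \<and>
       (\<forall>y. \<bar>y\<bar> \<le> R \<longrightarrow> (\<exists>q\<in>J. dist ((q - w0) / (p - w0)) (Complex 1 y) \<le> \<eta>))"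
    proof (intro conjI ballI allI impI)
      fix q assume q: "q \<in> J" "dist p q \<le> R * dist w0 p"
      have "R * norm D * (1 + \<epsilon>) < R * norm D * 2" using \<epsilon> R nD0 by (intro mult_strict_left_mono) auto
      then have "R * dist w0 p < r / (1 + \<epsilon>)" using \<epsilon> by (simp add: r_def less_divide_eq nD)
      then have "q \<in> A" using A(9) q by auto
      then show "\<bar>Re ((q - w0) / (p - w0)) - 1\<bar> \<le> \<eta>" using flat by (auto simp: m_def D_def)
    next
      fix y :: real assume "\<bar>y\<bar> \<le> R"
      then obtain q where "q \<in> A" "dist (m q) (Complex 1 y) \<le> \<eta>" using flat by auto
      then show "\<exists>q\<in>J. dist ((q - w0) / (p - w0)) (Complex 1 y) \<le> \<eta>"
        using A(1) by (auto simp: m_def D_def)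
    qed
  qed
qed

section \<open>From the pre-Schwarzian derivative to asymptotic symmetry\<close>

text \<open>The condition that \<open>log f'\<close> belongs to the little Bloch space.\<close>
definition vanishing_pre_schwarzian :: "(complex \<Rightarrow> complex) \<Rightarrow> bool" where
  "vanishing_pre_schwarzian f \<longleftrightarrow>
     (\<forall>\<epsilon>>0. \<exists>\<rho><1. \<forall>z. \<rho> \<le> norm z \<and> norm z < 1 \<longrightarrow>
        (1 - norm z) * norm (deriv (deriv f) z / deriv f z) \<le> \<epsilon>)"

text \<open>The derivative of \<open>s \<mapsto> exp (s w)\<close> is dominated by that of \<open>s \<mapsto> exp (s |w|)\<close>.\<close>
lemma norm_exp_minus_one_le:
  fixes w :: complex
  assumes "norm w \<le> B"
  shows "norm (exp w - 1) \<le> exp B - 1"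
proof -
  have "norm (exp (1 *\<^sub>R w) - exp (0 *\<^sub>R w)) \<le> exp (1 * norm w) - exp (0 * norm w)"
  proof (rule differentiable_bound_general)
    show "((\<lambda>s. exp (s *\<^sub>R w)) has_vector_derivative w * exp (s *\<^sub>R w)) (at s)" for s
      using exp_scaleR_has_vector_derivative_left by blast
    show "((\<lambda>s. exp (s * norm w)) has_vector_derivative norm w * exp (s * norm w)) (at s)" for s
      by (auto intro!: derivative_eq_intros simp: has_real_derivative_iff_has_vector_derivative[symmetric])
    show "norm (w * exp (s *\<^sub>R w)) \<le> norm w * exp (s * norm w)" if "0 < s" for s
    proof -
      have "Re (s *\<^sub>R w) \<le> s * norm w" using that complex_Re_le_cmod[of w] by simp
      then have "norm (exp (s *\<^sub>R w)) \<le> exp (s * norm w)" by simp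
      then show ?thesis by (simp add: norm_mult mult_left_mono)
    qed
  qed (auto intro!: continuous_intros)
  then have "norm (exp w - 1) \<le> exp (norm w) - 1" by simp
  also have "\<dots> \<le> exp B - 1" using assms by simp
  finally show ?thesis .
qed

lemma shrink_in_ball:
  fixes x :: complex
  assumes "norm x < 1" "0 \<le> s" "s \<le> 1"
  shows "norm ((1 - of_real s) * x) < 1" "s \<le> 1 - norm ((1 - of_real s) * x)"
proof -
  have e: "norm ((1 - of_real s) * x) = (1 - s) * norm x"
  proof -
    have "norm (1 - of_real s :: complex) = norm (of_real (1 - s) :: complex)" by simp
    also have "\<dots> = 1 - s" unfolding norm_of_real using assms by simp
    finally show ?thesis by (simp add: norm_mult)
  qed
  have "(1 - s) * norm x \<le> (1-s) * 1" using assms by (intro mult_left_mono) auto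
  then show "s \<le> 1 - norm ((1 - of_real s) * x)" using e by simp
  have "(1 - s) * norm x \<le> 1 * norm x" using assms by (intro mult_right_mono) auto
  then show "norm ((1 - of_real s) * x) < 1" using e assms by simp
qed

text \<open>The vanishing condition controls the pre-Schwarzian derivative only near the circle. The constant
  \<open>M\<close> accounts for the remaining compact disc and becomes harmless at small scales.\<close>
locale log_derivative_bound =
  fixes f \<Lambda> :: "complex \<Rightarrow> complex" and \<epsilon> M :: real
  assumes hol_f: "f holomorphic_on ball 0 1" and hol_log: "\<Lambda> holomorphic_on ball 0 1"
    and exp_log: "\<And>z. norm z < 1 \<Longrightarrow> deriv f z = exp (\<Lambda> z)"
    and eps: "0 < \<epsilon>" "\<epsilon> < 1" and M: "0 \<le> M"
    and bound: "\<And>z. norm z < 1 \<Longrightarrow> norm (deriv \<Lambda> z) \<le> \<epsilon> / (1 - norm z) + M"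
begin

lemma deriv_near:
  assumes "norm u < 1" "norm z < 1" "norm (\<Lambda> u - \<Lambda> z) \<le> B"
  shows "norm (deriv f u - deriv f z) \<le> norm (deriv f z) * (exp B - 1)"
proof -
  have "deriv f u - deriv f z = deriv f z * (exp (\<Lambda> u - \<Lambda> z) - 1)"
    using assms exp_log by (simp add: exp_diff algebra_simps)
  then show ?thesis
    using norm_exp_minus_one_le[OF assms(3)] by (simp add: norm_mult mult_left_mono)
qed

lemma has_field_derivative_f: "norm z < 1 \<Longrightarrow> (f has_field_derivative deriv f z) (at z)"
  using hol_f holomorphic_derivI by (metis mem_ball_0 open_ball)

lemma has_field_derivative_log: "norm z < 1 \<Longrightarrow> (\<Lambda> has_field_derivative deriv \<Lambda> z) (at z)"
  using hol_log holomorphic_derivI by (metis mem_ball_0 open_ball)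

text \<open>Integrate the bound on \<open>deriv \<Lambda>\<close> along a radius; the point \<open>(1 - \<sigma>) x\<close> has distance at least
  \<open>\<sigma>\<close> from the circle.\<close>
lemma log_radial:
  assumes x: "norm x < 1" and s: "0 < s" "s < r" "r < 1"
  shows "norm (\<Lambda> ((1 - of_real s) * x) - \<Lambda> ((1 - of_real r) * x)) \<le> \<epsilon> * ln (r / s) + M * r"
proof -
  have "norm (\<Lambda> ((1 - of_real r) * x) - \<Lambda> ((1 - of_real s) * x))
      \<le> (\<epsilon> * ln r + M * r) - (\<epsilon> * ln s + M * s)"
  proof (rule differentiable_bound_general[OF s(2)])
    show "continuous_on {s..r} (\<lambda>\<sigma>. \<Lambda> ((1 - of_real \<sigma>) * x))"
      by (rule continuous_on_compose2[OF holomorphic_on_imp_continuous_on[OF hol_log]])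
         (use s x in \<open>auto intro!: continuous_intros shrink_in_ball\<close>)
    show "continuous_on {s..r} (\<lambda>\<sigma>. \<epsilon> * ln \<sigma> + M * \<sigma>)"
      using s by (auto intro!: continuous_intros)
    fix \<sigma> assume \<sigma>: "s < \<sigma>" "\<sigma> < r"
    have i: "norm ((1 - of_real \<sigma>) * x) < 1" "\<sigma> \<le> 1 - norm ((1 - of_real \<sigma>) * x)"
      using shrink_in_ball[OF x] \<sigma> s by auto
    show "((\<lambda>\<sigma>. \<Lambda> ((1 - of_real \<sigma>) * x)) has_vector_derivative - x * deriv \<Lambda> ((1 - of_real \<sigma>) * x)) (at \<sigma>)"
    proof -
      have "((\<lambda>\<sigma>. (1 - of_real \<sigma>) * x) has_vector_derivative - x) (at \<sigma>)"
        by (auto intro!: derivative_eq_intros simp: has_vector_derivative_def scaleR_conv_of_real algebra_simps)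
      from field_vector_diff_chain_at[OF this has_field_derivative_log[OF i(1)]] 
      show ?thesis by (simp add: o_def)
    qed
    show "((\<lambda>\<sigma>. \<epsilon> * ln \<sigma> + M * \<sigma>) has_vector_derivative \<epsilon> / \<sigma> + M) (at \<sigma>)"
      using \<sigma> s by (auto intro!: derivative_eq_intros simp: has_real_derivative_iff_has_vector_derivative[symmetric] field_simps)
    have "norm (deriv \<Lambda> ((1 - of_real \<sigma>) * x)) \<le> \<epsilon> / \<sigma> + M"
    proof -
      have "\<epsilon> / (1 - norm ((1 - of_real \<sigma>) * x)) \<le> \<epsilon> / \<sigma>"
        using i \<sigma> s eps by (intro divide_left_mono) auto
      with bound[OF i(1)] show ?thesis by linarith
    qed
    moreover have "norm x * norm (deriv \<Lambda> ((1 - of_real \<sigma>) * x)) \<le> 1 * norm (deriv \<Lambda> ((1 - of_real \<sigma>) * x))"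
      using x by (intro mult_right_mono) auto
    ultimately show "norm (- x * deriv \<Lambda> ((1 - of_real \<sigma>) * x)) \<le> \<epsilon> / \<sigma> + M"
      by (simp add: norm_mult)
  qed
  moreover have "0 \<le> M * s" using M s by simp
  ultimately show ?thesis using s by (simp add: ln_div norm_minus_commute algebra_simps)
qed

text \<open>By \<open>log_radial\<close>, the quotient of the values of \<open>f'\<close> at \<open>(1 - s) x\<close> and at \<open>(1 - r) x\<close> differs
  from \<open>1\<close> by at most \<open>exp (M r) (r / s) powr \<epsilon> - 1\<close>. As \<open>\<epsilon> < 1\<close> this is integrable down to \<open>s = 0\<close>, so the
  estimate reaches \<open>x\<close> however close \<open>x\<close> is to the circle.\<close>
lemma linear_radial:
  assumes x: "norm x < 1" and r: "0 < r" "r < 1"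
  defines "z \<equiv> (1 - of_real r) * x"
  shows "norm (f x - f z - deriv f z * (x - z)) \<le> norm (deriv f z) * r * (exp (M * r) / (1 - \<epsilon>) - 1)"
proof -
  let ?\<phi> = "\<lambda>s. f ((1 - of_real s) * x) + of_real s * x * deriv f z"
  let ?\<psi> = "\<lambda>s. norm (deriv f z) * (exp (M * r) * r powr \<epsilon> * s powr (1 - \<epsilon>) / (1 - \<epsilon>) - s)"
  have zn: "norm z < 1" using shrink_in_ball[OF x] r unfolding z_def by auto
  have "norm (?\<phi> r - ?\<phi> 0) \<le> ?\<psi> r - ?\<psi> 0"
  proof (rule differentiable_bound_general[OF r(1)])
    show "continuous_on {0..r} ?\<phi>"
      by (intro continuous_intros continuous_on_compose2[OF holomorphic_on_imp_continuous_on[OF hol_f]])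
         (use r x in \<open>auto intro!: continuous_intros shrink_in_ball\<close>)
    have "continuous_on {0..r} (\<lambda>s. s powr (1 - \<epsilon>))"
      by (rule continuous_on_powr') (use eps in auto)
    then show "continuous_on {0..r} ?\<psi>"
      using eps by (intro continuous_on_mult continuous_on_diff continuous_on_divide continuous_on_const continuous_on_id) auto
    fix s assume s: "0 < s" "s < r"
    have i: "norm ((1 - of_real s) * x) < 1"
      using shrink_in_ball[OF x] s r by auto
    show "(?\<phi> has_vector_derivative (- x * deriv f ((1 - of_real s) * x) + x * deriv f z)) (at s)"
    proof -
      have "((\<lambda>\<sigma>. (1 - of_real \<sigma>) * x) has_vector_derivative - x) (at s)"
        by (auto intro!: derivative_eq_intros simp: has_vector_derivative_def scaleR_conv_of_real algebra_simps)
      from field_vector_diff_chain_at[OF this has_field_derivative_f[OF i(1)]] 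
      have 1: "((\<lambda>\<sigma>. f ((1 - of_real \<sigma>) * x)) has_vector_derivative - x * deriv f ((1 - of_real s) * x)) (at s)" by (simp add: o_def)
      have 2: "((\<lambda>\<sigma>. of_real \<sigma> * x * deriv f z) has_vector_derivative x * deriv f z) (at s)"
        by (auto intro!: derivative_eq_intros simp: has_vector_derivative_def scaleR_conv_of_real algebra_simps)
      show ?thesis using has_vector_derivative_add[OF 1 2] .
    qed
    show "(?\<psi> has_vector_derivative norm (deriv f z) * (exp (M * r) * r powr \<epsilon> * s powr (- \<epsilon>) - 1)) (at s)"
      using s eps by (auto intro!: derivative_eq_intros simp: has_real_derivative_iff_has_vector_derivative[symmetric])
    have "norm (deriv f ((1 - of_real s) * x) - deriv f z) \<le> norm (deriv f z) * (exp (\<epsilon> * ln (r / s) + M * r) - 1)"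
      using deriv_near[OF i zn] log_radial[OF x s r(2)] by (simp add: z_def)
    also have "exp (\<epsilon> * ln (r / s) + M * r) = exp (M * r) * r powr \<epsilon> * s powr (- \<epsilon>)"
      using s r by (simp add: exp_add powr_def ln_div algebra_simps exp_diff exp_minus field_simps)
    finally have "norm (deriv f ((1 - of_real s) * x) - deriv f z) \<le> norm (deriv f z) * (exp (M * r) * r powr \<epsilon> * s powr (- \<epsilon>) - 1)" .
    moreover have "norm x * norm (deriv f ((1 - of_real s) * x) - deriv f z) \<le> 1 * norm (deriv f ((1 - of_real s) * x) - deriv f z)"
      using x by (intro mult_right_mono) auto
    moreover have "- x * deriv f ((1 - of_real s) * x) + x * deriv f z = - (x * (deriv f ((1 - of_real s) * x) - deriv f z))"
      by (simp add: algebra_simps)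
    ultimately show "norm (- x * deriv f ((1 - of_real s) * x) + x * deriv f z) \<le> norm (deriv f z) * (exp (M * r) * r powr \<epsilon> * s powr (- \<epsilon>) - 1)"
      by (simp only: norm_minus_cancel norm_mult)
  qed
  moreover have "?\<psi> r - ?\<psi> 0 = norm (deriv f z) * r * (exp (M * r) / (1 - \<epsilon>) - 1)"
  proof -
    have "r powr \<epsilon> * r powr (1 - \<epsilon>) = r" using r by (simp flip: powr_add)
    then have "exp (M * r) * r powr \<epsilon> * r powr (1 - \<epsilon>) / (1 - \<epsilon>) = exp (M * r) * r / (1 - \<epsilon>)" by (simp add: mult.assoc)
    then show ?thesis using eps by (simp only: right_diff_distrib) (simp add: algebra_simps)
  qed
  moreover have "?\<phi> r - ?\<phi> 0 = - (f x - f z - deriv f z * (x - z))"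
    by (simp add: z_def algebra_simps)
  ultimately show ?thesis by (metis norm_minus_cancel)
qed

text \<open>The segment between the two shrunk points stays at distance at least \<open>r\<close> from the circle, where
  \<open>\<Lambda>\<close> varies slowly at scale \<open>r\<close>.\<close>
lemma shrunk_pair:
  assumes x: "norm x < 1" and y: "norm y < 1" and r: "0 < r" "r < 1" and T: "norm (y - x) \<le> T * r"
  defines "z \<equiv> (1 - of_real r) * x" and "w \<equiv> (1 - of_real r) * y"
  defines "\<kappa> \<equiv> exp (T * (\<epsilon> + M * r)) - 1"
  shows "norm (deriv f w - deriv f z) \<le> norm (deriv f z) * \<kappa>" (is ?A)
    and "norm (f w - f z - deriv f z * (w - z)) \<le> norm (deriv f z) * \<kappa> * (T * r)" (is ?B)
proof -
  let ?S = "cball (0::complex) (1 - r)"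
  have S1: "norm u < 1" if "u \<in> ?S" for u using that r by simp
  have zS: "z \<in> ?S" and wS: "w \<in> ?S" using shrink_in_ball(2)[OF x, of r] shrink_in_ball(2)[OF y, of r] r by (auto simp: z_def w_def)
  have T0: "0 \<le> T * r" using T norm_ge_zero order_trans by blast
  have wz: "norm (w - z) \<le> T * r"
  proof -
    have "w - z = (1 - of_real r) * (y - x)" by (simp add: w_def z_def algebra_simps)
    moreover have "norm (1 - of_real r :: complex) = 1 - r"
    proof -
      have "norm (of_real (1 - r) :: complex) = 1 - r" unfolding norm_of_real using r by simp
      then show ?thesis by simp
    qed
    moreover have "(1 - r) * norm (y - x) \<le> 1 * norm (y - x)" using r by (intro mult_right_mono) auto
    ultimately show ?thesis using T by (simp add: norm_mult)
  qed
  define C where "C = closed_segment z w"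
  have CS: "C \<subseteq> ?S" unfolding C_def using zS wS closed_segment_subset by (metis convex_cball)
  have cC: "convex C" by (simp add: C_def)
  have near: "norm (deriv f u - deriv f z) \<le> norm (deriv f z) * \<kappa>" if u: "u \<in> C" for u
  proof -
    have "norm (\<Lambda> u - \<Lambda> z) \<le> (\<epsilon> / r + M) * norm (u - z)"
    proof (rule field_differentiable_bound[of C \<Lambda> "deriv \<Lambda>"])
      show "convex C" by (rule cC)
      show "(\<Lambda> has_field_derivative deriv \<Lambda> v) (at v within C)" if "v \<in> C" for v
        using has_field_derivative_log CS S1 that by (meson has_field_derivative_at_within subset_iff)
      show "norm (deriv \<Lambda> v) \<le> \<epsilon> / r + M" if "v \<in> C" for v
      proof -
        have v: "v \<in> ?S" using that CS by auto
        have "\<epsilon> / (1 - norm v) \<le> \<epsilon> / r" using v r eps by (intro divide_left_mono) (auto intro!: mult_pos_pos)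
        with bound[OF S1[OF v]] show ?thesis by linarith
      qed
    qed (use u in \<open>auto simp: C_def\<close>)
    also have "\<dots> \<le> (\<epsilon> / r + M) * (T * r)"
    proof (rule mult_left_mono)
      show "norm (u - z) \<le> T * r" using u wz segment_bound1[of u z w] unfolding C_def by linarith
      show "0 \<le> \<epsilon> / r + M" using eps M r by simp
    qed
    also have "\<dots> = T * (\<epsilon> + M * r)" using r by (simp add: field_simps)
    finally show ?thesis using deriv_near[of u z] S1 CS u zS by (auto simp: \<kappa>_def)
  qed
  show ?A using near[of w] by (simp add: C_def)
  have "norm ((f w - deriv f z * w) - (f z - deriv f z * z)) \<le> (norm (deriv f z) * \<kappa>) * norm (w - z)"
  proof (rule field_differentiable_bound[of C "\<lambda>v. f v - deriv f z * v" "\<lambda>v. deriv f v - deriv f z"])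
    show "((\<lambda>v. f v - deriv f z * v) has_field_derivative deriv f v - deriv f z) (at v within C)" if "v \<in> C" for v
      by (rule has_field_derivative_at_within) (use has_field_derivative_f[of v] CS S1 that in \<open>auto intro!: derivative_eq_intros\<close>)
  qed (use near cC in \<open>auto simp: C_def\<close>)
  also have "\<dots> \<le> (norm (deriv f z) * \<kappa>) * (T * r)"
    by (rule mult_left_mono[OF wz]) (use near[of z] in \<open>simp add: C_def\<close>)
  finally show ?B by (simp add: algebra_simps)
qed

text \<open>Go from \<open>x\<close> radially inwards to \<open>z\<close>, across to \<open>(1 - r) y\<close>, and radially outwards to \<open>y\<close>. Along each
  of the three pieces \<open>f\<close> is close to an affine map, and the slopes agree approximately.\<close>
lemma linear_approximation:
  assumes x: "norm x < 1" and y: "norm y < 1" and r: "0 < r" "r < 1" and T: "norm (y - x) \<le> T * r"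
    and Mr: "M * r \<le> \<epsilon>" and T0: "0 \<le> T"
  defines "z \<equiv> (1 - of_real r) * x"
  defines "\<kappa> \<equiv> exp (T * (2 * \<epsilon>)) - 1" and "\<mu> \<equiv> exp \<epsilon> / (1 - \<epsilon>) - 1"
  shows "norm (f y - f x - deriv f z * (y - x)) \<le> norm (deriv f z) * r * ((1 + \<kappa>) * \<mu> + \<kappa> + \<kappa> * T + \<mu>)"
proof -
  define w where "w = (1 - of_real r) * y"
  define F where "F = norm (deriv f z)"
  have F0: "0 \<le> F" by (simp add: F_def)
  have \<mu>: "exp (M * r) / (1 - \<epsilon>) - 1 \<le> \<mu>" unfolding \<mu>_def using Mr eps by (simp add: divide_right_mono)
  have \<kappa>: "exp (T * (\<epsilon> + M * r)) - 1 \<le> \<kappa>" unfolding \<kappa>_def using Mr T0 by (simp add: mult_left_mono)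
  have \<kappa>0: "0 \<le> \<kappa>" unfolding \<kappa>_def using T0 eps by simp
  have \<mu>0: "0 \<le> \<mu>"
  proof -
    have "1 - \<epsilon> \<le> exp \<epsilon>" using exp_ge_add_one_self[of \<epsilon>] eps by linarith
    then show ?thesis unfolding \<mu>_def using eps by (simp add: le_divide_eq)
  qed
  have d1: "norm (deriv f w - deriv f z) \<le> F * \<kappa>"
    using shrunk_pair(1)[OF x y r T] mult_left_mono[OF \<kappa> F0] by (simp add: F_def z_def w_def)
  have d2: "norm (f w - f z - deriv f z * (w - z)) \<le> F * \<kappa> * (T * r)"
  proof -
    have "F * (exp (T * (\<epsilon> + M * r)) - 1) * (T * r) \<le> F * \<kappa> * (T * r)"
      using \<kappa> F0 T0 r by (intro mult_right_mono mult_left_mono) auto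
    then show ?thesis using shrunk_pair(2)[OF x y r T] by (simp add: F_def z_def w_def)
  qed
  have d3: "norm (f x - f z - deriv f z * (x - z)) \<le> F * r * \<mu>"
    using linear_radial[OF x r] mult_left_mono[OF \<mu>, of "F * r"] F0 r by (simp add: F_def z_def)
  have Fw: "norm (deriv f w) \<le> F * (1 + \<kappa>)"
    using d1 norm_triangle_sub[of "deriv f w" "deriv f z"] by (simp add: F_def algebra_simps)
  have d4: "norm (f y - f w - deriv f w * (y - w)) \<le> F * (1 + \<kappa>) * r * \<mu>"
  proof -
    have "norm (f y - f w - deriv f w * (y - w)) \<le> norm (deriv f w) * r * \<mu>"
      using linear_radial[OF y r] mult_left_mono[OF \<mu>, of "norm (deriv f w) * r"] r by (simp add: w_def)
    also have "\<dots> \<le> F * (1 + \<kappa>) * r * \<mu>" using Fw \<mu>0 r by (intro mult_right_mono) auto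
    finally show ?thesis .
  qed
  have d5: "norm ((deriv f w - deriv f z) * (y - w)) \<le> F * \<kappa> * r"
  proof -
    have "y - w = of_real r * y" by (simp add: w_def algebra_simps)
    then have "norm (y - w) \<le> r" using y r by (simp add: norm_mult mult_left_le)
    then show ?thesis unfolding norm_mult using d1 F0 \<kappa>0 by (intro mult_mono) auto
  qed
  have "f y - f x - deriv f z * (y - x) = (f y - f w - deriv f w * (y - w)) + (deriv f w - deriv f z) * (y - w)
      + (f w - f z - deriv f z * (w - z)) - (f x - f z - deriv f z * (x - z))"
    by (simp add: algebra_simps)
  also have "norm \<dots> \<le> F * (1 + \<kappa>) * r * \<mu> + F * \<kappa> * r + F * \<kappa> * (T * r) + F * r * \<mu>"
    using d2 d3 d4 d5 norm_triangle_ineq4 norm_triangle_ineq by (smt (verit, best))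
  also have "\<dots> = F * r * ((1 + \<kappa>) * \<mu> + \<kappa> + \<kappa> * T + \<mu>)" by (simp add: algebra_simps)
  finally show ?thesis by (simp add: F_def)
qed

end

lemma conformal_log_deriv:
  assumes "f holomorphic_on ball 0 1" "inj_on f (ball 0 1)"
  obtains \<Lambda> where "\<Lambda> holomorphic_on ball 0 1" "\<And>z. norm z < 1 \<Longrightarrow> deriv f z = exp (\<Lambda> z)"
    "\<And>z. norm z < 1 \<Longrightarrow> deriv \<Lambda> z = deriv (deriv f) z / deriv f z"
proof -
  have h: "deriv f holomorphic_on ball 0 1" using assms by (intro holomorphic_deriv) auto
  have nz: "deriv f z \<noteq> 0" if "z \<in> ball 0 1" for z
    using holomorphic_injective_imp_regular[OF assms(1) _ assms(2) that] by simp
  obtain \<Lambda> where L: "\<Lambda> holomorphic_on ball 0 1" "\<And>z. z \<in> ball 0 1 \<Longrightarrow> deriv f z = exp (\<Lambda> z)"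
    using contractible_imp_holomorphic_log[OF h convex_imp_contractible[OF convex_ball] nz] by auto
  show ?thesis
  proof
    fix z :: complex assume z: "norm z < 1"
    have "(deriv f has_field_derivative exp (\<Lambda> z) * deriv \<Lambda> z) (at z)"
    proof (rule has_field_derivative_transform_within_open[of "\<lambda>z. exp (\<Lambda> z)" _ _ "ball 0 1"])
      show "((\<lambda>z. exp (\<Lambda> z)) has_field_derivative exp (\<Lambda> z) * deriv \<Lambda> z) (at z)"
        using holomorphic_derivI[OF L(1), of z] z by (auto intro!: derivative_eq_intros)
    qed (use L z in auto)
    then show "deriv \<Lambda> z = deriv (deriv f) z / deriv f z"
      using L(2)[of z] z by (simp add: DERIV_imp_deriv)
  qed (use L in auto)
qed

lemma conformal_homeomorphism:
  assumes "f holomorphic_on ball 0 1" "inj_on f (ball 0 1)"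
  shows "\<exists>g. homeomorphism (ball 0 1) (f ` ball 0 1) f g"
proof -
  obtain g where g: "g holomorphic_on (f ` ball 0 1)" "\<And>z. z \<in> ball 0 1 \<Longrightarrow> g (f z) = z"
    using holomorphic_has_inverse[OF assms(1) open_ball assms(2)] by metis
  have "homeomorphism (ball 0 1) (f ` ball 0 1) f g"
    by (rule homeomorphismI) (use assms g in \<open>auto simp: holomorphic_on_imp_continuous_on\<close>)
  then show ?thesis by blast
qed

text \<open>Apply \<open>linear_approximation\<close> at the scale \<open>r = |b - x|\<close>: both \<open>f a - f x\<close> and \<open>f b - f x\<close> are then
  known up to \<open>c |f'(z)| r\<close>, which is small compared with \<open>|f b - f x|\<close>.\<close>
proposition vanishing_pre_schwarzian_imp_asymptotically_symmetric:
  assumes hol: "f holomorphic_on ball 0 1" and inj: "inj_on f (ball 0 1)"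
    and van: "vanishing_pre_schwarzian f"
  shows "asymptotically_symmetric_on (ball 0 1) f"
  unfolding asymptotically_symmetric_on_def
proof (intro conjI allI impI)
  show "\<exists>g. homeomorphism (ball 0 1) (f ` ball 0 1) f g" by (rule conformal_homeomorphism[OF hol inj])
next
  fix e t :: real assume e: "0 < e" and t: "0 < t"
  obtain \<Lambda> where L: "\<Lambda> holomorphic_on ball 0 1" "\<And>z. norm z < 1 \<Longrightarrow> deriv f z = exp (\<Lambda> z)"
    "\<And>z. norm z < 1 \<Longrightarrow> deriv \<Lambda> z = deriv (deriv f) z / deriv f z"
    using conformal_log_deriv[OF hol inj] by blast
  define T where "T = max 1 t"
  define E where "E = (\<lambda>\<epsilon>. let \<kappa> = exp (T * (2 * \<epsilon>)) - 1; \<mu> = exp \<epsilon> / (1 - \<epsilon>) - 1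
     in (1 + \<kappa>) * \<mu> + \<kappa> + \<kappa> * T + \<mu>)"
  have "(E \<longlongrightarrow> E 0) (at_right 0)"
    unfolding E_def Let_def by (intro tendsto_intros) auto
  then have E0: "(E \<longlongrightarrow> 0) (at_right 0)" by (simp add: E_def)
  \<comment> \<open>With relative error \<open>c\<close> the ratio of image distances is at most \<open>(t + c) / (1 - c)\<close>.\<close>
  define c where "c = min (1/2) (e * t / (1 + (1 + e) * t))"
  have c: "0 < c" "c < 1" using e t by (auto simp: c_def add_pos_pos)
  have ct: "t + c \<le> (1 + e) * t * (1 - c)"
  proof -
    have "c * (1 + (1 + e) * t) \<le> e * t / (1 + (1 + e) * t) * (1 + (1 + e) * t)"
      unfolding c_def using e t by (intro mult_right_mono) auto
    also have "\<dots> = e * t"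
    proof -
      have "1 + (1 + e) * t \<noteq> 0" using e t by (smt (verit) mult_pos_pos)
      then show ?thesis by simp
    qed
    finally show ?thesis by (simp add: algebra_simps)
  qed
  have "\<forall>\<^sub>F \<epsilon> in at_right 0. E \<epsilon> < c \<and> \<epsilon> \<in> {0<..<1}"
    by (intro eventually_conj order_tendstoD(2)[OF E0 c(1)] eventually_at_right_real) auto
  then obtain \<epsilon> where \<epsilon>: "E \<epsilon> < c" "0 < \<epsilon>" "\<epsilon> < 1"
    using eventually_happens[of _ "at_right (0::real)"] by (auto simp: trivial_limit_at_right_real)
  obtain \<rho> where \<rho>: "\<rho> < 1" "\<And>z. \<rho> \<le> norm z \<Longrightarrow> norm z < 1 \<Longrightarrow>
        (1 - norm z) * norm (deriv (deriv f) z / deriv f z) \<le> \<epsilon>"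
    using van \<epsilon>(2) unfolding vanishing_pre_schwarzian_def by metis
  have "continuous_on (cball 0 \<rho>) (deriv \<Lambda>)"
    using \<rho>(1) L(1) by (intro continuous_on_subset[OF holomorphic_on_imp_continuous_on[OF holomorphic_deriv]]) auto
  then have "bounded (deriv \<Lambda> ` cball 0 \<rho>)" by (intro compact_imp_bounded compact_continuous_image) auto
  then obtain M where Mpos: "0 < M" and Mb: "\<And>z. norm z \<le> \<rho> \<Longrightarrow> norm (deriv \<Lambda> z) \<le> M"
    unfolding bounded_pos by auto
  interpret log_derivative_bound f \<Lambda> \<epsilon> M
  proof
    fix z :: complex assume z: "norm z < 1"
    show "norm (deriv \<Lambda> z) \<le> \<epsilon> / (1 - norm z) + M"
    proof (cases "norm z \<le> \<rho>")
      case True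
      then show ?thesis using Mb[of z] \<epsilon> z by (smt (verit) divide_nonneg_nonneg)
    next
      case False
      then have "norm (deriv \<Lambda> z) * (1 - norm z) \<le> \<epsilon>" using \<rho>(2)[of z] L(3)[of z] z by (simp add: mult.commute)
      then have "norm (deriv \<Lambda> z) \<le> \<epsilon> / (1 - norm z)" using z by (simp add: le_divide_eq)
      then show ?thesis using Mpos by linarith
    qed
  qed (use hol L \<epsilon> Mpos in auto)
  define \<delta> where "\<delta> = min (1/4) (\<epsilon> / (2 * M))"
  have \<delta>: "0 < \<delta>" using \<epsilon> Mpos by (simp add: \<delta>_def)
  show "\<exists>\<delta>>0. \<forall>x\<in>ball 0 1. \<forall>a\<in>ball 0 1. \<forall>b\<in>ball 0 1.
        x \<noteq> a \<and> x \<noteq> b \<and> a \<noteq> b \<and> (\<exists>c\<in>ball 0 1. {x, a, b} \<subseteq> ball c \<delta>) \<longrightarrow>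
        dist x a / dist x b \<le> t \<longrightarrow> dist (f x) (f a) / dist (f x) (f b) \<le> (1 + e) * t"
  proof (intro exI[of _ \<delta>] conjI \<delta> ballI impI)
    fix x a b :: complex
    assume xab: "x \<in> ball 0 1" "a \<in> ball 0 1" "b \<in> ball 0 1"
      and as: "x \<noteq> a \<and> x \<noteq> b \<and> a \<noteq> b \<and> (\<exists>c\<in>ball 0 1. {x, a, b} \<subseteq> ball c \<delta>)"
      and ratio: "dist x a / dist x b \<le> t"
    define r where "r = norm (b - x)"
    have r0: "0 < r" using as by (auto simp: r_def)
    have "r < 2 * \<delta>"
    proof -
      obtain q where "x \<in> ball q \<delta>" "b \<in> ball q \<delta>" using as by auto
      then have "dist x b < 2 * \<delta>" using dist_triangle2[of x b q] by (simp add: dist_commute)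
      then show ?thesis by (simp add: r_def dist_norm norm_minus_commute)
    qed
    then have r1: "r < 1" and "r \<le> \<epsilon> / M" unfolding \<delta>_def by (auto simp: min_def split: if_splits)
    then have Mr: "M * r \<le> \<epsilon>" using Mpos by (simp add: field_simps)
    have ax: "norm (a - x) \<le> t * r"
      using ratio r0 by (simp add: r_def dist_norm norm_minus_commute divide_le_eq)
    define z where "z = (1 - of_real r) * x"
    define F where "F = norm (deriv f z)"
    have z1: "norm z < 1" using shrink_in_ball(1)[of x r] xab r0 r1 by (simp add: z_def)
    have F0: "0 < F" using L(2)[OF z1] by (simp add: F_def)
    have apx: "norm (f y - f x - deriv f z * (y - x)) \<le> F * r * c"
      if y: "norm y < 1" "norm (y - x) \<le> T * r" for y
    proof -
      have "norm (f y - f x - deriv f z * (y - x)) \<le> F * r * E \<epsilon>"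
        using linear_approximation[OF _ y(1) r0 r1 y(2) Mr] xab
        unfolding E_def Let_def F_def z_def T_def by simp
      also have "\<dots> \<le> F * r * c" using \<epsilon> F0 r0 by (intro mult_left_mono) auto
      finally show ?thesis .
    qed
    have "t * r \<le> T * r" "1 * r \<le> T * r" using r0 by (auto simp: T_def intro!: mult_right_mono)
    then have A: "norm (f a - f x - deriv f z * (a - x)) \<le> F * r * c"
      and B: "norm (f b - f x - deriv f z * (b - x)) \<le> F * r * c"
      using apx[of a] apx[of b] ax xab by (auto simp: r_def)
    have "norm (f a - f x) \<le> F * norm (a - x) + F * r * c"
      using A norm_triangle_sub[of "f a - f x" "deriv f z * (a - x)"] by (simp add: F_def norm_mult)
    also have "\<dots> \<le> F * (t * r) + F * r * c" using ax F0 by simp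
    also have "\<dots> = F * r * (t + c)" by (simp add: algebra_simps)
    also have "\<dots> \<le> F * r * ((1 + e) * t * (1 - c))" using ct F0 r0 by (intro mult_left_mono) auto
    also have "\<dots> = (1 + e) * t * (F * r * (1 - c))" by simp
    also have "\<dots> \<le> (1 + e) * t * norm (f b - f x)"
    proof (rule mult_left_mono)
      have "F * r \<le> norm (f b - f x) + F * r * c"
        using B norm_triangle_sub[of "deriv f z * (b - x)" "f b - f x"]
        by (simp add: F_def r_def norm_mult norm_minus_commute)
      then show "F * r * (1 - c) \<le> norm (f b - f x)" by (simp add: algebra_simps)
    qed (use e t in auto)
    finally have "dist (f x) (f a) \<le> (1 + e) * t * dist (f x) (f b)"
      by (simp add: dist_norm norm_minus_commute)
    moreover have "f x \<noteq> f b" using inj xab as by (auto dest: inj_onD)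
    ultimately show "dist (f x) (f a) / dist (f x) (f b) \<le> (1 + e) * t"
      by (simp add: divide_le_eq)
  qed
qed

section \<open>Disc automorphisms and extremal maps into a half-plane\<close>

text \<open>The automorphism of the unit disc that takes \<open>0\<close> to \<open>a\<close> and has positive derivative there.\<close>
definition disc_shift :: "complex \<Rightarrow> complex \<Rightarrow> complex" where
  "disc_shift a w = (w + a) / (1 + cnj a * w)"

lemma disc_shift_0 [simp]: "disc_shift a 0 = a"
  by (simp add: disc_shift_def)

lemma disc_shift_eq_Moebius: "disc_shift a = Moebius_function 0 (- a)"
  by (simp add: disc_shift_def Moebius_function_def fun_eq_iff)

lemma disc_shift_denom_nz: "norm a < 1 \<Longrightarrow> norm w < 1 \<Longrightarrow> 1 + cnj a * w \<noteq> 0"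
proof
  assume "norm a < 1" "norm w < 1" "1 + cnj a * w = 0"
  then have "norm (cnj a * w) = 1" by (metis add.inverse_unique norm_minus_cancel norm_one)
  moreover have "norm (cnj a * w) < 1" using \<open>norm a < 1\<close> \<open>norm w < 1\<close> norm_mult_less[of "cnj a" 1 w 1] by simp
  ultimately show False by simp
qed

lemma disc_shift_less_1: "norm a < 1 \<Longrightarrow> norm w < 1 \<Longrightarrow> norm (disc_shift a w) < 1"
  unfolding disc_shift_eq_Moebius by (rule Moebius_function_norm_lt_1) auto

lemma disc_shift_holomorphic: "norm a < 1 \<Longrightarrow> disc_shift a holomorphic_on ball 0 1"
  unfolding disc_shift_eq_Moebius by (rule Moebius_function_holomorphic) auto

lemma disc_shift_inverse: "norm a < 1 \<Longrightarrow> norm w < 1 \<Longrightarrow> disc_shift a (disc_shift (- a) w) = w"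
  unfolding disc_shift_eq_Moebius by (rule Moebius_function_compose) auto

lemma disc_shift_image: "norm a < 1 \<Longrightarrow> disc_shift a ` ball 0 1 = ball 0 1"
proof (intro equalityI subsetI)
  fix w assume a: "norm a < 1" and "w \<in> ball (0::complex) 1"
  then have w: "norm w < 1" by simp
  have "w = disc_shift a (disc_shift (- a) w)" using disc_shift_inverse a w by simp
  moreover have "disc_shift (- a) w \<in> ball 0 1" using disc_shift_less_1[of "- a" w] a w by simp
  ultimately show "w \<in> disc_shift a ` ball 0 1" by blast
qed (use disc_shift_less_1 in auto)

lemma disc_shift_inj: "norm a < 1 \<Longrightarrow> inj_on (disc_shift a) (ball 0 1)"
  by (rule inj_on_inverseI[of _ "disc_shift (- a)"]) (use disc_shift_inverse[of "- a"] in auto)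

lemma disc_shift_has_derivative:
  assumes "norm a < 1" "norm w < 1"
  shows "(disc_shift a has_field_derivative of_real (1 - (norm a)\<^sup>2) / (1 + cnj a * w)\<^sup>2) (at w)"
proof -
  have "((\<lambda>w. (w + a) / (1 + cnj a * w)) has_field_derivative
      (1 * (1 + cnj a * w) - (w + a) * cnj a) / ((1 + cnj a * w) * (1 + cnj a * w))) (at w)"
    by (rule derivative_eq_intros refl | use disc_shift_denom_nz[OF assms] in simp)+
  moreover have "1 * (1 + cnj a * w) - (w + a) * cnj a = of_real (1 - (norm a)\<^sup>2)"
    using complex_norm_square[of a] by (simp add: algebra_simps)
  moreover have "disc_shift a = (\<lambda>w. (w + a) / (1 + cnj a * w))" by (simp add: disc_shift_def fun_eq_iff)
  ultimately show ?thesis by (simp only: power2_eq_square)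
qed

text \<open>Disc automorphisms are isometries of the hyperbolic metric \<open>|dz| / (1 - |z|\<^sup>2)\<close>.\<close>
lemma disc_shift_one_minus_norm:
  assumes "norm a < 1" "norm w < 1"
  shows "1 - (norm (disc_shift a w))\<^sup>2 = (1 - (norm w)\<^sup>2) * norm (of_real (1 - (norm a)\<^sup>2) / (1 + cnj a * w)\<^sup>2)"
proof -
  have nz: "norm (1 + cnj a * w) \<noteq> 0" using disc_shift_denom_nz[OF assms] by simp
  have "(norm a)\<^sup>2 < 1" using assms by (simp add: abs_square_less_1)
  then have n: "norm (of_real (1 - (norm a)\<^sup>2) :: complex) = 1 - (norm a)\<^sup>2" unfolding norm_of_real by simp
  have "(norm (1 + cnj a * w))\<^sup>2 - (norm (w + a))\<^sup>2 = (1 - (norm w)\<^sup>2) * (1 - (norm a)\<^sup>2)"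
    unfolding cmod_power2 by (simp add: power2_eq_square algebra_simps)
  then have "1 - (norm (w + a))\<^sup>2 / (norm (1 + cnj a * w))\<^sup>2 = (1 - (norm w)\<^sup>2) * (1 - (norm a)\<^sup>2) / (norm (1 + cnj a * w))\<^sup>2"
    using nz by (simp add: field_simps)
  then show ?thesis unfolding norm_divide n by (simp add: disc_shift_def norm_divide power_divide norm_power)
qed

text \<open>The conformal radius is monotone in the domain: compose the inverse of \<open>F\<close> with a conformal map of
  the unit disc onto \<open>ball c R\<close> that fixes \<open>0\<close>, and apply the Schwarz lemma.\<close>
lemma conformal_radius_lower_bound:
  assumes F: "F holomorphic_on ball 0 1" "inj_on F (ball 0 1)" "F 0 = 0"
    and sub: "ball c R \<subseteq> F ` ball 0 1" and c: "norm c < R"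
  shows "(R\<^sup>2 - (norm c)\<^sup>2) / R \<le> norm (deriv F 0)"
proof -
  have R: "0 < R" using c norm_ge_zero[of c] by linarith
  obtain k where k: "k holomorphic_on F ` ball 0 1" "\<And>z. z \<in> ball 0 1 \<Longrightarrow> deriv F z * deriv k (F z) = 1"
     "\<And>z. z \<in> ball 0 1 \<Longrightarrow> k (F z) = z"
    using holomorphic_has_inverse[OF F(1) open_ball F(2)] by blast
  define a where "a = - c / of_real R"
  have a: "norm a < 1" using c R by (simp add: a_def norm_divide)
  define L where "L = (\<lambda>w. c + of_real R * disc_shift a w)"
  have L: "L holomorphic_on ball 0 1" unfolding L_def by (intro holomorphic_intros disc_shift_holomorphic a)
  have Lin: "L w \<in> ball c R" if "norm w < 1" for w
    using disc_shift_less_1[OF a that] R by (simp add: L_def dist_norm norm_mult)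
  have L0: "L 0 = 0" using R by (simp add: L_def a_def)
  have Fo: "open (F ` ball 0 1)" using open_mapping_thm3[OF F(1) open_ball F(2)] .
  have kin: "norm (k u) < 1" if "u \<in> F ` ball 0 1" for u using that k(3) by auto
  have L': "(L has_field_derivative of_real R * of_real (1 - (norm a)\<^sup>2)) (at 0)"
    unfolding L_def using disc_shift_has_derivative[OF a, of 0] by (auto intro!: derivative_eq_intros)
  have k': "(k has_field_derivative deriv k 0) (at (L 0))"
    unfolding L0 using holomorphic_derivI[OF k(1) Fo, of 0] F(3) by (metis L0 Lin norm_zero sub subsetD zero_less_one)
  have "((\<lambda>w. k (L w)) has_field_derivative deriv k 0 * (of_real R * of_real (1 - (norm a)\<^sup>2))) (at 0)"
    using DERIV_chain2[OF k' L'] .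
  then have d: "deriv (\<lambda>w. k (L w)) 0 = deriv k 0 * (of_real R * of_real (1 - (norm a)\<^sup>2))" by (rule DERIV_imp_deriv)
  have "norm (deriv (\<lambda>w. k (L w)) 0) \<le> 1"
  proof (rule Schwarz_Lemma(2)[of _ 0])
    show "(\<lambda>w. k (L w)) holomorphic_on ball 0 1"
      using holomorphic_on_compose_gen[OF L k(1), unfolded o_def] Lin sub by (force simp: image_subset_iff)
    show "k (L 0) = 0" using k(3)[of 0] F(3) L0 by simp
    show "norm (k (L z)) < 1" if "norm z < 1" for z using kin Lin[OF that] sub by blast
  qed auto
  moreover have "deriv F 0 * deriv k 0 = 1" using k(2)[of 0] F(3) by simp
  then have "norm (deriv F 0) * norm (deriv k 0) = 1" by (metis norm_mult norm_one)
  moreover have "norm (of_real R * of_real (1 - (norm a)\<^sup>2) :: complex) = (R\<^sup>2 - (norm c)\<^sup>2) / R"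
  proof -
    have "(norm a)\<^sup>2 < 1" using a by (simp add: abs_square_less_1)
    then have "norm (of_real R * of_real (1 - (norm a)\<^sup>2) :: complex) = R * (1 - (norm a)\<^sup>2)"
      using R by (simp only: norm_mult norm_of_real abs_of_pos diff_gt_0_iff_gt)
    also have "\<dots> = (R\<^sup>2 - (norm c)\<^sup>2) / R" using R by (simp add: a_def norm_divide power_divide field_simps power2_eq_square)
    finally show ?thesis .
  qed
  ultimately have 1: "norm (deriv k 0) * ((R\<^sup>2 - (norm c)\<^sup>2) / R) \<le> 1" and 2: "norm (deriv F 0) * norm (deriv k 0) = 1"
    unfolding d by (simp_all add: norm_mult)
  have "(R\<^sup>2 - (norm c)\<^sup>2) / R = norm (deriv F 0) * (norm (deriv k 0) * ((R\<^sup>2 - (norm c)\<^sup>2) / R))"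
    using 2 by (simp add: mult.assoc[symmetric])
  also have "\<dots> \<le> norm (deriv F 0) * 1" using 1 by (intro mult_left_mono) auto
  finally show ?thesis by simp
qed

text \<open>The Cauchy estimate for \<open>F n - g\<close> on a disc of fixed size around the moving point.\<close>
lemma deriv_tendsto_moving_point:
  assumes F: "\<And>n. F n holomorphic_on ball 0 1" and g: "g holomorphic_on ball 0 1"
    and lim: "\<And>K. compact K \<Longrightarrow> K \<subseteq> ball 0 1 \<Longrightarrow> uniform_limit K F g sequentially"
    and w: "w \<longlonglongrightarrow> W" "norm W < 1"
  shows "(\<lambda>n. deriv (F n) (w n)) \<longlonglongrightarrow> deriv g W"
proof -
  define s where "s = (1 - norm W) / 3"
  have s: "0 < s" using w by (simp add: s_def)
  have sub: "cball W (2 * s) \<subseteq> ball 0 1"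
  proof
    fix u assume "u \<in> cball W (2 * s)"
    then have "norm u \<le> norm W + 2 * s" using norm_triangle_sub[of u W] by (simp add: dist_norm norm_minus_commute)
    then show "u \<in> ball 0 1" using w s by (simp add: s_def field_simps)
  qed
  have "(\<lambda>n. deriv (F n) (w n) - deriv g (w n)) \<longlonglongrightarrow> 0"
  proof (rule tendstoI)
    fix e :: real assume e: "0 < e"
    have "\<forall>\<^sub>F n in sequentially. \<forall>u\<in>cball W (2 * s). dist (F n u) (g u) < e * s / 2"
      by (rule uniform_limitD[OF lim[OF compact_cball sub]]) (use e s in simp)
    moreover have "\<forall>\<^sub>F n in sequentially. dist (w n) W < s" using w(1) s unfolding tendsto_iff by blast
    ultimately show "\<forall>\<^sub>F n in sequentially. dist (deriv (F n) (w n) - deriv g (w n)) 0 < e"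
    proof eventually_elim
      case (elim n)
      have c: "cball (w n) s \<subseteq> cball W (2 * s)"
      proof
        fix u assume "u \<in> cball (w n) s"
        then show "u \<in> cball W (2 * s)" using dist_triangle[of W u "w n"] elim(2) by (simp add: dist_commute)
      qed
      then have c1: "cball (w n) s \<subseteq> ball 0 1" using sub by blast
      have "w n \<in> cball (w n) s" using s by simp
      then have "w n \<in> ball 0 1" using c1 by blast
      then have diff: "deriv (\<lambda>u. F n u - g u) (w n) = deriv (F n) (w n) - deriv g (w n)"
        using holomorphic_on_imp_differentiable_at[OF F[of n] open_ball] holomorphic_on_imp_differentiable_at[OF g open_ball]
        by simp
      have "norm ((deriv ^^ 1) (\<lambda>u. F n u - g u) (w n)) \<le> fact 1 * (e * s / 2) / s ^ 1"
      proof (rule Cauchy_inequality)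
        have "(\<lambda>u. F n u - g u) holomorphic_on cball (w n) s"
          using c1 by (intro holomorphic_intros holomorphic_on_subset[OF F] holomorphic_on_subset[OF g]) auto
        then show "(\<lambda>u. F n u - g u) holomorphic_on ball (w n) s" "continuous_on (cball (w n) s) (\<lambda>u. F n u - g u)"
          by (auto intro: holomorphic_on_subset holomorphic_on_imp_continuous_on)
        fix u assume "norm (w n - u) = s"
        then have "u \<in> cball W (2 * s)" using c by (auto simp: dist_norm)
        then show "norm (F n u - g u) \<le> e * s / 2" using elim(1) by (auto simp: dist_norm less_imp_le)
      qed (rule s)
      then show ?case using diff s e by (simp add: dist_norm)
    qed
  qed
  moreover have "(\<lambda>n. deriv g (w n)) \<longlonglongrightarrow> deriv g W"
  proof -
    have "isCont (deriv g) W"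
      using holomorphic_deriv[OF g open_ball] w(2) continuous_on_eq_continuous_at[OF open_ball]
      by (metis holomorphic_on_imp_continuous_on mem_ball_0)
    then show ?thesis using w(1) by (rule isCont_tendsto_compose)
  qed
  ultimately have "(\<lambda>n. deriv (F n) (w n) - deriv g (w n) + deriv g (w n)) \<longlonglongrightarrow> 0 + deriv g W" by (rule tendsto_add)
  then show ?thesis by simp
qed

text \<open>The value \<open>2\<close> is the largest possible modulus of \<open>g' 0\<close> for a map into the half-plane \<open>Re < 1\<close>,
  by the Schwarz lemma for \<open>g / (2 - g)\<close>, and the equality case of that lemma determines \<open>g\<close>.\<close>
lemma half_plane_extremal:
  assumes g: "g holomorphic_on ball 0 1" "g 0 = 0" and half: "\<And>w. norm w < 1 \<Longrightarrow> Re (g w) < 1"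
    and d: "2 \<le> norm (deriv g 0)"
  obtains v where "norm v = 1" "\<And>w. norm w < 1 \<Longrightarrow> g w = 2 * v * w / (1 + v * w)"
proof -
  define k where "k = (\<lambda>w. g w / (2 - g w))"
  have nz: "2 - g w \<noteq> 0" if "norm w < 1" for w using half[OF that] by (auto simp: complex_eq_iff)
  have kh: "k holomorphic_on ball 0 1" unfolding k_def using nz by (intro holomorphic_intros g) auto
  have k0: "k 0 = 0" by (simp add: k_def g)
  have k1: "norm (k w) < 1" if "norm w < 1" for w
  proof -
    have "(norm (g w))\<^sup>2 < (norm (2 - g w))\<^sup>2" unfolding cmod_power2 using half[OF that]
      by (simp add: power2_eq_square algebra_simps)
    then have "norm (g w) < norm (2 - g w)" using power2_less_imp_less norm_ge_zero by blast
    then show ?thesis using nz[OF that] by (simp add: k_def norm_divide divide_less_eq)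
  qed
  have g': "(g has_field_derivative deriv g 0) (at 0)" using holomorphic_derivI[OF g(1) open_ball] by simp
  have "(k has_field_derivative deriv g 0 / 2) (at 0)"
    unfolding k_def using g' g(2) by (auto intro!: derivative_eq_intros)
  then have "deriv k 0 = deriv g 0 / 2" by (rule DERIV_imp_deriv)
  then have "norm (deriv k 0) = norm (deriv g 0) / 2" by (simp only: norm_divide norm_numeral)
  then have "1 \<le> norm (deriv k 0)" using d by simp
  moreover have "norm (deriv k 0) \<le> 1" by (rule Schwarz_Lemma(2)[OF kh k0, of 0]) (use k1 in auto)
  ultimately have "norm (deriv k 0) = 1" by simp
  then obtain v where v: "\<And>w. norm w < 1 \<Longrightarrow> k w = v * w" "norm v = 1"
    using Schwarz_Lemma(3)[OF kh k0, of 0] k1 by auto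
  have "g w = 2 * v * w / (1 + v * w)" if w: "norm w < 1" for w
  proof -
    have e: "g w = (v * w) * (2 - g w)" using v(1)[OF w] nz[OF w] by (simp add: k_def field_simps)
    have "norm (v * w) < 1" using v w by (simp add: norm_mult)
    then have "1 + v * w \<noteq> 0" by (metis add.inverse_unique less_irrefl norm_minus_cancel norm_one)
    moreover have "g w * (1 + v * w) = 2 * v * w" using e by (simp add: algebra_simps)
    ultimately show ?thesis by (simp add: eq_divide_eq)
  qed
  with v(2) show ?thesis by (rule that)
qed

text \<open>After an affine change of coordinates taking the omitted values \<open>1\<close> and \<open>e i\<close> to \<open>0\<close> and \<open>1\<close>, which
  is uniformly controlled because they stay apart and bounded, this is Schottky's theorem.\<close>
lemma Schottky_family_bounded:
  assumes F: "\<And>i. i \<in> I \<Longrightarrow> F i holomorphic_on ball 0 1" "\<And>i. i \<in> I \<Longrightarrow> F i 0 = (0::complex)"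
    and om: "\<And>i. i \<in> I \<Longrightarrow> 1 \<notin> F i ` ball 0 1" "\<And>i. i \<in> I \<Longrightarrow> e i \<notin> F i ` ball 0 1"
    and e: "\<And>i. i \<in> I \<Longrightarrow> 1 / 2 \<le> norm (e i - 1)" "\<And>i. i \<in> I \<Longrightarrow> norm (e i - 1) \<le> 2"
    and K: "compact K" "K \<subseteq> ball 0 1"
  shows "\<exists>B. \<forall>i\<in>I. \<forall>z\<in>K. norm (F i z) \<le> B"
proof -
  have "\<exists>k. 0 < k \<and> k < 1 \<and> K \<subseteq> cball 0 k"
  proof (cases "K = {}")
    case True then show ?thesis by (auto intro!: exI[of _ "1/2"])
  next
    case False
    obtain z where z: "z \<in> K" "\<And>u. u \<in> K \<Longrightarrow> norm u \<le> norm z"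
      using continuous_attains_sup[OF K(1) False, of norm] by (auto intro: continuous_intros)
    have "norm z < 1" using z K by auto
    then show ?thesis using z by (intro exI[of _ "max (norm z) (1/2)"]) force
  qed
  then obtain k where k: "0 < k" "k < 1" "K \<subseteq> cball 0 k" by blast
  define \<kappa> where "\<kappa> = (1 + k) / 2"
  have \<kappa>: "0 < \<kappa>" "\<kappa> < 1" "k < \<kappa>" using k by (auto simp: \<kappa>_def)
  define t where "t = k / \<kappa>"
  have t: "0 < t" "t < 1" using k \<kappa> by (auto simp: t_def)
  define B where "B = exp (pi * exp (pi * (2 + 2 * 2 + 12 * t / (1 - t))))"
  have "norm (F i z) \<le> 1 + 2 * B" if i: "i \<in> I" and z: "z \<in> K" for i z
  proof -
    define S where "S = (\<lambda>w. (F i (of_real \<kappa> * w) - 1) / (e i - 1))"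
    have ne: "e i - 1 \<noteq> 0" using e(1)[OF i] by auto
    have in_b: "of_real \<kappa> * w \<in> ball 0 1" if "w \<in> cball 0 1" for w :: complex
    proof -
      have "\<kappa> * norm w \<le> \<kappa> * 1" using that \<kappa> by (intro mult_left_mono) auto
      then have "\<kappa> * norm w < 1" using \<kappa> by linarith
      then show ?thesis using \<kappa> by (simp add: norm_mult)
    qed
    have "norm (S (z / of_real \<kappa>)) \<le> B"
      unfolding B_def
    proof (rule Schottky[of S])
      show "S holomorphic_on cball 0 1"
      proof -
        have "(\<lambda>w. F i (of_real \<kappa> * w)) holomorphic_on cball 0 1"
          by (rule holomorphic_on_compose_gen[OF _ F(1)[OF i], unfolded o_def])
             (use in_b in \<open>auto intro!: holomorphic_intros\<close>)
        then show ?thesis unfolding S_def using ne by (intro holomorphic_on_divide holomorphic_on_diff holomorphic_on_const) auto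
      qed
      have "norm (S 0) = 1 / norm (e i - 1)" by (simp add: S_def F(2)[OF i] norm_divide norm_minus_commute)
      also have "\<dots> \<le> 1 / (1/2)" using e(1)[OF i] by (intro divide_left_mono) auto
      finally show "norm (S 0) \<le> 2" by simp
      show "\<not> (S w = 0 \<or> S w = 1)" if "w \<in> cball 0 1" for w
      proof -
        have "F i (of_real \<kappa> * w) \<noteq> 1" "F i (of_real \<kappa> * w) \<noteq> e i" using om[OF i] in_b[OF that] by (metis imageI)+
        then show ?thesis using ne by (simp add: S_def divide_eq_eq)
      qed
      have "norm z / \<kappa> \<le> k / \<kappa>" using z k \<kappa> by (intro divide_right_mono) auto
      then show "norm (z / of_real \<kappa>) \<le> t" using \<kappa> by (simp add: t_def norm_divide)
    qed (use t in auto)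
    moreover have "F i z = 1 + (e i - 1) * S (z / of_real \<kappa>)" using ne \<kappa> by (simp add: S_def)
    then have "norm (F i z) \<le> 1 + norm (e i - 1) * norm (S (z / of_real \<kappa>))"
      by (metis norm_mult norm_one norm_triangle_ineq)
    moreover have "norm (e i - 1) * norm (S (z / of_real \<kappa>)) \<le> 2 * B"
      using calculation(1) e(2)[OF i] by (intro mult_mono) auto
    ultimately show ?thesis by linarith
  qed
  then show ?thesis by blast
qed

section \<open>Rescaling limits of a conformal map\<close>

locale conformal_map_disc =
  fixes f :: "complex \<Rightarrow> complex" and G :: "complex set"
  assumes hol: "f holomorphic_on ball 0 1" and inj: "inj_on f (ball 0 1)"
    and image: "f ` ball 0 1 = G" and bounded_G: "bounded G"
begin

abbreviation "J \<equiv> frontier G"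

lemma open_G: "open G"
  using open_mapping_thm3[OF hol open_ball inj] image by simp

lemma J_disjoint: "J \<inter> G = {}"
  using open_G by (auto simp: frontier_def interior_open)

lemma compact_J: "compact J"
  using bounded_G by (rule compact_frontier_bounded)

lemma J_nonempty: "J \<noteq> {}"
proof
  assume "J = {}"
  then have "G = {} \<or> G = UNIV" by (simp add: frontier_eq_empty)
  moreover have "G \<noteq> {}" using image by force
  ultimately show False using bounded_G not_bounded_UNIV by simp
qed

lemma in_G: "norm z < 1 \<Longrightarrow> f z \<in> G"
  using image by force

lemma deriv_nz: "norm z < 1 \<Longrightarrow> deriv f z \<noteq> 0"
  using holomorphic_injective_imp_regular[OF hol open_ball inj] by simp

lemma inverse_continuous:
  obtains h where "continuous_on G h" "\<And>z. norm z < 1 \<Longrightarrow> h (f z) = z" "\<And>w. w \<in> G \<Longrightarrow> norm (h w) < 1"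
proof -
  obtain h where h: "homeomorphism (ball 0 1) G f h"
    using conformal_homeomorphism[OF hol inj] image by auto
  show ?thesis by (rule that[of h]) (use h in \<open>auto simp: homeomorphism_def\<close>)
qed

text \<open>The points of the closure of \<open>G\<close> at distance at least \<open>e\<close> from the boundary form a compact subset of
  \<open>G\<close>, whose preimage is compact in the open disc.\<close>
lemma boundary_approach:
  assumes e: "0 < e"
  obtains \<rho> where "\<rho> < 1" "\<And>z. norm z < 1 \<Longrightarrow> \<rho> < norm z \<Longrightarrow> \<exists>q\<in>J. dist (f z) q < e"
proof -
  obtain h where h: "continuous_on G h" "\<And>z. norm z < 1 \<Longrightarrow> h (f z) = z" "\<And>w. w \<in> G \<Longrightarrow> norm (h w) < 1"
    using inverse_continuous by metis
  define K where "K = closure G \<inter> (\<Inter>q\<in>J. - ball q e)"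
  have KG: "K \<subseteq> G"
  proof
    fix w assume w: "w \<in> K"
    have "w \<notin> J" using w e by (auto simp: K_def)
    then show "w \<in> G" using w open_G by (auto simp: K_def frontier_def interior_open)
  qed
  have "closed K" unfolding K_def by (intro closed_Int closed_closure closed_INT) (auto simp: closed_Compl)
  moreover have "bounded K" using bounded_subset[OF bounded_G KG] .
  ultimately have "compact K" by (simp add: compact_eq_bounded_closed)
  have "\<exists>\<rho><1. \<forall>w\<in>K. norm (h w) \<le> \<rho>"
  proof (cases "K = {}")
    case True then show ?thesis by (auto intro!: exI[of _ 0])
  next
    case False
    have "continuous_on K (\<lambda>w. norm (h w))"
      by (intro continuous_on_norm continuous_on_subset[OF h(1) KG])
    then obtain w where "w \<in> K" "\<And>v. v \<in> K \<Longrightarrow> norm (h v) \<le> norm (h w)"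
      using continuous_attains_sup[OF \<open>compact K\<close> False] by metis
    then show ?thesis using h(3) KG by blast
  qed
  then obtain \<rho> where \<rho>: "\<rho> < 1" "\<And>w. w \<in> K \<Longrightarrow> norm (h w) \<le> \<rho>" by blast
  show ?thesis
  proof (rule that[OF \<rho>(1)])
    fix z :: complex assume z: "norm z < 1" "\<rho> < norm z"
    show "\<exists>q\<in>J. dist (f z) q < e"
    proof (rule ccontr)
      assume far: "\<not> ?thesis"
      have "f z \<in> closure G" using in_G[OF z(1)] closure_subset by blast
      moreover have "f z \<notin> ball q e" if "q \<in> J" for q using far that by (auto simp: dist_commute)
      ultimately have "f z \<in> K" by (auto simp: K_def)
      then show False using \<rho>(2) h(2)[OF z(1)] z(2) by force
    qed
  qed
qed

text \<open>The conformal radius of \<open>G\<close> as seen from \<open>f z\<close>.\<close>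
definition conformal_radius :: "complex \<Rightarrow> real" where
  "conformal_radius z = (1 - (norm z)\<^sup>2) * norm (deriv f z)"

lemma conformal_radius_pos: "norm z < 1 \<Longrightarrow> 0 < conformal_radius z"
  using deriv_nz[of z] by (simp add: conformal_radius_def abs_square_less_1)

lemma has_derivative_f: "norm z < 1 \<Longrightarrow> (f has_field_derivative deriv f z) (at z)"
  using holomorphic_derivI[OF hol open_ball] by simp

lemma deriv_f_shift:
  assumes "norm a < 1" "norm w < 1"
  shows "((\<lambda>w. f (disc_shift a w)) has_field_derivative
     deriv f (disc_shift a w) * (of_real (1 - (norm a)\<^sup>2) / (1 + cnj a * w)\<^sup>2)) (at w)"
  using DERIV_chain2[OF has_derivative_f[OF disc_shift_less_1[OF assms]] disc_shift_has_derivative[OF assms]] .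

lemma conformal_radius_shift:
  assumes "norm a < 1" "norm w < 1"
  shows "conformal_radius (disc_shift a w) = (1 - (norm w)\<^sup>2) * norm (deriv (\<lambda>w. f (disc_shift a w)) w)"
proof -
  have "deriv (\<lambda>w. f (disc_shift a w)) w = deriv f (disc_shift a w) * (of_real (1 - (norm a)\<^sup>2) / (1 + cnj a * w)\<^sup>2)"
    by (rule DERIV_imp_deriv[OF deriv_f_shift[OF assms]])
  then show ?thesis
    unfolding conformal_radius_def disc_shift_one_minus_norm[OF assms] by (simp only: norm_mult ac_simps)
qed

text \<open>This formula is how limits of rescaled maps give information on the pre-Schwarzian derivative of
  \<open>f\<close>: the left-hand side is unchanged by affine normalisation in the image.\<close>
lemma pre_schwarzian_shift:
  assumes a: "norm a < 1"
  shows "deriv (deriv (\<lambda>w. f (disc_shift a w))) 0 / deriv (\<lambda>w. f (disc_shift a w)) 0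
    = of_real (1 - (norm a)\<^sup>2) * (deriv (deriv f) a / deriv f a) - 2 * cnj a"
proof -
  let ?c = "of_real (1 - (norm a)\<^sup>2) :: complex"
  let ?h = "\<lambda>w. f (disc_shift a w)"
  have "(norm a)\<^sup>2 < 1" using a by (simp add: abs_square_less_1)
  then have c0: "?c \<noteq> 0" by (simp only: of_real_eq_0_iff)
  have d1: "deriv ?h 0 = deriv f a * ?c"
    using DERIV_imp_deriv[OF deriv_f_shift[OF a, of 0]] by simp
  have f2: "(deriv f has_field_derivative deriv (deriv f) a) (at a)"
    using holomorphic_derivI[OF holomorphic_deriv[OF hol open_ball] open_ball] a by simp
  have s: "(disc_shift a has_field_derivative ?c) (at 0)" using disc_shift_has_derivative[OF a, of 0] by simp
  have "((\<lambda>w. deriv f (disc_shift a w)) has_field_derivative deriv (deriv f) a * ?c) (at 0)"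
    using DERIV_chain2[of "deriv f" _ "disc_shift a" 0] f2 s by simp
  moreover have "((\<lambda>w. ?c / (1 + cnj a * w)\<^sup>2) has_field_derivative - 2 * cnj a * ?c) (at 0)"
    by (auto intro!: derivative_eq_intros)
  ultimately have "((\<lambda>w. deriv f (disc_shift a w) * (?c / (1 + cnj a * w)\<^sup>2)) has_field_derivative
      deriv (deriv f) a * ?c * ?c + deriv f a * (- 2 * cnj a * ?c)) (at 0)"
    by (auto intro!: derivative_eq_intros)
  then have "(deriv ?h has_field_derivative deriv (deriv f) a * ?c * ?c + deriv f a * (- 2 * cnj a * ?c)) (at 0)"
    by (rule has_field_derivative_transform_within_open[of _ _ _ "ball 0 1"])
       (use DERIV_imp_deriv[OF deriv_f_shift[OF a]] in auto)
  then have "deriv (deriv ?h) 0 = deriv (deriv f) a * ?c * ?c + deriv f a * (- 2 * cnj a * ?c)" by (rule DERIV_imp_deriv)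
  then have d2: "deriv (deriv ?h) 0 = deriv (deriv f) a * ?c * ?c + deriv f a * (- 2 * cnj a * ?c)" .
  have gen: "(A * C * C + B * (- 2 * q * C)) / (B * C) = C * (A / B) - 2 * q" if "C \<noteq> 0" "B \<noteq> 0" for A B C q :: complex
    using that by (simp add: field_simps)
  show ?thesis unfolding d1 d2 by (rule gen[OF c0 deriv_nz[OF a]])
qed

text \<open>The map \<open>f\<close> seen from \<open>a\<close>: the source is moved so that \<open>a\<close> becomes \<open>0\<close>, and the target is moved
  affinely so that \<open>f a\<close> becomes \<open>0\<close> and \<open>p\<close> becomes \<open>1\<close>.\<close>
definition rescaled :: "complex \<Rightarrow> complex \<Rightarrow> complex \<Rightarrow> complex" where
  "rescaled a p = (\<lambda>w. (f (disc_shift a w) - f a) / (p - f a))"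

lemma rescaled_props:
  assumes a: "norm a < 1" and p: "p \<in> J"
  shows "rescaled a p holomorphic_on ball 0 1" "inj_on (rescaled a p) (ball 0 1)" "rescaled a p 0 = 0"
    and "rescaled a p ` ball 0 1 = (\<lambda>q. (q - f a) / (p - f a)) ` G"
    and "\<And>w. norm w < 1 \<Longrightarrow> deriv (rescaled a p) w = deriv (\<lambda>w. f (disc_shift a w)) w / (p - f a)"
    and "\<And>q. q \<in> J \<Longrightarrow> (q - f a) / (p - f a) \<notin> rescaled a p ` ball 0 1"
proof -
  have ne: "p - f a \<noteq> 0" using p in_G[OF a] J_disjoint by auto
  have sh: "(\<lambda>w. f (disc_shift a w)) holomorphic_on ball 0 1"
    using holomorphic_on_compose_gen[OF disc_shift_holomorphic[OF a] hol, unfolded o_def] disc_shift_image[OF a] by simp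
  show h: "rescaled a p holomorphic_on ball 0 1"
    unfolding rescaled_def using ne by (intro holomorphic_on_divide holomorphic_on_diff sh holomorphic_on_const) auto
  have "inj_on (f \<circ> disc_shift a) (ball 0 1)"
    by (rule comp_inj_on[OF disc_shift_inj[OF a]]) (simp add: disc_shift_image[OF a] inj)
  then show "inj_on (rescaled a p) (ball 0 1)"
    unfolding rescaled_def inj_on_def using ne by auto
  show "rescaled a p 0 = 0" by (simp add: rescaled_def)
  have "rescaled a p ` ball 0 1 = (\<lambda>q. (q - f a) / (p - f a)) ` f ` disc_shift a ` ball 0 1"
    by (simp add: rescaled_def image_image)
  then show im: "rescaled a p ` ball 0 1 = (\<lambda>q. (q - f a) / (p - f a)) ` G"
    using disc_shift_image[OF a] image by simp
  show "deriv (rescaled a p) w = deriv (\<lambda>w. f (disc_shift a w)) w / (p - f a)" if w: "norm w < 1" for w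
  proof -
    have "((\<lambda>w. f (disc_shift a w)) has_field_derivative deriv (\<lambda>w. f (disc_shift a w)) w) (at w)"
      using holomorphic_derivI[OF sh open_ball] w by simp
    then have "(rescaled a p has_field_derivative deriv (\<lambda>w. f (disc_shift a w)) w / (p - f a)) (at w)"
      unfolding rescaled_def using ne by (auto intro!: derivative_eq_intros)
    then show ?thesis by (rule DERIV_imp_deriv)
  qed
  show "(q - f a) / (p - f a) \<notin> rescaled a p ` ball 0 1" if "q \<in> J" for q
    using that J_disjoint ne unfolding im by auto
qed

lemma nearest_boundary_point:
  obtains p where "p \<in> J" "\<And>q. q \<in> J \<Longrightarrow> dist w p \<le> dist w q"
  using distance_attains_inf[OF compact_imp_closed[OF compact_J] J_nonempty] by metis

text \<open>In normalised coordinates the boundary converges to the line \<open>Re = 1\<close>. Two omitted boundary points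
  make the rescaled maps a normal family. By Hurwitz' theorem a limit \<open>g\<close> omits the line, so it maps
  into the half-plane \<open>Re < 1\<close>. On the other hand the normalised domains contain larger and larger
  discs that nearly touch the line, so \<open>|g' 0| \<ge> 2\<close> by \<open>conformal_radius_lower_bound\<close>. Hence \<open>g\<close> is
  extremal, and \<open>half_plane_extremal\<close> identifies it.\<close>
lemma rescaling_limit:
  assumes S: "symmetric_quasicircle J"
    and z: "\<And>n. norm (z n) < 1" "(\<lambda>n. norm (z n)) \<longlonglongrightarrow> 1"
    and p: "\<And>n. p n \<in> J" "\<And>n q. q \<in> J \<Longrightarrow> dist (f (z n)) (p n) \<le> dist (f (z n)) q"
  obtains r :: "nat \<Rightarrow> nat" and g v where "strict_mono r" "norm v = 1"
    "g holomorphic_on ball 0 1" "\<And>w. norm w < 1 \<Longrightarrow> g w = 2 * v * w / (1 + v * w)"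
    "\<And>K. compact K \<Longrightarrow> K \<subseteq> ball 0 1 \<Longrightarrow> uniform_limit K (\<lambda>n. rescaled (z (r n)) (p (r n))) g sequentially"
    "(\<lambda>n. dist (f (z n)) (p n)) \<longlonglongrightarrow> 0"
proof -
  define d where "d = (\<lambda>n. dist (f (z n)) (p n))"
  have d0: "d \<longlonglongrightarrow> 0"
  proof (rule tendstoI)
    fix e :: real assume e: "0 < e"
    obtain \<rho> where \<rho>: "\<rho> < 1" "\<And>z. norm z < 1 \<Longrightarrow> \<rho> < norm z \<Longrightarrow> \<exists>q\<in>J. dist (f z) q < e"
      using boundary_approach[OF e] by metis
    have "\<forall>\<^sub>F n in sequentially. \<rho> < norm (z n)" using order_tendstoD(1)[OF z(2) \<rho>(1)] .
    then show "\<forall>\<^sub>F n in sequentially. dist (d n) 0 < e"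
    proof eventually_elim
      case (elim n)
      obtain q where "q \<in> J" "dist (f (z n)) q < e" using \<rho>(2)[OF z(1) elim] by blast
      then show ?case using p(2)[of q n] by (simp add: d_def)
    qed
  qed
  define m where "m = (\<lambda>n q. (q - f (z n)) / (p n - f (z n)))"
  define F where "F = (\<lambda>n. rescaled (z n) (p n))"
  have F: "F n holomorphic_on ball 0 1" "inj_on (F n) (ball 0 1)" "F n 0 = 0" "F n ` ball 0 1 = m n ` G" for n
    using rescaled_props[OF z(1)[of n] p(1)[of n]] unfolding F_def m_def by auto
  have ne: "p n - f (z n) \<noteq> 0" for n using p(1)[of n] in_G[OF z(1)[of n]] J_disjoint by auto
  have notJ: "f (z n) \<notin> J" for n using in_G[OF z(1)] J_disjoint by auto
  have om: "m n q \<notin> F n ` ball 0 1" if "q \<in> J" for n q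
    unfolding m_def F_def by (rule rescaled_props(6)[OF z(1) p(1) that])
  have mp: "m n (p n) = 1" for n using ne by (simp add: m_def)
  \<comment> \<open>As \<open>d n \<longlonglongrightarrow> 0\<close>, the boundary is nearly straight at every normalised scale \<open>R\<close>.\<close>
  have flat: "\<forall>\<^sub>F n in sequentially. (\<forall>q\<in>J. dist (p n) q \<le> R * d n \<longrightarrow> \<bar>Re (m n q) - 1\<bar> \<le> \<eta>) \<and>
       (\<forall>y. \<bar>y\<bar> \<le> R \<longrightarrow> (\<exists>q\<in>J. dist (m n q) (Complex 1 y) \<le> \<eta>))" if R: "1 \<le> R" and \<eta>: "0 < \<eta>" for R \<eta>
  proof -
    obtain d0 where d0': "0 < d0" and st: "\<And>w0 p. p \<in> J \<Longrightarrow> w0 \<notin> J \<Longrightarrow> (\<And>q. q \<in> J \<Longrightarrow> dist w0 p \<le> dist w0 q) \<Longrightarrow> dist w0 p < d0 \<Longrightarrow>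
       (\<forall>q\<in>J. dist p q \<le> R * dist w0 p \<longrightarrow> \<bar>Re ((q - w0) / (p - w0)) - 1\<bar> \<le> \<eta>) \<and>
       (\<forall>y. \<bar>y\<bar> \<le> R \<longrightarrow> (\<exists>q\<in>J. dist ((q - w0) / (p - w0)) (Complex 1 y) \<le> \<eta>))"
      using symmetric_quasicircle_nearly_straight[OF S R \<eta>] by metis
    have "\<forall>\<^sub>F n in sequentially. d n < d0" using order_tendstoD(2)[OF d0 d0'] .
    then show ?thesis
    proof eventually_elim
      case (elim n)
      show ?case unfolding m_def d_def
        by (rule st[OF p(1) notJ p(2)]) (use elim in \<open>auto simp: d_def\<close>)
    qed
  qed
  \<comment> \<open>The disc \<open>ball c R\<close> comes within \<open>\<eta>\<close> of the line, so flatness at scale \<open>2 R + 1\<close> puts it inside the domain.\<close>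
  have disc: "\<forall>\<^sub>F n in sequentially. 2 * (1 - \<eta>) - 1 / R \<le> norm (deriv (F n) 0)"
    if R: "1 \<le> R" and \<eta>: "0 < \<eta>" "\<eta> < 1" for R \<eta>
  proof -
    define c :: complex where "c = of_real (1 - \<eta> - R)"
    have cn: "norm c = R - (1 - \<eta>)" unfolding c_def norm_of_real using R \<eta> by simp
    have "\<forall>\<^sub>F n in sequentially. (\<forall>q\<in>J. dist (p n) q \<le> (2 * R + 1) * d n \<longrightarrow> \<bar>Re (m n q) - 1\<bar> \<le> \<eta>)"
      using flat[of "2 * R + 1" \<eta>] R \<eta> by (auto elim: eventually_mono)
    then show ?thesis
    proof eventually_elim
      case (elim n)
      have "ball c R \<subseteq> F n ` ball 0 1"
      proof -
        define D where "D = p n - f (z n)"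
        have D: "D \<noteq> 0" "norm D = d n" using ne by (auto simp: D_def d_def dist_norm norm_minus_commute)
        define X where "X = (\<lambda>\<zeta>. f (z n) + D * \<zeta>) ` ball c R"
        have mX: "m n (f (z n) + D * \<zeta>) = \<zeta>" for \<zeta> using D by (simp add: m_def flip: D_def)
        have XJ: "X \<inter> J = {}"
        proof (rule ccontr)
          assume "X \<inter> J \<noteq> {}"
          then obtain \<zeta> where \<zeta>: "\<zeta> \<in> ball c R" "f (z n) + D * \<zeta> \<in> J" by (auto simp: X_def)
          have "norm (1 - \<zeta>) \<le> norm (1 - c) + norm (c - \<zeta>)" using norm_triangle_ineq[of "1 - c" "c - \<zeta>"] by simp
          also have "norm (1 - c) = R + \<eta>"
          proof -
            have "1 - c = of_real (R + \<eta>)" by (simp add: c_def)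
            then show ?thesis using R \<eta> by (simp only: norm_of_real)
          qed
          also have "norm (c - \<zeta>) \<le> R" using \<zeta> by (simp add: dist_norm)
          finally have le: "norm (1 - \<zeta>) \<le> 2 * R + 1" using \<eta> by linarith
          have "p n - (f (z n) + D * \<zeta>) = D * (1 - \<zeta>)" by (simp add: D_def algebra_simps)
          then have "dist (p n) (f (z n) + D * \<zeta>) = d n * norm (1 - \<zeta>)" by (simp add: dist_norm norm_mult D)
          also have "\<dots> \<le> d n * (2 * R + 1)" using le by (intro mult_left_mono) (auto simp: d_def)
          finally have "\<bar>Re \<zeta> - 1\<bar> \<le> \<eta>" using elim[rule_format, OF \<zeta>(2)] mX by (simp add: mult.commute)
          moreover have "Re (\<zeta> - c) < R" using \<zeta>(1) complex_Re_le_cmod[of "\<zeta> - c"] by (simp add: dist_norm norm_minus_commute)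
          ultimately show False by (simp add: c_def)
        qed
        have "connected X" unfolding X_def by (intro connected_continuous_image continuous_intros) auto
        moreover have "0 \<in> ball c R" using cn R \<eta> by (simp add: dist_norm)
        then have "f (z n) \<in> X" unfolding X_def by (metis (no_types, lifting) add.right_neutral image_eqI mult_zero_right)
        ultimately have "X \<subseteq> G" using connected_Int_frontier[of X G] XJ in_G[OF z(1)] by blast
        then have "m n ` X \<subseteq> m n ` G" by blast
        moreover have "m n ` X = ball c R" unfolding X_def image_image mX by simp
        ultimately show ?thesis using F(4)[of n] by simp
      qed
      then have "(R\<^sup>2 - (norm c)\<^sup>2) / R \<le> norm (deriv (F n) 0)"
        by (rule conformal_radius_lower_bound[OF F(1,2,3)]) (use cn \<eta> in simp)
      moreover have "2 * (1 - \<eta>) - 1 / R \<le> (R\<^sup>2 - (norm c)\<^sup>2) / R"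
      proof -
        have "(1 - \<eta>)\<^sup>2 \<le> 1" using \<eta> by (intro power_le_one) auto
        then have "(2 * (1 - \<eta>) - 1 / R) * R \<le> R\<^sup>2 - (norm c)\<^sup>2"
          unfolding cn using R by (simp add: algebra_simps power2_eq_square)
        then show ?thesis using R by (simp add: le_divide_eq)
      qed
      ultimately show ?case by linarith
    qed
  qed
  \<comment> \<open>The second omitted value is near \<open>1 + \<i>\<close>, so it keeps away from the first one, \<open>1\<close>.\<close>
  have "\<forall>\<^sub>F n in sequentially. \<exists>q\<in>J. dist (m n q) (Complex 1 1) \<le> 1 / 2"
    using flat[of 1 "1/2"] by (rule eventually_mono) (auto dest!: conjunct2 spec[of _ "1::real"])
  then obtain N where "\<And>n. N \<le> n \<Longrightarrow> \<exists>q\<in>J. dist (m n q) (Complex 1 1) \<le> 1 / 2"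
    unfolding eventually_sequentially by blast
  then obtain q1 where q1: "\<And>n. N \<le> n \<Longrightarrow> q1 n \<in> J" "\<And>n. N \<le> n \<Longrightarrow> dist (m n (q1 n)) (Complex 1 1) \<le> 1 / 2"
    by metis
  have n1: "norm (Complex 1 1 - 1) = 1" by (simp add: cmod_def)
  have e1: "1 / 2 \<le> norm (m n (q1 n) - 1)" "norm (m n (q1 n) - 1) \<le> 2" if "N \<le> n" for n
    using q1(2)[OF that] norm_triangle_sub[of "m n (q1 n) - 1" "Complex 1 1 - 1"] 
       norm_triangle_sub[of "Complex 1 1 - 1" "m n (q1 n) - 1"] n1
    by (auto simp: dist_norm norm_minus_commute)
  obtain g r0 where g: "g holomorphic_on ball 0 1" and r0: "strict_mono (r0 :: nat \<Rightarrow> nat)"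
    and ulim0: "\<And>K. compact K \<Longrightarrow> K \<subseteq> ball 0 1 \<Longrightarrow> uniform_limit K ((\<lambda>n. F (n + N)) \<circ> r0) g sequentially"
  proof (rule Montel[of "ball 0 1" "F ` {N..}" "\<lambda>n. F (n + N)"])
    show "\<exists>B. \<forall>h\<in>F ` {N..}. \<forall>z\<in>K. norm (h z) \<le> B" if "compact K" "K \<subseteq> ball 0 1" for K
    proof -
      have "\<exists>B. \<forall>i\<in>{N..}. \<forall>z\<in>K. norm (F i z) \<le> B"
      proof (rule Schottky_family_bounded[of _ _ "\<lambda>n. m n (q1 n)"])
        show "1 \<notin> F i ` ball 0 1" for i using om[OF p(1)[of i], of i] mp by simp
      qed (use F(1,3) om q1(1) e1 that in auto)
      then show ?thesis by auto
    qed
  qed (use F(1) in auto)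
  define r where "r = (\<lambda>n. r0 n + N)"
  have r: "strict_mono r" using r0 by (auto simp: r_def strict_mono_def)
  have ulim: "uniform_limit K (\<lambda>n. F (r n)) g sequentially" if "compact K" "K \<subseteq> ball 0 1" for K
    using ulim0[OF that] by (simp add: r_def o_def)
  have pt: "(\<lambda>n. F (r n) w) \<longlonglongrightarrow> g w" if "norm w < 1" for w
    using tendsto_uniform_limitI[OF ulim[of "{w}"]] that by auto
  have g0: "g 0 = 0" using LIMSEQ_unique[OF pt[of 0]] F(3) by simp
  have rtop: "filterlim r sequentially sequentially" using r by (rule filterlim_subseq)
  have dlim: "(\<lambda>n. deriv (F (r n)) 0) \<longlonglongrightarrow> deriv g 0"
    by (rule deriv_tendsto_moving_point[OF F(1) g ulim tendsto_const]) auto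
  have d2: "2 \<le> norm (deriv g 0)"
  proof (rule field_le_epsilon)
    fix e :: real assume e: "0 < e"
    define \<eta> where "\<eta> = min (1/2) (e / 4)"
    define R where "R = max 1 (2 / e)"
    have "\<forall>\<^sub>F n in sequentially. 2 * (1 - \<eta>) - 1 / R \<le> norm (deriv (F n) 0)"
      by (rule disc) (use e in \<open>auto simp: \<eta>_def R_def\<close>)
    from eventually_compose_filterlim[OF this rtop] have "2 * (1 - \<eta>) - 1 / R \<le> norm (deriv g 0)"
      by (rule tendsto_lowerbound[OF tendsto_norm[OF dlim]]) auto
    moreover have "1 / R \<le> e / 2"
    proof -
      have "1 / R \<le> 1 / (2 / e)" using e by (intro divide_left_mono) (auto simp: R_def)
      then show ?thesis using e by simp
    qed
    moreover have "2 * \<eta> \<le> e / 2" by (simp add: \<eta>_def)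
    ultimately show "2 \<le> norm (deriv g 0) + e" by simp
  qed
  have nonconst: "\<not> g constant_on ball 0 1"
  proof
    assume "g constant_on ball 0 1"
    then obtain c where c: "\<And>w. w \<in> ball 0 1 \<Longrightarrow> g w = c" unfolding constant_on_def by blast
    have "(g has_field_derivative 0) (at 0)"
      by (rule has_field_derivative_transform_within_open[of "\<lambda>_. c" _ _ "ball 0 1"]) (use c in auto)
    then show False using d2 DERIV_imp_deriv by force
  qed
  have line: "g w \<noteq> Complex 1 y" if w: "norm w < 1" for w y
  proof -
    have "\<exists>q\<in>J. \<forall>q'\<in>J. dist (m n q) (Complex 1 y) \<le> dist (m n q') (Complex 1 y)" for n
      by (rule continuous_attains_inf[OF compact_J J_nonempty]) (use ne[of n] in \<open>auto simp: m_def intro!: continuous_intros\<close>)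
    then obtain q where q: "\<And>n. q n \<in> J" "\<And>n q'. q' \<in> J \<Longrightarrow> dist (m n (q n)) (Complex 1 y) \<le> dist (m n q') (Complex 1 y)"
      by metis
    have "(\<lambda>n. m n (q n)) \<longlonglongrightarrow> Complex 1 y"
    proof (rule tendstoI)
      fix e :: real assume e: "0 < e"
      have "\<forall>\<^sub>F n in sequentially. \<exists>q\<in>J. dist (m n q) (Complex 1 y) \<le> e / 2"
        using flat[of "max 1 \<bar>y\<bar>" "e/2"] e by (auto elim!: eventually_mono)
      then show "\<forall>\<^sub>F n in sequentially. dist (m n (q n)) (Complex 1 y) < e"
      proof eventually_elim
        case (elim n)
        then obtain q' where "q' \<in> J" "dist (m n q') (Complex 1 y) \<le> e / 2" by blast
        then show ?case using q(2)[of q' n] e by linarith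
      qed
    qed
    then have mlim: "(\<lambda>n. m (r n) (q (r n))) \<longlonglongrightarrow> Complex 1 y"
      using filterlim_compose[OF _ rtop] by blast
    have "g w - Complex 1 y \<noteq> 0"
    proof (rule Hurwitz_no_zeros[of "ball 0 1" "\<lambda>n u. F (r n) u - m (r n) (q (r n))" "\<lambda>u. g u - Complex 1 y"])
      show "uniform_limit K (\<lambda>n u. F (r n) u - m (r n) (q (r n))) (\<lambda>u. g u - Complex 1 y) sequentially"
        if "compact K" "K \<subseteq> ball 0 1" for K
      proof -
        have "uniform_limit K (\<lambda>n u. m (r n) (q (r n))) (\<lambda>u. Complex 1 y) sequentially"
          using mlim unfolding uniform_limit_iff tendsto_iff by (auto elim: eventually_mono)
        then show ?thesis by (rule uniform_limit_minus[OF ulim[OF that]])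
      qed
      show "\<not> (\<lambda>u. g u - Complex 1 y) constant_on ball 0 1"
        using nonconst unfolding constant_on_def by (metis diff_add_cancel)
      show "F (r n) u - m (r n) (q (r n)) \<noteq> 0" if "u \<in> ball 0 1" for n u
        using om[OF q(1), of "r n" "r n"] that by (metis eq_iff_diff_eq_0 imageI)
    qed (use w F(1) g in \<open>auto intro!: holomorphic_intros\<close>)
    then show ?thesis by simp
  qed
  have half: "Re (g w) < 1" if w: "norm w < 1" for w
  proof (rule ccontr)
    assume "\<not> Re (g w) < 1"
    have "connected ((\<lambda>u. Re (g u)) ` ball 0 1)"
      by (intro connected_continuous_image continuous_intros holomorphic_on_imp_continuous_on[OF g]) auto
    then have "{0..Re (g w)} \<subseteq> (\<lambda>u. Re (g u)) ` ball 0 1"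
      by (rule connected_contains_Icc) (use w g0 in \<open>auto intro: image_eqI[of _ _ 0] image_eqI[of _ _ w]\<close>)
    then have "1 \<in> (\<lambda>u. Re (g u)) ` ball 0 1" using \<open>\<not> Re (g w) < 1\<close> by auto
    then obtain u where u: "norm u < 1" "Re (g u) = 1" by auto
    then have "g u = Complex 1 (Im (g u))" by (simp add: complex_eq_iff)
    then show False using line[OF u(1)] by blast
  qed
  obtain v where v: "norm v = 1" "\<And>w. norm w < 1 \<Longrightarrow> g w = 2 * v * w / (1 + v * w)"
    by (rule half_plane_extremal[OF g g0 half d2]; (assumption | (rule that; assumption)))
  show ?thesis
    by (rule that[OF r v(1) g v(2) ulim[unfolded F_def] d0[unfolded d_def]])
qed

end

section \<open>The pole of a rescaling limit\<close>

context conformal_map_disc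
begin

lemma conformal_radius_rescaled:
  assumes "norm a < 1" "norm w < 1" "p \<in> J"
  shows "conformal_radius (disc_shift a w) = (1 - (norm w)\<^sup>2) * (dist (f a) p * norm (deriv (rescaled a p) w))"
proof -
  have "p \<noteq> f a" using assms in_G J_disjoint by auto
  then show ?thesis
    using conformal_radius_shift[OF assms(1,2)] rescaled_props(5)[OF assms(1,3,2)]
    by (simp add: norm_divide dist_norm norm_minus_commute)
qed

lemma pre_schwarzian_rescaled:
  assumes a: "norm a < 1" and p: "p \<in> J"
  shows "deriv (deriv (rescaled a p)) 0 / deriv (rescaled a p) 0
    = of_real (1 - (norm a)\<^sup>2) * (deriv (deriv f) a / deriv f a) - 2 * cnj a"
proof -
  let ?h = "\<lambda>w. f (disc_shift a w)"
  have ne: "p - f a \<noteq> 0" using p in_G[OF a] J_disjoint by auto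
  have sh: "?h holomorphic_on ball 0 1"
    using holomorphic_on_compose_gen[OF disc_shift_holomorphic[OF a] hol, unfolded o_def] disc_shift_image[OF a] by simp
  have "((\<lambda>w. deriv ?h w / (p - f a)) has_field_derivative deriv (deriv ?h) 0 / (p - f a)) (at 0)"
    using holomorphic_derivI[OF holomorphic_deriv[OF sh open_ball] open_ball, of 0] ne
    by (auto intro!: derivative_eq_intros)
  then have "(deriv (rescaled a p) has_field_derivative deriv (deriv ?h) 0 / (p - f a)) (at 0)"
    by (rule has_field_derivative_transform_within_open[of _ _ _ "ball 0 1"])
       (use rescaled_props(5)[OF a p] in auto)
  then have "deriv (deriv (rescaled a p)) 0 = deriv (deriv ?h) 0 / (p - f a)" by (rule DERIV_imp_deriv)
  then show ?thesis using rescaled_props(5)[OF a p, of 0] pre_schwarzian_shift[OF a] ne by simp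
qed

lemma half_plane_map_derivs:
  fixes g :: "complex \<Rightarrow> complex"
  assumes g: "\<And>w. norm w < 1 \<Longrightarrow> g w = 2 * v * w / (1 + v * w)" and v: "norm v = 1"
  shows "norm w < 1 \<Longrightarrow> deriv g w = 2 * v / (1 + v * w)\<^sup>2" "deriv (deriv g) 0 = - 4 * v\<^sup>2"
proof -
  have nz: "1 + v * w \<noteq> 0" if "norm w < 1" for w
  proof
    assume "1 + v * w = 0"
    then have "norm (v * w) = 1" by (metis add.inverse_unique norm_minus_cancel norm_one)
    then show False using v that by (simp add: norm_mult)
  qed
  have d: "deriv g w = 2 * v / (1 + v * w)\<^sup>2" if w: "norm w < 1" for w
  proof -
    have "((\<lambda>w. 2 * v * w / (1 + v * w)) has_field_derivative 2 * v / (1 + v * w)\<^sup>2) (at w)"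
      using nz[OF w] by (auto intro!: derivative_eq_intros simp: power2_eq_square field_simps)
    then have "(g has_field_derivative 2 * v / (1 + v * w)\<^sup>2) (at w)"
      by (rule has_field_derivative_transform_within_open[of _ _ _ "ball 0 1"]) (use g w in auto)
    then show ?thesis by (rule DERIV_imp_deriv)
  qed
  then show "norm w < 1 \<Longrightarrow> deriv g w = 2 * v / (1 + v * w)\<^sup>2" .
  have "((\<lambda>w. 2 * v / (1 + v * w)\<^sup>2) has_field_derivative - 4 * v\<^sup>2) (at 0)"
    by (auto intro!: derivative_eq_intros simp: power2_eq_square)
  then have "(deriv g has_field_derivative - 4 * v\<^sup>2) (at 0)"
    by (rule has_field_derivative_transform_within_open[of _ _ _ "ball 0 1"]) (use d in auto)
  then show "deriv (deriv g) 0 = - 4 * v\<^sup>2" by (rule DERIV_imp_deriv)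
qed

text \<open>The action of \<open>disc_shift\<close> on a diameter through \<open>0\<close>: move by the (signed) hyperbolic distance of
  \<open>s\<close> from \<open>0\<close>, outwards if \<open>s\<close> is positive.\<close>
definition radial_shift :: "real \<Rightarrow> real \<Rightarrow> real" where
  "radial_shift \<rho> s = (s + \<rho>) / (1 + \<rho> * s)"

lemma disc_shift_radial:
  assumes "norm \<zeta> = 1"
  shows "disc_shift (\<zeta> * of_real \<rho>) (\<zeta> * of_real s) = \<zeta> * of_real (radial_shift \<rho> s)"
proof -
  have u: "\<zeta> * cnj \<zeta> = 1" using assms by (simp add: complex_norm_square[symmetric])
  have "cnj (\<zeta> * of_real \<rho>) * (\<zeta> * of_real s) = (\<zeta> * cnj \<zeta>) * of_real (\<rho> * s)" by simp
  then have "cnj (\<zeta> * of_real \<rho>) * (\<zeta> * of_real s) = of_real (\<rho> * s)" using u by simp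
  then show ?thesis by (simp add: disc_shift_def radial_shift_def distrib_left)
qed

text \<open>The form of \<open>rescaling_limit\<close> in which it is used. Here \<open>- 1 / c\<close> is the pole of the limit map
  relative to the outward radial direction. Convergence is stated along further subsequences \<open>k\<close> and
  with moving parameters \<open>s n\<close> because the argument of \<open>pole_location\<close> selects both.\<close>
lemma radial_limit:
  assumes S: "symmetric_quasicircle J"
    and \<rho>: "\<And>n. 0 \<le> \<rho> n" "\<And>n. \<rho> n < 1" "\<rho> \<longlonglongrightarrow> 1" and \<zeta>: "\<And>n. norm (\<zeta> n) = 1"
  obtains r :: "nat \<Rightarrow> nat" and c where "strict_mono r" "norm c = 1"
    "\<And>k s \<sigma>. strict_mono k \<Longrightarrow> s \<longlonglongrightarrow> \<sigma> \<Longrightarrow> \<bar>\<sigma>\<bar> < 1 \<Longrightarrow> \<forall>n. \<bar>s n\<bar> < 1 \<Longrightarrow>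
        (\<lambda>n. conformal_radius (\<zeta> (r (k n)) * of_real (radial_shift (\<rho> (r (k n))) (s n))) /
             conformal_radius (\<zeta> (r (k n)) * of_real (\<rho> (r (k n))))) \<longlonglongrightarrow> (1 - \<sigma>\<^sup>2) / (norm (1 + c * of_real \<sigma>))\<^sup>2"
    "(\<lambda>n. conformal_radius (\<zeta> (r n) * of_real (\<rho> (r n)))) \<longlonglongrightarrow> 0"
    "(\<lambda>n. let z = \<zeta> (r n) * of_real (\<rho> (r n)) in
        of_real (1 - (norm z)\<^sup>2) * \<zeta> (r n) * (deriv (deriv f) z / deriv f z)) \<longlonglongrightarrow> 2 - 2 * c"
proof -
  define z where "z = (\<lambda>n. \<zeta> n * of_real (\<rho> n))"
  have zn: "norm (z n) = \<rho> n" for n using \<zeta> \<rho>(1) by (simp add: z_def norm_mult)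
  have z1: "norm (z n) < 1" for n using zn \<rho>(2) by simp
  have "\<exists>p. p \<in> J \<and> (\<forall>q\<in>J. dist (f (z n)) p \<le> dist (f (z n)) q)" for n
    by (rule nearest_boundary_point[of "f (z n)"]) blast
  then obtain p where p: "\<And>n. p n \<in> J" "\<And>n q. q \<in> J \<Longrightarrow> dist (f (z n)) (p n) \<le> dist (f (z n)) q" by metis
  have zlim: "(\<lambda>n. norm (z n)) \<longlonglongrightarrow> 1" using \<rho>(3) zn by simp
  obtain r0 :: "nat \<Rightarrow> nat" and g v where r0: "strict_mono r0" and v: "norm v = 1"
    and gh: "g holomorphic_on ball 0 1" and g: "\<And>w. norm w < 1 \<Longrightarrow> g w = 2 * v * w / (1 + v * w)"
    and ul: "\<And>K. compact K \<Longrightarrow> K \<subseteq> ball 0 1 \<Longrightarrow> uniform_limit K (\<lambda>n. rescaled (z (r0 n)) (p (r0 n))) g sequentially"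
    and d: "(\<lambda>n. dist (f (z n)) (p n)) \<longlonglongrightarrow> 0"
    by (rule rescaling_limit[OF S z1 zlim p]; (assumption | (rule that; assumption)))
  have "seq_compact (sphere (0::complex) 1)" using compact_sphere compact_eq_seq_compact_metric by blast
  then obtain Z r1 where Z: "Z \<in> sphere 0 1" "strict_mono r1" "((\<lambda>n. \<zeta> (r0 n)) \<circ> r1) \<longlonglongrightarrow> Z"
    using \<zeta> unfolding seq_compact_def by (metis mem_sphere_0)
  define r where "r = (\<lambda>n. r0 (r1 n))"
  have r: "strict_mono r" using r0 Z(2) by (simp add: r_def strict_mono_def)
  have Zlim: "(\<lambda>n. \<zeta> (r n)) \<longlonglongrightarrow> Z" using Z(3) by (simp add: r_def o_def)
  define c where "c = v * Z"
  have c: "norm c = 1" using v Z by (simp add: c_def norm_mult)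
  define F where "F = (\<lambda>n. rescaled (z n) (p n))"
  have Fh: "F n holomorphic_on ball 0 1" for n unfolding F_def using rescaled_props(1)[OF z1 p(1)] .
  have ulk: "uniform_limit K (\<lambda>n. F (r (k n))) g sequentially" if k: "strict_mono k" and K: "compact K" "K \<subseteq> ball 0 1" for k K
  proof -
    have "strict_mono (\<lambda>n. r1 (k n))" using Z(2) k by (simp add: strict_mono_def)
    then have t: "filterlim (\<lambda>n. r1 (k n)) sequentially sequentially" by (rule filterlim_subseq)
    show ?thesis
      using ul[OF K] eventually_compose_filterlim[OF _ t] unfolding uniform_limit_iff F_def r_def by blast
  qed
  have derivs: "(\<lambda>n. deriv (F (r (k n))) (w n)) \<longlonglongrightarrow> 2 * v / (1 + v * W)\<^sup>2"
    if k: "strict_mono k" and w: "w \<longlonglongrightarrow> W" "norm W < 1" for k w W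
    using deriv_tendsto_moving_point[OF Fh gh ulk[OF k] w] half_plane_map_derivs(1)[OF g v w(2)] by simp
  have d0: "(\<lambda>n. deriv (F (r n)) 0) \<longlonglongrightarrow> 2 * v"
    using derivs[of "\<lambda>n. n" "\<lambda>_. 0" 0] by (simp add: strict_mono_def)
  have v0: "2 * v \<noteq> 0" using v by auto
  show ?thesis
  proof (rule that[OF r c])
    fix k :: "nat \<Rightarrow> nat" and s :: "nat \<Rightarrow> real" and \<sigma> :: real
    assume k: "strict_mono k" and s: "s \<longlonglongrightarrow> \<sigma>" "\<bar>\<sigma>\<bar> < 1" "\<forall>n. \<bar>s n\<bar> < 1"
    have Zk: "(\<lambda>n. \<zeta> (r (k n))) \<longlonglongrightarrow> Z" using LIMSEQ_subseq_LIMSEQ[OF Zlim k] by (simp add: o_def)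
    have w: "(\<lambda>n. \<zeta> (r (k n)) * of_real (s n)) \<longlonglongrightarrow> Z * of_real \<sigma>" by (intro tendsto_intros Zk s)
    have W: "norm (Z * of_real \<sigma>) < 1" using Z s by (simp add: norm_mult)
    have nzW: "1 + c * of_real \<sigma> \<noteq> 0"
    proof
      assume "1 + c * of_real \<sigma> = 0"
      then have "norm (c * of_real \<sigma>) = 1" by (metis add.inverse_unique norm_minus_cancel norm_one)
      then show False using c s by (simp add: norm_mult)
    qed
    have dk0: "(\<lambda>n. deriv (F (r (k n))) 0) \<longlonglongrightarrow> 2 * v" using LIMSEQ_subseq_LIMSEQ[OF d0 k] by (simp add: o_def)
    have dk: "(\<lambda>n. deriv (F (r (k n))) (\<zeta> (r (k n)) * of_real (s n))) \<longlonglongrightarrow> 2 * v / (1 + c * of_real \<sigma>)\<^sup>2"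
      using derivs[OF k w W] by (simp add: c_def mult.assoc)
    have "conformal_radius (\<zeta> m * of_real (radial_shift (\<rho> m) t)) / conformal_radius (\<zeta> m * of_real (\<rho> m))
        = (1 - t\<^sup>2) * (norm (deriv (F m) (\<zeta> m * of_real t)) / norm (deriv (F m) 0))" if "\<bar>t\<bar> < 1" for m t
    proof -
      have n: "norm (\<zeta> m * of_real t) = \<bar>t\<bar>" by (simp add: norm_mult \<zeta>)
      have 1: "conformal_radius (\<zeta> m * of_real (radial_shift (\<rho> m) t))
         = (1 - t\<^sup>2) * (dist (f (z m)) (p m) * norm (deriv (F m) (\<zeta> m * of_real t)))"
        using conformal_radius_rescaled[OF z1[of m] _ p(1)[of m], of "\<zeta> m * of_real t"] n that
        by (simp add: disc_shift_radial[OF \<zeta>] z_def F_def)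
      have 2: "conformal_radius (\<zeta> m * of_real (\<rho> m)) = dist (f (z m)) (p m) * norm (deriv (F m) 0)"
        using conformal_radius_rescaled[OF z1[of m] _ p(1)[of m], of 0] by (simp add: z_def F_def)
      have "dist (f (z m)) (p m) \<noteq> 0" using p(1)[of m] in_G[OF z1[of m]] J_disjoint by auto
      then show ?thesis unfolding 1 2 by simp
    qed
    then have "(\<lambda>n. conformal_radius (\<zeta> (r (k n)) * of_real (radial_shift (\<rho> (r (k n))) (s n))) /
             conformal_radius (\<zeta> (r (k n)) * of_real (\<rho> (r (k n)))))
       = (\<lambda>n. (1 - (s n)\<^sup>2) * (norm (deriv (F (r (k n))) (\<zeta> (r (k n)) * of_real (s n))) / norm (deriv (F (r (k n))) 0)))"
      using s(3) by auto
    also have "\<dots> \<longlonglongrightarrow> (1 - \<sigma>\<^sup>2) * (norm (2 * v / (1 + c * of_real \<sigma>)\<^sup>2) / norm (2 * v))"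
      by (intro tendsto_intros dk dk0 s) (use v0 in auto)
    also have "norm (2 * v / (1 + c * of_real \<sigma>)\<^sup>2) / norm (2 * v) = 1 / (norm (1 + c * of_real \<sigma>))\<^sup>2"
      using v by (simp add: norm_divide norm_mult norm_power)
    finally show "(\<lambda>n. conformal_radius (\<zeta> (r (k n)) * of_real (radial_shift (\<rho> (r (k n))) (s n))) /
             conformal_radius (\<zeta> (r (k n)) * of_real (\<rho> (r (k n))))) \<longlonglongrightarrow> (1 - \<sigma>\<^sup>2) / (norm (1 + c * of_real \<sigma>))\<^sup>2"
      by simp
  next
    have "(\<lambda>n. dist (f (z (r n))) (p (r n)) * norm (deriv (F (r n)) 0)) \<longlonglongrightarrow> 0 * norm (2 * v)"
      by (intro tendsto_intros d0 LIMSEQ_subseq_LIMSEQ[OF d r, unfolded o_def])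
    moreover have "conformal_radius (\<zeta> m * of_real (\<rho> m)) = dist (f (z m)) (p m) * norm (deriv (F m) 0)" for m
      using conformal_radius_rescaled[OF z1[of m] _ p(1)[of m], of 0] by (simp add: z_def F_def)
    ultimately show "(\<lambda>n. conformal_radius (\<zeta> (r n) * of_real (\<rho> (r n)))) \<longlonglongrightarrow> 0" by simp
  next
    let ?P = "\<lambda>n. deriv (deriv f) (z n) / deriv f (z n)"
    have "(\<lambda>n. (deriv ^^ 2) (F (r n)) 0) \<longlonglongrightarrow> (deriv ^^ 2) g 0"
    proof (rule higher_deriv_complex_uniform_limit)
      show "uniform_limit (ball 0 (1/2)) (\<lambda>n. F (r n)) g sequentially"
        by (rule uniform_limit_on_subset[OF ulk[of "\<lambda>n. n" "cball 0 (1/2)"]]) (auto simp: strict_mono_def)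
      show "\<forall>\<^sub>F n in sequentially. F (r n) holomorphic_on ball 0 (1/2)"
        by (rule always_eventually) (auto intro: holomorphic_on_subset[OF Fh])
    qed auto
    then have "(\<lambda>n. deriv (deriv (F (r n))) 0) \<longlonglongrightarrow> - 4 * v\<^sup>2"
      using half_plane_map_derivs(2)[OF g v] by (simp add: numeral_2_eq_2)
    then have "(\<lambda>n. \<zeta> (r n) * (deriv (deriv (F (r n))) 0 / deriv (F (r n)) 0) + 2 * of_real (\<rho> (r n))) \<longlonglongrightarrow> Z * (- 4 * v\<^sup>2 / (2 * v)) + 2 * of_real 1"
      by (intro tendsto_intros d0 Zlim v0 LIMSEQ_subseq_LIMSEQ[OF \<rho>(3) r, unfolded o_def])
    moreover have eqc: "Z * (- 4 * v\<^sup>2 / (2 * v)) + 2 * of_real 1 = 2 - 2 * c"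
      using v by (auto simp: c_def power2_eq_square)
    have gen: "x * (A * P - 2 * q) + 2 * w = A * x * P" if "x * q = w" for x A P q w :: complex
      unfolding that[symmetric] by (simp add: algebra_simps)
    have shift: "\<zeta> n * (deriv (deriv (F n)) 0 / deriv (F n) 0) + 2 * of_real (\<rho> n) = of_real (1 - (norm (z n))\<^sup>2) * \<zeta> n * ?P n" for n
    proof -
      have "\<zeta> n * cnj (\<zeta> n) = 1" using \<zeta>[of n] by (simp add: complex_norm_square[symmetric])
      then have "\<zeta> n * cnj (z n) = of_real (\<rho> n)" by (simp add: z_def)
      then show ?thesis
        unfolding F_def pre_schwarzian_rescaled[OF z1 p(1)] by (rule gen)
    qed
    ultimately show "(\<lambda>n. let z = \<zeta> (r n) * of_real (\<rho> (r n)) in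
        of_real (1 - (norm z)\<^sup>2) * \<zeta> (r n) * (deriv (deriv f) z / deriv f z)) \<longlonglongrightarrow> 2 - 2 * c"
      unfolding shift eqc Let_def z_def by blast
  qed
qed

lemma radial_shift_mono:
  assumes "0 \<le> \<rho>" "\<rho> < 1" "- 1 < s" "s \<le> t"
  shows "radial_shift \<rho> s \<le> radial_shift \<rho> t"
proof -
  have pos: "0 < 1 + \<rho> * u" if "- 1 < u" for u
  proof (cases "0 \<le> u")
    case True then show ?thesis using assms by (simp add: add_pos_nonneg)
  next
    case False
    then have "\<rho> * (- u) < 1" using assms that mult_le_one[of \<rho> "- u"] mult_strict_mono[of \<rho> 1 "- u" 1] by simp
    then show ?thesis by simp
  qed
  have "0 \<le> (1 - \<rho> * \<rho>) * (t - s)"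
    using assms mult_le_one[of \<rho> \<rho>] by (intro mult_nonneg_nonneg) auto
  then have "(s + \<rho>) * (1 + \<rho> * t) \<le> (t + \<rho>) * (1 + \<rho> * s)" by (simp add: algebra_simps)
  then show ?thesis unfolding radial_shift_def using pos[of s] pos[of t] assms
    by (simp add: pos_divide_le_eq pos_le_divide_eq mult.commute)
qed

lemma radial_shift_0 [simp]: "radial_shift \<rho> 0 = \<rho>"
  by (simp add: radial_shift_def)

lemma radial_shift_eq:
  assumes "0 \<le> \<rho>'" "\<rho>' \<le> \<rho>" "\<rho> < 1"
  defines "\<sigma> \<equiv> (\<rho> - \<rho>') / (1 - \<rho> * \<rho>')"
  shows "radial_shift \<rho>' \<sigma> = \<rho>" "0 \<le> \<sigma>"
proof -
  have "\<rho> * \<rho>' \<le> \<rho> * 1" using assms by (intro mult_left_mono) auto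
  then have pos: "0 < 1 - \<rho> * \<rho>'" using assms by linarith
  show "0 \<le> \<sigma>" using pos assms by (simp add: \<sigma>_def)
  have "\<rho>' * \<rho>' \<le> \<rho>' * 1" using assms by (intro mult_left_mono) auto
  then have "0 < 1 - \<rho>' * \<rho>'" using assms by linarith
  moreover have "\<sigma> + \<rho>' = \<rho> * (1 - \<rho>' * \<rho>') / (1 - \<rho> * \<rho>')" "1 + \<rho>' * \<sigma> = (1 - \<rho>' * \<rho>') / (1 - \<rho> * \<rho>')"
    using pos by (simp_all add: \<sigma>_def field_simps)
  ultimately show "radial_shift \<rho>' \<sigma> = \<rho>" using pos by (simp add: radial_shift_def)
qed

lemma continuous_conformal_radius: "continuous_on (ball 0 1) conformal_radius"
  unfolding conformal_radius_def
  by (intro continuous_intros holomorphic_on_imp_continuous_on[OF holomorphic_deriv[OF hol]]) auto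

text \<open>The conformal radius has a positive minimum on every compact subset of the disc.\<close>
lemma conformal_radius_small_imp_near_boundary:
  assumes z: "\<And>n. norm (z n) < 1" and lim: "(\<lambda>n. conformal_radius (z n)) \<longlonglongrightarrow> 0"
  shows "(\<lambda>n. norm (z n)) \<longlonglongrightarrow> 1"
proof (rule order_tendstoI)
  fix \<kappa> :: real assume \<kappa>: "\<kappa> < 1"
  show "\<forall>\<^sub>F n in sequentially. \<kappa> < norm (z n)"
  proof (cases "\<kappa> < 0")
    case True then show ?thesis by (simp add: less_le_trans)
  next
    case False
    then have ne: "cball (0::complex) \<kappa> \<noteq> {}" by simp
    have sub: "cball (0::complex) \<kappa> \<subseteq> ball 0 1" using \<kappa> by auto
    obtain u where u: "u \<in> cball 0 \<kappa>" "\<And>v. v \<in> cball 0 \<kappa> \<Longrightarrow> conformal_radius u \<le> conformal_radius v"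
      using continuous_attains_inf[OF compact_cball ne continuous_on_subset[OF continuous_conformal_radius sub]] by blast
    have "0 < conformal_radius u" using u(1) sub conformal_radius_pos by auto
    then have "\<forall>\<^sub>F n in sequentially. conformal_radius (z n) < conformal_radius u" using order_tendstoD(2)[OF lim] by blast
    then show ?thesis
    proof eventually_elim
      case (elim n)
      show ?case
      proof (rule ccontr)
        assume "\<not> \<kappa> < norm (z n)"
        then have "z n \<in> cball 0 \<kappa>" by simp
        then show False using u(2) elim by force
      qed
    qed
  qed
qed (use z in \<open>auto intro!: always_eventually intro: less_trans\<close>)

text \<open>If \<open>c \<noteq> 1\<close>, then a fixed step inwards from the points \<open>\<zeta> n * \<rho> n\<close> eventually halves the conformal
  radius. Replace these points by minimum points \<open>\<zeta> n * \<mu> n\<close> of the conformal radius on the radial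
  segments ending in them; the minimum points tend to the circle as well. Rescale there. Moving inwards
  cannot decrease the conformal radius, which forces the new pole parameter \<open>c'\<close> to be \<open>1\<close>. But for
  this limit the conformal radius decreases strictly outwards, while on the way out to
  \<open>\<zeta> n * \<rho> n\<close> it never gets below its minimum and ends at more than twice this value.\<close>
lemma pole_location:
  fixes c :: complex
  assumes S: "symmetric_quasicircle J"
    and \<rho>: "\<And>n. 0 \<le> \<rho> n" "\<And>n. \<rho> n < 1" "\<rho> \<longlonglongrightarrow> 1" and \<zeta>: "\<And>n. norm (\<zeta> n) = 1"
    and c: "norm c = 1"
    and ratio: "\<And>s. \<bar>s\<bar> < 1 \<Longrightarrow> (\<lambda>n. conformal_radius (\<zeta> n * of_real (radial_shift (\<rho> n) s)) /
             conformal_radius (\<zeta> n * of_real (\<rho> n))) \<longlonglongrightarrow> (1 - s\<^sup>2) / (norm (1 + c * of_real s))\<^sup>2"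
    and lim0: "(\<lambda>n. conformal_radius (\<zeta> n * of_real (\<rho> n))) \<longlonglongrightarrow> 0"
  shows "c = 1"
proof (rule ccontr)
  assume "c \<noteq> 1"
  define D where "D = (\<lambda>n t. conformal_radius (\<zeta> n * of_real t))"
  have nz: "norm (\<zeta> n * of_real t) = \<bar>t\<bar>" for n t by (simp add: norm_mult \<zeta>)
  have Dpos: "0 < D n t" if "0 \<le> t" "t < 1" for n t
    unfolding D_def using nz[of n t] that by (intro conformal_radius_pos) simp
  have sq: "(norm (1 + c * of_real s))\<^sup>2 = 1 + 2 * s * Re c + s\<^sup>2" if "norm c = 1" for c :: complex and s :: real
  proof -
    have "(Re c)\<^sup>2 + (Im c)\<^sup>2 = 1" using that cmod_power2[of c] by simp
    then have "s\<^sup>2 * (Re c)\<^sup>2 + s\<^sup>2 * (Im c)\<^sup>2 = s\<^sup>2" by (metis distrib_left mult.right_neutral)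
    then show ?thesis unfolding cmod_power2 by (simp add: power2_eq_square algebra_simps)
  qed
  have Re1: "c' = 1" if "norm c' = 1" "1 \<le> Re c'" for c' :: complex
  proof -
    have "Re c' = 1" using that complex_Re_le_cmod[of c'] by simp
    moreover have "(Re c')\<^sup>2 + (Im c')\<^sup>2 = 1" using that cmod_power2[of c'] by simp
    ultimately show ?thesis by (simp add: complex_eq_iff)
  qed
  define \<delta> where "\<delta> = 1 - Re c"
  have "\<not> 1 \<le> Re c" using Re1[OF c] \<open>c \<noteq> 1\<close> by blast
  then have \<delta>: "0 < \<delta>" "\<delta> \<le> 2" using abs_Re_le_cmod[of c] c by (auto simp: \<delta>_def)
  \<comment> \<open>For this inward step the limit ratio \<open>(1 - s\<^sup>2) / |1 - c s|\<^sup>2\<close> is below \<open>1 / 2\<close>.\<close>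
  define s where "s = 1 - \<delta> / 8"
  have s: "0 < s" "s < 1" using \<delta> by (auto simp: s_def)
  have "\<forall>\<^sub>F n in sequentially. D n (radial_shift (\<rho> n) (- s)) / D n (\<rho> n) < 1 / 2"
  proof (rule order_tendstoD(2))
    show "(\<lambda>n. D n (radial_shift (\<rho> n) (- s)) / D n (\<rho> n)) \<longlonglongrightarrow> (1 - (- s)\<^sup>2) / (norm (1 + c * of_real (- s)))\<^sup>2"
      unfolding D_def by (rule ratio) (use s in simp)
    have "0 < \<delta> * (3 / 2 - \<delta> / 4)" using \<delta> by (intro mult_pos_pos) auto
    also have "\<dots> = 2 * (1 - \<delta> / 8) * \<delta> - \<delta> / 2" by (simp add: algebra_simps)
    also have "\<dots> \<le> 2 * s * \<delta> - (3 * s + 1) * (1 - s)"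
    proof -
      have "(3 * s + 1) * (1 - s) \<le> 4 * (1 - s)" using s by (intro mult_right_mono) auto
      then show ?thesis by (simp add: s_def)
    qed
    also have "\<dots> = (1 + 2 * (- s) * Re c + (- s)\<^sup>2) - 2 * (1 - (- s)\<^sup>2)"
      by (simp add: \<delta>_def power2_eq_square algebra_simps)
    finally have "2 * (1 - (- s)\<^sup>2) < 1 + 2 * (- s) * Re c + (- s)\<^sup>2" by simp
    moreover have "0 < 1 - (- s)\<^sup>2" using s by (simp add: abs_square_less_1)
    ultimately show "(1 - (- s)\<^sup>2) / (norm (1 + c * of_real (- s)))\<^sup>2 < 1 / 2"
      unfolding sq[OF c] by (simp add: divide_less_eq)
  qed
  moreover have "\<forall>\<^sub>F n in sequentially. s < \<rho> n" using order_tendstoD(1)[OF \<rho>(3) s(2)] .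
  ultimately have "\<forall>\<^sub>F n in sequentially. \<exists>t\<in>{0..\<rho> n}. D n t < D n (\<rho> n) / 2"
  proof eventually_elim
    case (elim n)
    have "radial_shift (\<rho> n) (- s) \<le> \<rho> n" using radial_shift_mono[of "\<rho> n" "- s" 0] \<rho> s by simp
    moreover have "0 \<le> radial_shift (\<rho> n) (- s)"
      unfolding radial_shift_def using elim(2) s \<rho>(1,2)[of n] mult_le_one[of "\<rho> n" s] by (intro divide_nonneg_nonneg) auto
    moreover have "D n (radial_shift (\<rho> n) (- s)) < D n (\<rho> n) / 2"
      using elim(1) Dpos[OF \<rho>(1,2)] by (simp add: divide_less_eq)
    ultimately show ?case by auto
  qed
  then obtain N where N: "\<And>n. N \<le> n \<Longrightarrow> \<exists>t\<in>{0..\<rho> n}. D n t < D n (\<rho> n) / 2"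
    unfolding eventually_sequentially by blast
  have "\<exists>t\<in>{0..\<rho> n}. \<forall>t'\<in>{0..\<rho> n}. D n t \<le> D n t'" for n
  proof (rule continuous_attains_inf)
    show "continuous_on {0..\<rho> n} (D n)"
      unfolding D_def by (rule continuous_on_compose2[OF continuous_conformal_radius])
        (use nz \<rho>(2)[of n] in \<open>auto intro!: continuous_intros\<close>)
  qed (use \<rho> in auto)
  then obtain \<mu> where \<mu>: "\<And>n. 0 \<le> \<mu> n" "\<And>n. \<mu> n \<le> \<rho> n" "\<And>n t. 0 \<le> t \<Longrightarrow> t \<le> \<rho> n \<Longrightarrow> D n (\<mu> n) \<le> D n t"
    by (metis atLeastAtMost_iff)
  have \<mu>1: "\<mu> n < 1" for n using \<mu>(2)[of n] \<rho>(2)[of n] by linarith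
  have "(\<lambda>n. D n (\<mu> n)) \<longlonglongrightarrow> 0"
  proof (rule tendsto_sandwich[OF _ _ tendsto_const lim0])
    show "\<forall>\<^sub>F n in sequentially. 0 \<le> D n (\<mu> n)" using Dpos \<mu> \<mu>1 by (auto intro!: always_eventually less_imp_le)
    show "\<forall>\<^sub>F n in sequentially. D n (\<mu> n) \<le> conformal_radius (\<zeta> n * of_real (\<rho> n))"
      using \<mu>(3)[OF \<rho>(1)] by (auto intro!: always_eventually simp: D_def)
  qed
  then have "(\<lambda>n. norm (\<zeta> n * of_real (\<mu> n))) \<longlonglongrightarrow> 1"
    unfolding D_def by (intro conformal_radius_small_imp_near_boundary) (use nz \<mu>(1) \<mu>1 in auto)
  then have \<mu>lim: "\<mu> \<longlonglongrightarrow> 1" using nz \<mu>(1) by simp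
  then have \<mu>limN: "(\<lambda>n. \<mu> (n + N)) \<longlonglongrightarrow> 1" by (rule LIMSEQ_ignore_initial_segment)
  obtain r c' where r: "strict_mono (r :: nat \<Rightarrow> nat)" and c': "norm (c' :: complex) = 1"
    and ratio': "\<And>k s \<sigma>. strict_mono k \<Longrightarrow> s \<longlonglongrightarrow> \<sigma> \<Longrightarrow> \<bar>\<sigma>\<bar> < 1 \<Longrightarrow> \<forall>n. \<bar>s n\<bar> < 1 \<Longrightarrow>
        (\<lambda>n. conformal_radius (\<zeta> (r (k n) + N) * of_real (radial_shift (\<mu> (r (k n) + N)) (s n))) /
             conformal_radius (\<zeta> (r (k n) + N) * of_real (\<mu> (r (k n) + N)))) \<longlonglongrightarrow> (1 - \<sigma>\<^sup>2) / (norm (1 + c' * of_real \<sigma>))\<^sup>2"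
    by (rule radial_limit[where \<rho> = "\<lambda>n. \<mu> (n + N)" and \<zeta> = "\<lambda>n. \<zeta> (n + N)", OF S \<mu>(1) \<mu>1 \<mu>limN \<zeta>]; (assumption | (rule that; assumption)))
  define m where "m = (\<lambda>n. r n + N)"
  have m: "filterlim m sequentially sequentially"
    unfolding m_def by (rule filterlim_subseq) (use r in \<open>simp add: strict_mono_def\<close>)
  have mlim: "(\<lambda>n. \<mu> (m n)) \<longlonglongrightarrow> 1" using filterlim_compose[OF \<mu>lim m] .
  have ratio: "(\<lambda>n. D (m (k n)) (radial_shift (\<mu> (m (k n))) (s n)) / D (m (k n)) (\<mu> (m (k n)))) \<longlonglongrightarrow> (1 - \<sigma>\<^sup>2) / (norm (1 + c' * of_real \<sigma>))\<^sup>2"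
    if "strict_mono k" "s \<longlonglongrightarrow> \<sigma>" "\<bar>\<sigma>\<bar> < 1" "\<forall>n. \<bar>s n\<bar> < 1" for k s \<sigma>
    using ratio'[OF that] unfolding D_def m_def .
  have Dm: "0 < D n (\<mu> n)" for n using Dpos \<mu>(1) \<mu>1 by simp
  have min1: "1 \<le> D n t / D n (\<mu> n)" if "0 \<le> t" "t \<le> \<rho> n" for n t
    using \<mu>(3)[OF that] Dm[of n] by (simp add: le_divide_eq)
  \<comment> \<open>Inward steps of every length \<open>t < 1\<close> are possible in the limit; \<open>t \<longlonglongrightarrow> 1\<close> gives the bound on \<open>Re c'\<close>.\<close>
  have "c' = 1"
  proof (rule Re1[OF c'])
    show "1 \<le> Re c'"
    proof (rule dense_le_bounded[of 0 1])
      fix t :: real assume t: "0 < t" "t < 1"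
      have lim: "(\<lambda>n. D (m n) (radial_shift (\<mu> (m n)) (- t)) / D (m n) (\<mu> (m n))) \<longlonglongrightarrow> (1 - (- t)\<^sup>2) / (norm (1 + c' * of_real (- t)))\<^sup>2"
        using ratio[of "\<lambda>n. n" "\<lambda>_. - t" "- t"] t by (simp add: strict_mono_def)
      have "\<forall>\<^sub>F n in sequentially. t < \<mu> (m n)" using order_tendstoD(1)[OF mlim t(2)] .
      then have "\<forall>\<^sub>F n in sequentially. 1 \<le> D (m n) (radial_shift (\<mu> (m n)) (- t)) / D (m n) (\<mu> (m n))"
      proof eventually_elim
        case (elim n)
        show ?case
        proof (rule min1)
          show "0 \<le> radial_shift (\<mu> (m n)) (- t)"
            unfolding radial_shift_def using elim t \<mu>(1)[of "m n"] \<mu>1[of "m n"] mult_le_one[of "\<mu> (m n)" t] by (intro divide_nonneg_nonneg) auto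
          show "radial_shift (\<mu> (m n)) (- t) \<le> \<rho> (m n)"
            using radial_shift_mono[of "\<mu> (m n)" "- t" 0] \<mu>(1)[of "m n"] \<mu>1[of "m n"] \<mu>(2)[of "m n"] t by simp
        qed
      qed
      then have le: "1 \<le> (1 - (- t)\<^sup>2) / (norm (1 + c' * of_real (- t)))\<^sup>2"
        by (rule tendsto_lowerbound[OF lim]) auto
      have "norm (1 + c' * of_real (- t)) \<noteq> 0" using le by (metis div_by_0 not_one_le_zero power_zero_numeral)
      then have "0 < (norm (1 + c' * of_real (- t)))\<^sup>2" by simp
      then have "(norm (1 + c' * of_real (- t)))\<^sup>2 \<le> 1 - (- t)\<^sup>2" using le by (simp add: le_divide_eq)
      then have "2 * t * t \<le> 2 * t * Re c'" unfolding sq[OF c'] by (simp add: power2_eq_square)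
      then show "t \<le> Re c'" using t by simp
    qed simp
  qed
  \<comment> \<open>The outward step from \<open>\<mu>\<close> to \<open>\<rho>\<close> may be unbounded, so it is cut off at \<open>1 / 2\<close> to have a limit.\<close>
  define \<sigma> where "\<sigma> = (\<lambda>n. (\<rho> n - \<mu> n) / (1 - \<rho> n * \<mu> n))"
  have \<sigma>: "radial_shift (\<mu> n) (\<sigma> n) = \<rho> n" "0 \<le> \<sigma> n" for n
    using radial_shift_eq[OF \<mu>(1,2) \<rho>(2)] by (simp_all add: \<sigma>_def)
  define \<tau> where "\<tau> = (\<lambda>n. min (\<sigma> (m n)) (1 / 2))"
  have \<tau>: "0 \<le> \<tau> n" "\<tau> n \<le> 1 / 2" "\<tau> n \<le> \<sigma> (m n)" for n using \<sigma> by (auto simp: \<tau>_def)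
  have "seq_compact {0..1/2::real}" using compact_Icc compact_eq_seq_compact_metric by blast
  then obtain k T where T: "T \<in> {0..1/2}" "strict_mono k" "(\<tau> \<circ> k) \<longlonglongrightarrow> T"
    using \<tau> unfolding seq_compact_def by (metis atLeastAtMost_iff)
  have lim: "(\<lambda>n. D (m (k n)) (radial_shift (\<mu> (m (k n))) (\<tau> (k n))) / D (m (k n)) (\<mu> (m (k n)))) \<longlonglongrightarrow> (1 - T\<^sup>2) / (norm (1 + c' * of_real T))\<^sup>2"
  proof (rule ratio[OF T(2)])
    show "(\<lambda>n. \<tau> (k n)) \<longlonglongrightarrow> T" using T(3) by (simp add: o_def)
    have "\<bar>\<tau> (k n)\<bar> < 1" for n using \<tau>[of "k n"] by simp
    then show "\<forall>n. \<bar>\<tau> (k n)\<bar> < 1" by blast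
  qed (use T in simp)
  have ge1: "1 \<le> D (m (k n)) (radial_shift (\<mu> (m (k n))) (\<tau> (k n))) / D (m (k n)) (\<mu> (m (k n)))" for n
  proof (rule min1)
    have "radial_shift (\<mu> (m (k n))) 0 \<le> radial_shift (\<mu> (m (k n))) (\<tau> (k n))"
      by (rule radial_shift_mono) (use \<mu>(1) \<mu>1 \<tau> in auto)
    then show "0 \<le> radial_shift (\<mu> (m (k n))) (\<tau> (k n))" using \<mu>(1)[of "m (k n)"] by simp
    have "radial_shift (\<mu> (m (k n))) (\<tau> (k n)) \<le> radial_shift (\<mu> (m (k n))) (\<sigma> (m (k n)))"
      by (rule radial_shift_mono) (use \<mu>(1) \<mu>1 \<tau>(3) \<tau>(1)[of "k n"] in auto)
    then show "radial_shift (\<mu> (m (k n))) (\<tau> (k n)) \<le> \<rho> (m (k n))" using \<sigma>(1) by simp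
  qed
  have "1 \<le> (1 - T\<^sup>2) / (norm (1 + c' * of_real T))\<^sup>2"
    by (rule tendsto_lowerbound[OF lim]) (use ge1 in auto)
  also have "\<dots> = (1 - T) / (1 + T)"
  proof -
    have "(norm (1 + c' * of_real T))\<^sup>2 = (1 + T)\<^sup>2" unfolding sq[OF c'] by (simp add: \<open>c' = 1\<close> power2_eq_square algebra_simps)
    moreover have "1 - T\<^sup>2 = (1 - T) * (1 + T)" by (simp add: power2_eq_square algebra_simps)
    ultimately show ?thesis using T(1) by (simp add: power2_eq_square)
  qed
  finally have "T = 0" using T(1) by (simp add: le_divide_eq)
  then have lim1: "(\<lambda>n. D (m (k n)) (radial_shift (\<mu> (m (k n))) (\<tau> (k n))) / D (m (k n)) (\<mu> (m (k n)))) \<longlonglongrightarrow> 1" using lim by simp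
  have "(\<lambda>n. \<tau> (k n)) \<longlonglongrightarrow> 0" using T(3) \<open>T = 0\<close> by (simp add: o_def)
  then have "\<forall>\<^sub>F n in sequentially. \<tau> (k n) < 1 / 2" by (rule order_tendstoD(2)) simp
  then have "\<forall>\<^sub>F n in sequentially. 2 \<le> D (m (k n)) (radial_shift (\<mu> (m (k n))) (\<tau> (k n))) / D (m (k n)) (\<mu> (m (k n)))"
  proof eventually_elim
    case (elim n)
    define j where "j = m (k n)"
    have "\<tau> (k n) = \<sigma> j" using elim by (auto simp: \<tau>_def j_def min_def split: if_splits)
    then have e: "radial_shift (\<mu> j) (\<tau> (k n)) = \<rho> j" using \<sigma>(1) by simp
    obtain t where "t \<in> {0..\<rho> j}" "D j t < D j (\<rho> j) / 2" using N[of j] by (auto simp: j_def m_def)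
    then have "2 * D j (\<mu> j) \<le> D j (\<rho> j)" using \<mu>(3)[of t j] by simp
    then show ?case using Dm[of j] e by (simp add: le_divide_eq flip: j_def)
  qed
  then have "(2::real) \<le> 1" by (rule tendsto_lowerbound[OF lim1]) auto
  then show False by simp
qed

text \<open>Along a bad sequence, \<open>radial_limit\<close> produces a limit with \<open>2 - 2 c\<close> bounded away from \<open>0\<close>,
  against \<open>pole_location\<close>.\<close>
proposition symmetric_quasicircle_imp_vanishing:
  assumes S: "symmetric_quasicircle J"
  shows "vanishing_pre_schwarzian f"
proof (rule ccontr)
  assume "\<not> ?thesis"
  then obtain \<epsilon> where \<epsilon>: "0 < \<epsilon>" and bad: "\<And>\<rho>. \<rho> < 1 \<Longrightarrow> \<exists>z. \<rho> \<le> norm z \<and> norm z < 1 \<and>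
        \<epsilon> < (1 - norm z) * norm (deriv (deriv f) z / deriv f z)"
    unfolding vanishing_pre_schwarzian_def by (auto simp: not_le)
  have "\<exists>z. 1 - 1 / real (n + 2) \<le> norm z \<and> norm z < 1 \<and> \<epsilon> < (1 - norm z) * norm (deriv (deriv f) z / deriv f z)" for n
    by (rule bad) simp
  then obtain z where z: "\<And>n. 1 - 1 / real (n + 2) \<le> norm (z n)" "\<And>n. norm (z n) < 1"
      "\<And>n. \<epsilon> < (1 - norm (z n)) * norm (deriv (deriv f) (z n) / deriv f (z n))"
    by metis
  have z0: "z n \<noteq> 0" for n
  proof
    assume "z n = 0"
    then have "1 \<le> 1 / real (n + 2)" using z(1)[of n] by simp
    then show False by (simp add: le_divide_eq)
  qed
  define \<rho> where "\<rho> = (\<lambda>n. norm (z n))"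
  define \<zeta> where "\<zeta> = (\<lambda>n. sgn (z n))"
  have zeq: "\<zeta> n * of_real (\<rho> n) = z n" for n
    using z0[of n] by (simp add: \<zeta>_def \<rho>_def sgn_div_norm scaleR_conv_of_real)
  have \<zeta>: "norm (\<zeta> n) = 1" for n using z0 by (simp add: \<zeta>_def norm_sgn)
  have \<rho>: "0 \<le> \<rho> n" "\<rho> n < 1" for n using z(2) by (simp_all add: \<rho>_def)
  have \<rho>lim: "\<rho> \<longlonglongrightarrow> 1"
  proof (rule tendsto_sandwich[OF _ _ _ tendsto_const])
    have "(\<lambda>n. 1 - 1 / real (n + 2)) \<longlonglongrightarrow> 1 - 0"
      by (intro tendsto_diff tendsto_const LIMSEQ_ignore_initial_segment lim_1_over_n)
    then show "(\<lambda>n. 1 - 1 / real (n + 2)) \<longlonglongrightarrow> 1" by simp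
  qed (use z \<rho> in \<open>auto intro!: always_eventually less_imp_le simp: \<rho>_def\<close>)
  obtain r c where r: "strict_mono (r :: nat \<Rightarrow> nat)" and c: "norm c = 1"
    and ratio: "\<And>k s \<sigma>. strict_mono k \<Longrightarrow> s \<longlonglongrightarrow> \<sigma> \<Longrightarrow> \<bar>\<sigma>\<bar> < 1 \<Longrightarrow> \<forall>n. \<bar>s n\<bar> < 1 \<Longrightarrow>
        (\<lambda>n. conformal_radius (\<zeta> (r (k n)) * of_real (radial_shift (\<rho> (r (k n))) (s n))) /
             conformal_radius (\<zeta> (r (k n)) * of_real (\<rho> (r (k n))))) \<longlonglongrightarrow> (1 - \<sigma>\<^sup>2) / (norm (1 + c * of_real \<sigma>))\<^sup>2"
    and lim0: "(\<lambda>n. conformal_radius (\<zeta> (r n) * of_real (\<rho> (r n)))) \<longlonglongrightarrow> 0"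
    and P: "(\<lambda>n. let z = \<zeta> (r n) * of_real (\<rho> (r n)) in
        of_real (1 - (norm z)\<^sup>2) * \<zeta> (r n) * (deriv (deriv f) z / deriv f z)) \<longlonglongrightarrow> 2 - 2 * c"
    by (rule radial_limit[OF S \<rho> \<rho>lim \<zeta>]; (assumption | (rule that; assumption)))
  have "c = 1"
  proof (rule pole_location[OF S _ _ _ _ c])
    show "(\<lambda>n. \<rho> (r n)) \<longlonglongrightarrow> 1" using LIMSEQ_subseq_LIMSEQ[OF \<rho>lim r] by (simp add: o_def)
    show "(\<lambda>n. conformal_radius (\<zeta> (r n) * of_real (radial_shift (\<rho> (r n)) s)) /
             conformal_radius (\<zeta> (r n) * of_real (\<rho> (r n)))) \<longlonglongrightarrow> (1 - s\<^sup>2) / (norm (1 + c * of_real s))\<^sup>2"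
      if "\<bar>s\<bar> < 1" for s using ratio[of "\<lambda>n. n" "\<lambda>_. s" s] that by (simp add: strict_mono_def)
  qed (use \<rho> \<zeta> lim0 in auto)
  then have "(\<lambda>n. of_real (1 - (norm (z (r n)))\<^sup>2) * \<zeta> (r n) * (deriv (deriv f) (z (r n)) / deriv f (z (r n)))) \<longlonglongrightarrow> 0"
    using P by (simp add: zeq Let_def)
  then have "\<forall>\<^sub>F n in sequentially. norm (of_real (1 - (norm (z (r n)))\<^sup>2) * \<zeta> (r n) * (deriv (deriv f) (z (r n)) / deriv f (z (r n)))) < \<epsilon>"
    using order_tendstoD(2)[OF tendsto_norm_zero \<epsilon>] by blast
  then obtain n where n: "norm (of_real (1 - (norm (z (r n)))\<^sup>2) * \<zeta> (r n) * (deriv (deriv f) (z (r n)) / deriv f (z (r n)))) < \<epsilon>"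
    using eventually_happens by force
  define x where "x = norm (z (r n))"
  have x: "0 \<le> x" "x < 1" using z(2) by (simp_all add: x_def)
  have "x * x \<le> x * 1" using x by (intro mult_left_mono) auto
  then have xx: "1 - x \<le> 1 - x\<^sup>2" by (simp add: power2_eq_square)
  have "norm (of_real (1 - x\<^sup>2) * \<zeta> (r n) * (deriv (deriv f) (z (r n)) / deriv f (z (r n)))) = \<bar>1 - x\<^sup>2\<bar> * norm (deriv (deriv f) (z (r n)) / deriv f (z (r n)))"
    by (simp only: norm_mult norm_of_real \<zeta> mult_1_right)
  moreover have "(1 - x) * norm (deriv (deriv f) (z (r n)) / deriv f (z (r n))) \<le> \<bar>1 - x\<^sup>2\<bar> * norm (deriv (deriv f) (z (r n)) / deriv f (z (r n)))"
    using xx x by (intro mult_right_mono) auto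
  ultimately show False using n z(3)[of "r n"] by (simp only: x_def[symmetric])
qed

end

section \<open>Extension to the boundary\<close>

text \<open>By the Jordan curve theorem the only components of the complement are the inside and the
  unbounded outside of the curve.\<close>
lemma bounded_jordan_domain_frontier:
  assumes "bounded_jordan_domain G"
  shows "jordan_curve (frontier G)" "bounded G"
proof -
  obtain J where J: "jordan_curve J" "G \<in> components (- J)" "bounded G"
    using assms unfolding bounded_jordan_domain_def by blast
  obtain \<gamma> where \<gamma>: "simple_path \<gamma>" "pathfinish \<gamma> = pathstart \<gamma>" "path_image \<gamma> = J"
    using J(1) unfolding jordan_curve_def by blast
  note JC = Jordan_inside_outside[OF \<gamma>(1,2), unfolded \<gamma>(3)]
  have union: "inside J \<union> outside J = - J" using JC by simp
  have "G \<inter> outside J = {}"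
  proof (rule ccontr)
    assume "G \<inter> outside J \<noteq> {}"
    moreover have "connected (outside J)" "outside J \<subseteq> - J" using JC by (simp, auto simp: outside_def)
    ultimately have "outside J \<subseteq> G" using components_maximal[OF J(2)] by metis
    moreover have "\<not> bounded (outside J)" using JC by simp
    ultimately show False using J(3) bounded_subset by metis
  qed
  moreover have "G \<subseteq> - J" "G \<noteq> {}" using J(2) in_components_subset in_components_nonempty by blast+
  ultimately have sub: "G \<subseteq> inside J" "G \<inter> inside J \<noteq> {}" using union by blast+
  moreover have "connected (inside J)" "inside J \<subseteq> - J" using JC by (simp, auto simp: inside_def)
  ultimately have "inside J \<subseteq> G" using components_maximal[OF J(2)] by metis
  then have "G = inside J" using sub by simp
  then show "jordan_curve (frontier G)" "bounded G" using JC J by auto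
qed

lemma jordan_curve_minus_point_connected:
  assumes "jordan_curve J" "p \<in> J"
  shows "connected (J - {p})"
proof -
  obtain \<gamma> where \<gamma>: "simple_path \<gamma>" "pathfinish \<gamma> = pathstart \<gamma>" "path_image \<gamma> = J"
    using assms(1) unfolding jordan_curve_def by blast
  obtain s where s: "s \<in> {0..1}" "\<gamma> s = p" using assms(2) \<gamma>(3) unfolding path_image_def by auto
  have "simple_path (shiftpath s \<gamma>)" "path_image (shiftpath s \<gamma>) = J" "pathstart (shiftpath s \<gamma>) = p"
    "pathfinish (shiftpath s \<gamma>) = p"
    using simple_path_shiftpath[OF \<gamma>(1,2)] path_image_shiftpath[OF s(1) \<gamma>(2)] pathstart_shiftpath[of s \<gamma>]
      pathfinish_shiftpath[of s \<gamma>] \<gamma> s by auto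
  then show ?thesis using connected_simple_path_endless[of "shiftpath s \<gamma>"] by simp
qed

lemma chord_norm:
  fixes a b :: complex
  assumes "norm a = 1" "norm b = 1"
  shows "(norm (a + of_real s * (b - a)))\<^sup>2 = 1 - s * (1 - s) * (norm (b - a))\<^sup>2"
proof -
  have a: "(Re a)\<^sup>2 = 1 - (Im a)\<^sup>2" and b: "(Re b)\<^sup>2 = 1 - (Im b)\<^sup>2"
    using assms cmod_power2[of a] cmod_power2[of b] by simp_all
  show ?thesis
    unfolding cmod_power2 using a b by (simp add: power2_eq_square) algebra
qed

context conformal_map_disc
begin

text \<open>For \<open>a\<close> much closer to \<open>x\<close> than a comparison point \<open>b\<close> at a fixed distance, the ratio of the image
  distances is small, and \<open>|f x - f b|\<close> is bounded. The point \<open>b\<close> is chosen on the diameter through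
  \<open>x\<close>, so that it stays in the disc.\<close>
lemma asymptotically_symmetric_imp_uniformly_continuous:
  assumes AS: "asymptotically_symmetric_on (ball 0 1) f"
  shows "uniformly_continuous_on (ball 0 1) f"
  unfolding uniformly_continuous_on_def
proof (intro allI impI)
  fix e :: real assume e: "0 < e"
  obtain M where M: "0 < M" "\<And>w. w \<in> G \<Longrightarrow> norm w \<le> M" using bounded_G unfolding bounded_pos by blast
  define t where "t = min 1 (e / (8 * M))"
  have t: "0 < t" "t \<le> 1" using e M by (auto simp: t_def)
  obtain \<delta>0 where \<delta>0: "0 < \<delta>0" and as: "\<And>x a b c. x \<in> ball 0 1 \<Longrightarrow> a \<in> ball 0 1 \<Longrightarrow> b \<in> ball 0 1 \<Longrightarrow> c \<in> ball 0 1 \<Longrightarrow>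
      x \<noteq> a \<Longrightarrow> x \<noteq> b \<Longrightarrow> a \<noteq> b \<Longrightarrow> {x, a, b} \<subseteq> ball c \<delta>0 \<Longrightarrow> dist x a / dist x b \<le> t \<Longrightarrow>
      dist (f x) (f a) / dist (f x) (f b) \<le> (1 + 1) * t"
    using AS t(1) zero_less_one unfolding asymptotically_symmetric_on_def by metis
  define \<delta> where "\<delta> = min \<delta>0 1"
  have \<delta>: "0 < \<delta>" "\<delta> \<le> 1" "\<delta> \<le> \<delta>0" using \<delta>0 by (auto simp: \<delta>_def)
  show "\<exists>d>0. \<forall>x\<in>ball 0 1. \<forall>x'\<in>ball 0 1. dist x' x < d \<longrightarrow> dist (f x') (f x) < e"
  proof (intro exI[of _ "t * \<delta> / 4"] conjI ballI impI)
    show "0 < t * \<delta> / 4" using t \<delta> by simp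
    fix x a :: complex assume x: "x \<in> ball 0 1" and a: "a \<in> ball 0 1" and d: "dist a x < t * \<delta> / 4"
    show "dist (f a) (f x) < e"
    proof (cases "a = x")
      case True then show ?thesis using e by simp
    next
      case False
      define u where "u = (if x = 0 then 1 else sgn x)"
      have u: "norm u = 1" "x = of_real (norm x) * u"
        by (auto simp: u_def sgn_div_norm scaleR_conv_of_real norm_mult norm_inverse)
      define b where "b = x - of_real (\<delta> / 4) * u"
      have "b = of_real (norm x - \<delta> / 4) * u" unfolding b_def by (subst u(2)) (simp add: algebra_simps)
      then have "norm b = \<bar>norm x - \<delta> / 4\<bar>" using u(1) by (simp only: norm_mult norm_of_real mult_1_right)
      then have b1: "b \<in> ball 0 1" using x \<delta> norm_ge_zero[of x] by (auto simp: abs_if simp del: norm_ge_zero)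
      have xb: "dist x b = \<delta> / 4"
      proof -
        have "x - b = of_real (\<delta> / 4) * u" by (simp add: b_def)
        then show ?thesis using u(1) \<delta> by (simp only: dist_norm norm_mult norm_of_real)
      qed
      have xb0: "0 < dist x b" unfolding xb using \<delta> by simp
      have "t * \<delta> \<le> 1 * \<delta>" using t \<delta> by (intro mult_right_mono) auto
      then have dx: "dist x a < dist x b" using d xb by (simp add: dist_commute)
      have "dist (f x) (f a) / dist (f x) (f b) \<le> (1 + 1) * t"
      proof (rule as[of _ _ _ x])
        show "{x, a, b} \<subseteq> ball x \<delta>0" using dx xb \<delta> by auto
        have "dist x a \<le> t * dist x b" unfolding xb using d by (simp add: dist_commute)
        then show "dist x a / dist x b \<le> t" using xb0 by (simp only: pos_divide_le_eq)
        show "x \<noteq> b" using xb0 by auto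
        show "a \<noteq> b" using dx by auto
      qed (use x a b1 False in auto)
      moreover have "f x \<noteq> f b" using inj x b1 xb \<delta> by (auto dest: inj_onD)
      ultimately have "dist (f x) (f a) \<le> 2 * t * dist (f x) (f b)" by (simp add: divide_le_eq)
      also have "\<dots> \<le> 2 * t * (2 * M)"
      proof (rule mult_left_mono)
        have "norm (f x) \<le> M" "norm (f b) \<le> M" using M(2) in_G x b1 by auto
        then show "dist (f x) (f b) \<le> 2 * M" using norm_triangle_ineq4[of "f x" "f b"] by (simp add: dist_norm)
      qed (use t in simp)
      also have "\<dots> \<le> 4 * (e / (8 * M)) * M"
      proof -
        have "t * M \<le> e / (8 * M) * M" using M by (intro mult_right_mono) (auto simp: t_def)
        then show ?thesis by linarith
      qed
      also have "\<dots> < e" using M e by simp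
      finally show ?thesis by (simp add: dist_commute)
    qed
  qed
qed

end

locale boundary_extension = conformal_map_disc +
  fixes F :: "complex \<Rightarrow> complex"
  assumes cont_F: "continuous_on (cball 0 1) F" and F_eq: "\<And>z. z \<in> ball 0 1 \<Longrightarrow> F z = f z"
begin

lemma radial_tendsto:
  assumes "norm x \<le> 1"
  shows "((\<lambda>s. f (of_real s * x)) \<longlongrightarrow> F x) (at_left 1)"
proof (rule Lim_transform_eventually)
  have ev: "\<forall>\<^sub>F s in at_left (1::real). s \<in> {0<..<1}" by (rule eventually_at_left_real) simp
  have in_ball: "of_real s * x \<in> ball 0 1" if "s \<in> {0<..<1}" for s
  proof -
    have "s * norm x \<le> s * 1" using assms that by (intro mult_left_mono) auto
    also have "\<dots> < 1" using that by simp
    finally have "s * norm x < 1" .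
    then show ?thesis using that by (simp add: norm_mult)
  qed
  show "((\<lambda>s. F (of_real s * x)) \<longlongrightarrow> F x) (at_left 1)"
  proof (rule continuous_on_tendsto_compose[OF cont_F])
    have "((\<lambda>s. of_real s * x) \<longlongrightarrow> of_real 1 * x) (at_left (1::real))" by (intro tendsto_intros)
    then show "((\<lambda>s. of_real s * x) \<longlongrightarrow> x) (at_left (1::real))" by simp
    show "\<forall>\<^sub>F s in at_left 1. of_real s * x \<in> cball 0 1"
      using ev by eventually_elim (use in_ball in force)
  qed (use assms in simp)
  show "\<forall>\<^sub>F s in at_left 1. F (of_real s * x) = f (of_real s * x)"
    using ev by eventually_elim (use in_ball F_eq in blast)
qed

text \<open>Shrinking the three points radially towards \<open>0\<close> does not change the ratio of their distances, so
  the inequality for \<open>f\<close> passes to the limit.\<close>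
lemma extension_asymptotically_symmetric:
  assumes AS: "asymptotically_symmetric_on (ball 0 1) f" and e: "0 < e" and t: "0 < t"
  obtains \<delta> where "0 < \<delta>" "\<And>x a b c. {x, a, b, c} \<subseteq> cball 0 1 \<Longrightarrow> x \<noteq> a \<Longrightarrow> x \<noteq> b \<Longrightarrow> a \<noteq> b \<Longrightarrow>
      {x, a, b} \<subseteq> ball c \<delta> \<Longrightarrow> dist x a / dist x b \<le> t \<Longrightarrow> dist (F x) (F a) \<le> (1 + e) * t * dist (F x) (F b)"
proof -
  obtain \<delta> where \<delta>: "0 < \<delta>" and as: "\<And>x a b c. x \<in> ball 0 1 \<Longrightarrow> a \<in> ball 0 1 \<Longrightarrow> b \<in> ball 0 1 \<Longrightarrow> c \<in> ball 0 1 \<Longrightarrow>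
      x \<noteq> a \<Longrightarrow> x \<noteq> b \<Longrightarrow> a \<noteq> b \<Longrightarrow> {x, a, b} \<subseteq> ball c \<delta> \<Longrightarrow> dist x a / dist x b \<le> t \<Longrightarrow>
      dist (f x) (f a) / dist (f x) (f b) \<le> (1 + e) * t"
    using AS e t unfolding asymptotically_symmetric_on_def by metis
  show ?thesis
  proof (rule that[OF \<delta>])
    fix x a b c :: complex
    assume in_cball: "{x, a, b, c} \<subseteq> cball 0 1" and ne: "x \<noteq> a" "x \<noteq> b" "a \<noteq> b"
      and close: "{x, a, b} \<subseteq> ball c \<delta>" and ratio: "dist x a / dist x b \<le> t"
    show "dist (F x) (F a) \<le> (1 + e) * t * dist (F x) (F b)"
    proof (rule tendsto_le[OF trivial_limit_at_left_real])
      show "((\<lambda>s. dist (f (of_real s * x)) (f (of_real s * a))) \<longlongrightarrow> dist (F x) (F a)) (at_left 1)"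
        by (intro tendsto_dist radial_tendsto) (use in_cball in auto)
      show "((\<lambda>s. (1 + e) * t * dist (f (of_real s * x)) (f (of_real s * b))) \<longlongrightarrow> (1 + e) * t * dist (F x) (F b)) (at_left 1)"
        by (intro tendsto_mult tendsto_const tendsto_dist radial_tendsto) (use in_cball in auto)
      have "\<forall>\<^sub>F s in at_left (1::real). s \<in> {0<..<1}" by (rule eventually_at_left_real) simp
      then show "\<forall>\<^sub>F s in at_left 1. dist (f (of_real s * x)) (f (of_real s * a)) \<le> (1 + e) * t * dist (f (of_real s * x)) (f (of_real s * b))"
      proof eventually_elim
        case (elim s)
        have inb: "of_real s * u \<in> ball 0 1" if "u \<in> cball 0 1" for u :: complex
        proof -
          have "s * norm u \<le> s * 1" using that elim by (intro mult_left_mono) auto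
          also have "\<dots> < 1" using elim by simp
          finally have "s * norm u < 1" .
          then show ?thesis using elim by (simp add: norm_mult)
        qed
        have ds: "dist (of_real s * u) (of_real s * v) = s * dist u v" for u v :: complex
        proof -
          have "of_real s * u - of_real s * v = of_real s * (u - v)" by (simp add: algebra_simps)
          then show ?thesis using elim by (simp add: dist_norm norm_mult)
        qed
        have cl: "of_real s * u \<in> ball (of_real s * c) \<delta>" if "u \<in> ball c \<delta>" for u
        proof -
          have "s * dist c u \<le> 1 * dist c u" using elim by (intro mult_right_mono) auto
          then show ?thesis using that by (simp add: ds)
        qed
        have "dist (f (of_real s * x)) (f (of_real s * a)) / dist (f (of_real s * x)) (f (of_real s * b)) \<le> (1 + e) * t"
          by (rule as[of _ _ _ "of_real s * c"]) (use inb in_cball cl close ne elim ratio in \<open>auto simp: ds\<close>)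
        moreover have "f (of_real s * x) \<noteq> f (of_real s * b)"
          using inj_onD[OF inj, of "of_real s * x" "of_real s * b"] inb[of x] inb[of b] in_cball ne elim by auto
        ultimately show ?case by (simp add: divide_le_eq)
      qed
    qed
  qed
qed

text \<open>A limit in \<open>G\<close> would be hit by an interior point, and the continuity of the inverse map would
  identify it with the boundary point.\<close>
lemma sphere_to_J:
  assumes z: "norm z = 1"
  shows "F z \<in> J"
proof -
  have "F z \<in> closure G"
  proof -
    have "F ` closure (ball 0 1) \<subseteq> closure G"
      by (rule image_closure_subset) (use cont_F F_eq in_G closure_subset[of G] in auto)
    then show ?thesis using z by auto
  qed
  moreover have "F z \<notin> G"
  proof
    assume Fz: "F z \<in> G"
    obtain h where h: "continuous_on G h" "\<And>z. norm z < 1 \<Longrightarrow> h (f z) = z" "\<And>w. w \<in> G \<Longrightarrow> norm (h w) < 1"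
      using inverse_continuous by metis
    have ev: "\<forall>\<^sub>F s in at_left (1::real). s \<in> {0<..<1}" by (rule eventually_at_left_real) simp
    have nn: "norm (of_real s * z) < 1" if "s \<in> {0<..<1}" for s using that z by (simp add: norm_mult)
    have "((\<lambda>s. h (f (of_real s * z))) \<longlongrightarrow> h (F z)) (at_left 1)"
      by (rule continuous_on_tendsto_compose[OF h(1) radial_tendsto Fz])
         (use z ev in \<open>auto elim!: eventually_mono intro!: in_G nn\<close>)
    then have "((\<lambda>s. of_real s * z) \<longlongrightarrow> h (F z)) (at_left (1::real))"
      by (rule Lim_transform_eventually) (use ev in \<open>auto elim!: eventually_mono intro!: h(2) nn\<close>)
    moreover have "((\<lambda>s. of_real s * z) \<longlongrightarrow> of_real 1 * z) (at_left (1::real))" by (intro tendsto_intros)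
    ultimately have "h (F z) = z"
      using tendsto_unique[OF trivial_limit_at_left_real] by fastforce
    then show False using h(3)[OF Fz] z by simp
  qed
  ultimately show ?thesis using open_G by (simp add: frontier_def interior_open)
qed

text \<open>Suppose \<open>F a = F b = p\<close>. The image \<open>C\<close> of the chord is a Jordan curve in \<open>G\<close> apart from the point
  \<open>p\<close>, so the connected set \<open>J - {p}\<close> lies in one component of the complement of \<open>C\<close>. The images of the
  two half discs cut off by the chord lie one in each component. The half disc whose image is in the
  component without boundary points must send its circular arc to \<open>p\<close>. Two points of this arc together
  with a nearby point of the disc contradict asymptotic symmetry.\<close>
lemma injective_on_sphere:
  assumes jc: "jordan_curve J" and AS: "asymptotically_symmetric_on (ball 0 1) f"
    and ab: "norm a = 1" "norm b = 1" "F a = F b"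
  shows "a = b"
proof (rule ccontr)
  assume ne: "a \<noteq> b"
  define p where "p = F a"
  have pJ: "p \<in> J" using sphere_to_J ab by (simp add: p_def)
  have dpos: "0 < (norm (b - a))\<^sup>2" using ne by simp
  have seg: "norm (a + of_real s * (b - a)) < 1 \<longleftrightarrow> 0 < s \<and> s < 1" for s
  proof -
    have "norm (a + of_real s * (b - a)) < 1 \<longleftrightarrow> (norm (a + of_real s * (b - a)))\<^sup>2 < 1" by (simp add: abs_square_less_1)
    also have "\<dots> \<longleftrightarrow> 0 < s * (1 - s)" unfolding chord_norm[OF ab(1,2)] using dpos by (simp add: zero_less_mult_iff)
    also have "\<dots> \<longleftrightarrow> 0 < s \<and> s < 1" by (auto simp: zero_less_mult_iff)
    finally show ?thesis .
  qed
  define side where "side = (\<lambda>z. Im ((z - a) * cnj (b - a)))"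
  have on_line: "\<exists>s. z = a + of_real s * (b - a)" if "side z = 0" for z
  proof
    have "(z - a) * cnj (b - a) = of_real (Re ((z - a) * cnj (b - a)))" using that by (simp add: side_def complex_eq_iff)
    moreover have "cnj (b - a) * (b - a) = of_real ((norm (b - a))\<^sup>2)" by (metis complex_norm_square mult.commute)
    ultimately have "(z - a) * of_real ((norm (b - a))\<^sup>2) = of_real (Re ((z - a) * cnj (b - a))) * (b - a)" by (metis mult.assoc)
    then show "z = a + of_real (Re ((z - a) * cnj (b - a)) / (norm (b - a))\<^sup>2) * (b - a)"
      using dpos by (simp add: field_simps)
  qed
  have off_line: "side (a + of_real s * (b - a)) = 0" for s
  proof -
    have "(b - a) * cnj (b - a) = of_real ((norm (b - a))\<^sup>2)" by (rule complex_norm_square[symmetric])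
    then have "(a + of_real s * (b - a) - a) * cnj (b - a) = of_real (s * (norm (b - a))\<^sup>2)" by simp
    then show ?thesis unfolding side_def by (simp only: Im_complex_of_real)
  qed
  define \<gamma> where "\<gamma> = (\<lambda>s. F (a + of_real s * (b - a)))"
  define C where "C = path_image \<gamma>"
  have in_cball: "a + of_real s * (b - a) \<in> cball 0 1" if "s \<in> {0..1}" for s
  proof (cases "s = 0 \<or> s = 1")
    case True then show ?thesis using ab by auto
  next
    case False then show ?thesis using seg[of s] that by auto
  qed
  have \<gamma>01: "\<gamma> 0 = p" "\<gamma> 1 = p" using ab by (auto simp: \<gamma>_def p_def)
  have \<gamma>f: "\<gamma> s = f (a + of_real s * (b - a))" "\<gamma> s \<in> G" if "0 < s" "s < 1" for s
    using seg[of s] that F_eq in_G by (auto simp: \<gamma>_def)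
  have pG: "p \<notin> G" using pJ J_disjoint by auto
  have "path \<gamma>" unfolding path_def \<gamma>_def
    by (rule continuous_on_compose2[OF cont_F]) (use in_cball in \<open>auto intro!: continuous_intros\<close>)
  moreover have "loop_free \<gamma>"
    unfolding loop_free_def
  proof (intro ballI impI)
    fix s t :: real assume st: "s \<in> {0..1}" "t \<in> {0..1}" "\<gamma> s = \<gamma> t"
    have int: "s = t" if "0 < s" "s < 1" "0 < t" "t < 1"
    proof -
      have "a + of_real s * (b - a) = a + of_real t * (b - a)"
        using inj_onD[OF inj, of "a + of_real s * (b - a)" "a + of_real t * (b - a)"] st(3) \<gamma>f(1) that seg by simp
      then show ?thesis using ne by simp
    qed
    have "s = 0 \<or> s = 1 \<or> (0 < s \<and> s < 1)" "t = 0 \<or> t = 1 \<or> (0 < t \<and> t < 1)" using st by auto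
    then show "s = t \<or> s = 0 \<and> t = 1 \<or> s = 1 \<and> t = 0"
      using int st(3) \<gamma>01 \<gamma>f(2) pG by metis
  qed
  ultimately have simple: "simple_path \<gamma>" by (simp add: simple_path_def)
  have loop: "pathfinish \<gamma> = pathstart \<gamma>" using \<gamma>01 by (simp add: pathfinish_def pathstart_def)
  note JC = Jordan_inside_outside[OF simple loop, folded C_def]
  have C_eq: "C = insert p (\<gamma> ` {0<..<1})"
  proof -
    have "{0..1::real} = {0, 1} \<union> {0<..<1}" by auto
    then show ?thesis unfolding C_def path_image_def using \<gamma>01 by auto
  qed
  have CJ: "C \<inter> J = {p}" using C_eq \<gamma>f(2) J_disjoint pJ by auto
  have Jp: "connected (J - {p})" by (rule jordan_curve_minus_point_connected[OF jc pJ])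
  define half where "half = (\<lambda>\<sigma>::real. {z. norm z < 1 \<and> 0 < \<sigma> * side z})"
  have half_conn: "connected (f ` half \<sigma>)" for \<sigma>
  proof (rule connected_continuous_image)
    have "half \<sigma> = ball 0 1 \<inter> {z. 0 < \<sigma> * side z}" by (auto simp: half_def)
    moreover have "{z. 0 < \<sigma> * side z} = {z. inner (of_real \<sigma> * \<i> * (b - a)) a < inner (of_real \<sigma> * \<i> * (b - a)) z}"
      by (auto simp: side_def inner_complex_def algebra_simps)
    ultimately have "convex (half \<sigma>)" using convex_halfspace_gt by (metis convex_Int convex_ball)
    then show "connected (half \<sigma>)" by (rule convex_connected)
    show "continuous_on (half \<sigma>) f"
      by (rule continuous_on_subset[OF holomorphic_on_imp_continuous_on[OF hol]]) (auto simp: half_def)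
  qed
  have half_C: "f ` half \<sigma> \<inter> C = {}" for \<sigma>
  proof (rule ccontr)
    assume "f ` half \<sigma> \<inter> C \<noteq> {}"
    then obtain z where z: "z \<in> half \<sigma>" "f z \<in> C" by blast
    have zb: "norm z < 1" using z by (simp add: half_def)
    then have "f z \<noteq> p" using in_G pG by auto
    then obtain s where s: "0 < s" "s < 1" "f z = \<gamma> s" using z C_eq by auto
    then have "z = a + of_real s * (b - a)"
      using inj_onD[OF inj, of z "a + of_real s * (b - a)"] \<gamma>f(1)[of s] zb seg[of s] by simp
    then have "side z = 0" using off_line by simp
    then show False using z by (simp add: half_def)
  qed
  have meets: "\<exists>\<sigma>\<in>{1, -1}. f ` half \<sigma> \<subseteq> \<Omega>" if \<Omega>: "\<Omega> = inside C \<or> \<Omega> = outside C" for \<Omega>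
  proof -
    have fr: "frontier \<Omega> = C" "open \<Omega>" "\<Omega> \<inter> C = {}" using \<Omega> JC inside_no_overlap[of C] outside_no_overlap[of C] by metis+
    have "\<gamma> (1/2) \<in> C" using C_eq by auto
    then have "\<gamma> (1/2) \<in> closure \<Omega>" using fr by (auto simp: frontier_def)
    moreover have "\<gamma> (1/2) \<in> G" using \<gamma>f(2) by simp
    ultimately have "G \<inter> \<Omega> \<noteq> {}" using open_G closure_iff_nhds_not_empty by blast
    then obtain z where z: "norm z < 1" "f z \<in> \<Omega>" using image by auto
    have "side z \<noteq> 0"
    proof
      assume "side z = 0"
      then obtain s where s: "z = a + of_real s * (b - a)" using on_line by blast
      then have "0 < s" "s < 1" using seg z(1) by auto
      then have "f z = \<gamma> s" using \<gamma>f(1)[of s] s by simp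
      moreover have "\<gamma> s \<in> \<gamma> ` {0<..<1}" using \<open>0 < s\<close> \<open>s < 1\<close> by (intro imageI) simp
      ultimately have "f z \<in> C" using C_eq by simp
      then show False using z fr by auto
    qed
    then have "z \<in> half 1 \<or> z \<in> half (- 1)" using z(1) by (auto simp: half_def)
    then obtain \<sigma> where \<sigma>: "\<sigma> \<in> {1, -1::real}" "z \<in> half \<sigma>" by blast
    have "f ` half \<sigma> \<subseteq> \<Omega>"
    proof (rule ccontr)
      assume "\<not> ?thesis"
      then have "f ` half \<sigma> \<inter> frontier \<Omega> \<noteq> {}"
        using connected_Int_frontier[OF half_conn[of \<sigma>], of \<Omega>] z \<sigma> by blast
      then show False using half_C fr by auto
    qed
    then show ?thesis using \<sigma> by blast
  qed
  obtain \<Omega> where \<Omega>: "\<Omega> = inside C \<or> \<Omega> = outside C" "\<Omega> \<inter> J = {}"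
  proof -
    have "J - {p} \<subseteq> inside C \<union> outside C" using JC CJ by blast
    moreover have "inside C \<inter> outside C = {}" "open (inside C)" "open (outside C)" using JC by auto
    ultimately have "inside C \<inter> (J - {p}) = {} \<or> outside C \<inter> (J - {p}) = {}"
      using Jp unfolding connected_def by blast
    moreover have "p \<in> C" using CJ by blast
    then have "p \<notin> inside C" "p \<notin> outside C" using inside_no_overlap[of C] outside_no_overlap[of C] by blast+
    ultimately have "inside C \<inter> J = {} \<or> outside C \<inter> J = {}" by blast
    then show thesis using that by blast
  qed
  obtain \<sigma> where \<sigma>: "\<sigma> \<in> {1, -1::real}" "f ` half \<sigma> \<subseteq> \<Omega>" using meets[OF \<Omega>(1)] by blast
  have frO: "frontier \<Omega> = C" using \<Omega> JC by auto
  have const: "F \<xi> = p" if \<xi>: "norm \<xi> = 1" "0 < \<sigma> * side \<xi>" for \<xi>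
  proof -
    have "((\<lambda>s. \<sigma> * side (of_real s * \<xi>)) \<longlongrightarrow> \<sigma> * side (of_real 1 * \<xi>)) (at_left (1::real))"
      unfolding side_def by (intro tendsto_intros)
    then have "\<forall>\<^sub>F s in at_left (1::real). 0 < \<sigma> * side (of_real s * \<xi>)" using \<xi> order_tendstoD(1) by force
    moreover have "\<forall>\<^sub>F s in at_left (1::real). s \<in> {0<..<1}" by (rule eventually_at_left_real) simp
    ultimately have "\<forall>\<^sub>F s in at_left (1::real). f (of_real s * \<xi>) \<in> closure \<Omega>"
    proof eventually_elim
      case (elim s)
      then have "of_real s * \<xi> \<in> half \<sigma>" using \<xi> by (simp add: half_def norm_mult)
      then show ?case using \<sigma> closure_subset by blast
    qed
    then have "F \<xi> \<in> closure \<Omega>"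
      by (intro Lim_in_closed_set[OF closed_closure _ trivial_limit_at_left_real radial_tendsto]) (use \<xi> in auto)
    moreover have "F \<xi> \<in> J" using sphere_to_J \<xi> by simp
    ultimately have "F \<xi> \<in> C" using \<Omega>(2) closure_Un_frontier[of \<Omega>] unfolding frO by blast
    then show ?thesis using \<open>F \<xi> \<in> J\<close> CJ by blast
  qed
  \<comment> \<open>The radius perpendicular to the chord ends in the open arc cut off on the side given by \<open>\<sigma>\<close>.\<close>
  define \<xi> where "\<xi> = of_real \<sigma> * \<i> * sgn (b - a)"
  have \<xi>1: "norm \<xi> = 1" using \<sigma> ne by (auto simp: \<xi>_def norm_mult norm_sgn)
  have \<xi>pos: "0 < \<sigma> * side \<xi>"
  proof -
    define n where "n = norm (b - a)"
    have n: "0 < n" using ne by (simp add: n_def)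
    have "\<xi> * cnj (b - a) = \<i> * of_real (\<sigma> * n)"
    proof -
      have "sgn (b - a) * cnj (b - a) = of_real n"
      proof -
        have "(b - a) * cnj (b - a) = of_real n * of_real n" using complex_norm_square[of "b - a"] by (simp add: n_def power2_eq_square)
        then show ?thesis using n by (simp add: sgn_div_norm n_def scaleR_conv_of_real divide_inverse mult.assoc)
      qed
      then show ?thesis by (simp add: \<xi>_def mult.assoc)
    qed
    moreover have "side \<xi> = Im (\<xi> * cnj (b - a)) - Im (a * cnj (b - a))"
      unfolding side_def left_diff_distrib by (rule minus_complex.sel)
    moreover have "Im (\<i> * of_real (\<sigma> * n)) = \<sigma> * n" by (simp only: Im_i_times Re_complex_of_real)
    ultimately have "side \<xi> = \<sigma> * n - Im (a * cnj (b - a))" by simp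
    then have 1: "\<sigma> * side \<xi> = n - \<sigma> * Im (a * cnj (b - a))" using \<sigma>(1) by (auto simp: algebra_simps)
    have "(norm (a * cnj (b - a)))\<^sup>2 = n\<^sup>2" by (simp only: norm_mult complex_mod_cnj ab(1) n_def mult_1)
    then have 2: "(Re (a * cnj (b - a)))\<^sup>2 + (Im (a * cnj (b - a)))\<^sup>2 = n\<^sup>2" by (simp only: cmod_power2)
    have "Re (a * cnj (b - a)) = - n\<^sup>2 / 2"
    proof -
      have "(norm (a + of_real 1 * (b - a)))\<^sup>2 = (norm a)\<^sup>2 + 2 * Re (a * cnj (b - a)) + n\<^sup>2"
        unfolding n_def cmod_power2 by (simp add: power2_eq_square algebra_simps)
      then show ?thesis using ab by simp
    qed
    then have "0 < (Re (a * cnj (b - a)))\<^sup>2" using n by simp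
    then have "(Im (a * cnj (b - a)))\<^sup>2 < n\<^sup>2" using 2 by linarith
    then have "\<bar>Im (a * cnj (b - a))\<bar>\<^sup>2 < n\<^sup>2" by (simp only: power2_abs)
    then have "\<bar>Im (a * cnj (b - a))\<bar> < n" using n by (intro power2_less_imp_less[of _ n]) auto
    then show ?thesis using 1 \<sigma>(1) by auto
  qed
  obtain \<delta> where \<delta>: "0 < \<delta>" and as: "\<And>x a b c. {x, a, b, c} \<subseteq> cball 0 1 \<Longrightarrow> x \<noteq> a \<Longrightarrow> x \<noteq> b \<Longrightarrow> a \<noteq> b \<Longrightarrow>
      {x, a, b} \<subseteq> ball c \<delta> \<Longrightarrow> dist x a / dist x b \<le> 1 \<Longrightarrow> dist (F x) (F a) \<le> (1 + 1) * 1 * dist (F x) (F b)"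
    by (rule extension_asymptotically_symmetric[OF AS zero_less_one zero_less_one]; (assumption | (rule that; assumption)))
  obtain \<eta> where \<eta>: "norm \<eta> = 1" "\<eta> \<noteq> \<xi>" "dist \<xi> \<eta> < \<delta>" "0 < \<sigma> * side \<eta>"
  proof -
    have "((\<lambda>\<theta>. \<sigma> * side (\<xi> * cis \<theta>)) \<longlongrightarrow> \<sigma> * side (\<xi> * cis 0)) (at_right 0)"
      unfolding side_def by (intro tendsto_intros)
    then have "\<forall>\<^sub>F \<theta> in at_right 0. 0 < \<sigma> * side (\<xi> * cis \<theta>)" using \<xi>pos order_tendstoD(1) by force
    moreover have "((\<lambda>\<theta>. dist \<xi> (\<xi> * cis \<theta>)) \<longlongrightarrow> dist \<xi> (\<xi> * cis 0)) (at_right 0)" by (intro tendsto_intros)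
    then have "\<forall>\<^sub>F \<theta> in at_right 0. dist \<xi> (\<xi> * cis \<theta>) < \<delta>" using \<delta> order_tendstoD(2) by force
    moreover have "\<forall>\<^sub>F \<theta> in at_right (0::real). \<theta> \<in> {0<..<1}" by (rule eventually_at_right_real) simp
    ultimately have "\<forall>\<^sub>F \<theta> in at_right (0::real). \<exists>\<eta>. norm \<eta> = 1 \<and> \<eta> \<noteq> \<xi> \<and> dist \<xi> \<eta> < \<delta> \<and> 0 < \<sigma> * side \<eta>"
    proof eventually_elim
      case (elim \<theta>)
      have "0 < sin \<theta>" using elim pi_gt3 by (intro sin_gt_zero) auto
      then have "cis \<theta> \<noteq> 1" by (auto simp: complex_eq_iff)
      then have "\<xi> * cis \<theta> \<noteq> \<xi>" using \<xi>1 by auto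
      then show ?case using elim \<xi>1 by (intro exI[of _ "\<xi> * cis \<theta>"]) (simp add: norm_mult)
    qed
    then have "\<exists>\<eta>. norm \<eta> = 1 \<and> \<eta> \<noteq> \<xi> \<and> dist \<xi> \<eta> < \<delta> \<and> 0 < \<sigma> * side \<eta>"
      using eventually_happens[of _ "at_right (0::real)"] by (auto simp: trivial_limit_at_right_real)
    then show thesis using that by blast
  qed
  define m where "m = min (1/2) (dist \<xi> \<eta>)"
  have m: "0 < m" "m \<le> 1/2" "m \<le> dist \<xi> \<eta>" using \<eta> by (auto simp: m_def)
  \<comment> \<open>An interior point at least as close to \<open>\<xi>\<close> as \<open>\<eta>\<close> is: asymptotic symmetry would move its image to \<open>p\<close>.\<close>
  define q where "q = (1 - of_real m) * \<xi>"
  have q1: "norm q < 1"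
  proof -
    have "norm q = \<bar>1 - m\<bar>" using \<xi>1 by (simp add: q_def norm_mult) (metis norm_of_real of_real_1 of_real_diff)
    then show ?thesis using m by simp
  qed
  have dq: "dist \<xi> q = m"
  proof -
    have "\<xi> - q = of_real m * \<xi>" by (simp add: q_def algebra_simps)
    then show ?thesis using m \<xi>1 by (simp add: dist_norm norm_mult)
  qed
  have "dist (F \<xi>) (F q) \<le> (1 + 1) * 1 * dist (F \<xi>) (F \<eta>)"
  proof (rule as[of _ _ _ \<xi>])
    show "{\<xi>, q, \<eta>, \<xi>} \<subseteq> cball 0 1" using \<xi>1 q1 \<eta> by auto
    show "\<xi> \<noteq> q" "\<xi> \<noteq> \<eta>" "q \<noteq> \<eta>" using dq m \<eta> q1 by auto
    show "{\<xi>, q, \<eta>} \<subseteq> ball \<xi> \<delta>" using dq m \<eta> \<delta> by auto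
    show "dist \<xi> q / dist \<xi> \<eta> \<le> 1" using dq m \<eta> by (simp add: divide_le_eq)
  qed
  then have "F q = p" using const[OF \<xi>1 \<xi>pos] const[OF \<eta>(1,4)] by simp
  then have "f q = p" using F_eq q1 by simp
  then show False using in_G[OF q1] pG by simp
qed

end

context conformal_map_disc
begin

proposition asymptotically_symmetric_extension:
  assumes jc: "jordan_curve J" and AS: "asymptotically_symmetric_on (ball 0 1) f"
  shows "\<exists>F. homeomorphic_extension f G F \<and> asymptotically_symmetric_on (sphere 0 1) F"
proof -
  obtain F where F: "uniformly_continuous_on (closure (ball 0 1)) F" "\<And>z. z \<in> ball 0 1 \<Longrightarrow> f z = F z"
    using uniformly_continuous_on_extension_on_closure[OF asymptotically_symmetric_imp_uniformly_continuous[OF AS]] by metis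
  interpret boundary_extension f G F
  proof
    show "continuous_on (cball 0 1) F" using uniformly_continuous_imp_continuous[OF F(1)] by simp
  qed (use F in auto)
  have injF: "inj_on F (cball 0 1)"
  proof (rule inj_onI)
    fix x y assume xy: "x \<in> cball 0 1" "y \<in> cball 0 1" "F x = F y"
    consider "norm x < 1" "norm y < 1" | "norm x < 1" "norm y = 1" | "norm x = 1" "norm y < 1" | "norm x = 1" "norm y = 1"
      using xy by fastforce
    then show "x = y"
    proof cases
      case 1 then show ?thesis using xy F_eq inj_onD[OF inj] by simp
    next
      case 2 then show ?thesis using xy F_eq[of x] in_G[of x] sphere_to_J[of y] J_disjoint by auto
    next
      case 3 then show ?thesis using xy F_eq[of y] in_G[of y] sphere_to_J[of x] J_disjoint by auto
    next
      case 4 then show ?thesis using injective_on_sphere[OF jc AS] xy by blast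
    qed
  qed
  have FG: "F ` ball 0 1 = G" using image F_eq by auto
  have "F ` cball 0 1 = closure G"
  proof
    have "F ` closure (ball 0 1) \<subseteq> closure G"
      by (rule image_closure_subset) (use cont_F FG closure_subset[of G] in auto)
    then show "F ` cball 0 1 \<subseteq> closure G" by simp
    have "closed (F ` cball 0 1)" by (intro compact_imp_closed compact_continuous_image cont_F) auto
    moreover have "G \<subseteq> F ` cball 0 1" using FG by auto
    ultimately show "closure G \<subseteq> F ` cball 0 1" by (simp add: closure_minimal)
  qed
  then obtain g where g: "homeomorphism (cball 0 1) (closure G) F g"
    using homeomorphism_compact[OF compact_cball cont_F _ injF] by blast
  have "homeomorphic_extension f G F" unfolding homeomorphic_extension_def using g F_eq by auto
  moreover have "asymptotically_symmetric_on (sphere 0 1) F"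
    unfolding asymptotically_symmetric_on_def
  proof (intro conjI allI impI)
    have "homeomorphism (sphere 0 1) (F ` sphere 0 1) F g"
      by (rule homeomorphism_of_subsets[OF g]) (use g in \<open>auto simp: homeomorphism_def\<close>)
    then show "\<exists>g. homeomorphism (sphere 0 1) (F ` sphere 0 1) F g" by blast
    fix e t :: real assume e: "0 < e" and t: "0 < t"
    obtain \<delta> where \<delta>: "0 < \<delta>" and as: "\<And>x a b c. {x, a, b, c} \<subseteq> cball 0 1 \<Longrightarrow> x \<noteq> a \<Longrightarrow> x \<noteq> b \<Longrightarrow> a \<noteq> b \<Longrightarrow>
      {x, a, b} \<subseteq> ball c \<delta> \<Longrightarrow> dist x a / dist x b \<le> t \<Longrightarrow> dist (F x) (F a) \<le> (1 + e) * t * dist (F x) (F b)"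
      by (rule extension_asymptotically_symmetric[OF AS e t]; (assumption | (rule that; assumption)))
    show "\<exists>\<delta>>0. \<forall>x\<in>sphere 0 1. \<forall>a\<in>sphere 0 1. \<forall>b\<in>sphere 0 1.
        x \<noteq> a \<and> x \<noteq> b \<and> a \<noteq> b \<and> (\<exists>c\<in>sphere 0 1. {x, a, b} \<subseteq> ball c \<delta>) \<longrightarrow>
        dist x a / dist x b \<le> t \<longrightarrow> dist (F x) (F a) / dist (F x) (F b) \<le> (1 + e) * t"
    proof (intro exI[of _ \<delta>] conjI \<delta> ballI impI)
      fix x a b :: complex
      assume S: "x \<in> sphere 0 1" "a \<in> sphere 0 1" "b \<in> sphere 0 1"
        and d: "x \<noteq> a \<and> x \<noteq> b \<and> a \<noteq> b \<and> (\<exists>c\<in>sphere 0 1. {x, a, b} \<subseteq> ball c \<delta>)" and r: "dist x a / dist x b \<le> t"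
      obtain c where c: "c \<in> sphere 0 1" "{x, a, b} \<subseteq> ball c \<delta>" using d by blast
      have "dist (F x) (F a) \<le> (1 + e) * t * dist (F x) (F b)"
        by (rule as[of _ _ _ c]) (use S d c r in auto)
      moreover have "F x \<noteq> F b" using inj_onD[OF injF, of x b] S d by auto
      ultimately show "dist (F x) (F a) / dist (F x) (F b) \<le> (1 + e) * t" by (simp add: divide_le_eq)
    qed
  qed
  ultimately show ?thesis by blast
qed

end

section \<open>From boundary values to the boundary curve\<close>

lemma dist_cis: "dist (cis x) (cis y) = 2 * \<bar>sin ((x - y) / 2)\<bar>"
proof -
  have "(dist (cis x) (cis y))\<^sup>2 = (cos x - cos y)\<^sup>2 + (sin x - sin y)\<^sup>2"
    by (simp add: dist_norm cmod_power2)
  also have "\<dots> = 2 - 2 * cos (x - y)"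
    unfolding cos_diff using sin_cos_squared_add[of x] sin_cos_squared_add[of y]
    by (simp add: power2_eq_square algebra_simps)
  also have "cos (x - y) = 1 - 2 * (sin ((x - y) / 2))\<^sup>2"
  proof -
    have "cos (x - y) = cos (2 * ((x - y) / 2))" by (rule arg_cong[of _ _ cos]) simp
    then show ?thesis unfolding cos_double_sin .
  qed
  finally have "(dist (cis x) (cis y))\<^sup>2 = (2 * \<bar>sin ((x - y) / 2)\<bar>)\<^sup>2"
    by (simp add: power_mult_distrib)
  then show ?thesis by (rule power2_eq_imp_eq) simp_all
qed

lemma abs_sin_mono:
  assumes "\<bar>x\<bar> \<le> \<bar>y\<bar>" "\<bar>y\<bar> \<le> pi / 2"
  shows "\<bar>sin x\<bar> \<le> \<bar>sin y\<bar>"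
proof -
  have e: "\<bar>sin z\<bar> = sin \<bar>z\<bar>" if "\<bar>z\<bar> \<le> pi / 2" for z
  proof -
    have "0 \<le> sin \<bar>z\<bar>" using that by (intro sin_ge_zero) auto
    then show ?thesis by (auto simp: abs_if split: if_splits)
  qed
  have "sin \<bar>x\<bar> \<le> sin \<bar>y\<bar>" by (rule sin_monotone_2pi_le) (use assms in auto)
  then show ?thesis using e[of x] e[of y] assms by simp
qed

text \<open>In angular coordinates this is \<open>sin x / x \<longlonglongrightarrow> 1\<close> as \<open>x \<longlonglongrightarrow> 0\<close>.\<close>
lemma short_circle_arc:
  assumes e: "0 < \<epsilon>"
  obtains d where "0 < d" "\<And>\<alpha> \<beta>. norm \<alpha> = 1 \<Longrightarrow> norm \<beta> = 1 \<Longrightarrow> \<alpha> \<noteq> \<beta> \<Longrightarrow> dist \<alpha> \<beta> < d \<Longrightarrow>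
     \<exists>\<gamma>. arc \<gamma> \<and> pathstart \<gamma> = \<alpha> \<and> pathfinish \<gamma> = \<beta> \<and> path_image \<gamma> \<subseteq> sphere (0::complex) 1 \<and>
       (\<forall>\<omega>\<in>path_image \<gamma>. dist \<alpha> \<omega> \<le> dist \<alpha> \<beta> \<and> dist \<omega> \<beta> \<le> dist \<alpha> \<beta> \<and>
           dist \<alpha> \<omega> + dist \<omega> \<beta> \<le> (1 + \<epsilon>) * dist \<alpha> \<beta>)"
proof -
  have "((\<lambda>x::real. sin x / x) \<longlongrightarrow> 1) (at_right 0)"
    using DERIV_sin[of "0::real"] unfolding DERIV_def filterlim_at_split by simp
  then have "\<forall>\<^sub>F x in at_right (0::real). 1 / (1 + \<epsilon>) < sin x / x"
    by (rule order_tendstoD(1)) (use e in simp)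
  then obtain b where b: "0 < b" "\<And>x. 0 < x \<Longrightarrow> x < b \<Longrightarrow> 1 / (1 + \<epsilon>) < sin x / x"
    unfolding eventually_at_right_field by auto
  define \<theta> where "\<theta> = min b (pi / 2)"
  have \<theta>: "0 < \<theta>" "\<theta> \<le> pi / 2" "\<theta> \<le> b" using b pi_gt_zero by (auto simp: \<theta>_def)
  have sx: "x \<le> (1 + \<epsilon>) * sin x" if "0 < x" "x < \<theta>" for x
    using b(2)[of x] that \<theta> e by (simp add: field_simps)
  show ?thesis
  proof (rule that[of "2 * sin \<theta>"])
    show "0 < 2 * sin \<theta>" using sin_gt_zero[of \<theta>] \<theta> pi_gt_zero by simp
    fix \<alpha> \<beta> :: complex
    assume n: "norm \<alpha> = 1" "norm \<beta> = 1" "\<alpha> \<noteq> \<beta>" and d: "dist \<alpha> \<beta> < 2 * sin \<theta>"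
    define \<phi> where "\<phi> = Arg (\<beta> / \<alpha>)"
    have q: "norm (\<beta> / \<alpha>) = 1" using n by (simp add: norm_divide)
    then have "\<beta> / \<alpha> = cis \<phi>" unfolding \<phi>_def using cis_Arg[of "\<beta> / \<alpha>"] by (cases "\<beta> / \<alpha> = 0") (auto simp: sgn_div_norm)
    moreover have "\<alpha> \<noteq> 0" using n by auto
    ultimately have \<beta>: "\<beta> = \<alpha> * cis \<phi>" by (metis nonzero_mult_div_cancel_left times_divide_eq_right)
    have \<phi>: "\<bar>\<phi>\<bar> \<le> pi" using Arg_bounded[of "\<beta> / \<alpha>"] by (simp add: \<phi>_def abs_le_iff)
    have \<phi>0: "\<phi> \<noteq> 0" using \<beta> n by auto
    have D: "dist (\<alpha> * cis x) (\<alpha> * cis y) = 2 * \<bar>sin ((x - y) / 2)\<bar>" for x y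
    proof -
      have "dist (\<alpha> * cis x) (\<alpha> * cis y) = norm \<alpha> * dist (cis x) (cis y)"
        unfolding dist_norm by (simp add: norm_mult flip: right_diff_distrib)
      then show ?thesis using n dist_cis by simp
    qed
    have dab: "dist \<alpha> \<beta> = 2 * \<bar>sin (\<phi> / 2)\<bar>" using D[of 0 \<phi>] by (simp add: \<beta>)
    have small: "\<bar>\<phi>\<bar> / 2 < \<theta>"
    proof (rule ccontr)
      assume "\<not> ?thesis"
      then have "\<bar>sin \<theta>\<bar> \<le> \<bar>sin (\<phi> / 2)\<bar>" using \<theta> \<phi> by (intro abs_sin_mono) auto
      then show False using d dab by simp
    qed
    define \<gamma> where "\<gamma> = (\<lambda>s. \<alpha> * cis (s * \<phi>))"
    have "path \<gamma>" unfolding path_def \<gamma>_def by (intro continuous_intros)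
    moreover have "inj_on \<gamma> {0..1}"
    proof (rule inj_onI)
      fix s t :: real assume st: "s \<in> {0..1}" "t \<in> {0..1}" "\<gamma> s = \<gamma> t"
      define x where "x = \<bar>(s * \<phi> - t * \<phi>) / 2\<bar>"
      have "x = \<bar>s - t\<bar> * \<bar>\<phi>\<bar> / 2" unfolding x_def by (simp add: abs_mult flip: left_diff_distrib)
      moreover have "\<bar>s - t\<bar> * \<bar>\<phi>\<bar> \<le> 1 * pi" using st \<phi> by (intro mult_mono) auto
      moreover have "0 \<le> \<bar>s - t\<bar> * \<bar>\<phi>\<bar>" by (intro mult_nonneg_nonneg) auto
      ultimately have "0 \<le> x" "x < pi" and xe: "x = \<bar>s - t\<bar> * \<bar>\<phi>\<bar> / 2" using pi_gt_zero by linarith+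
      have "2 * \<bar>sin ((s * \<phi> - t * \<phi>) / 2)\<bar> = dist (\<gamma> s) (\<gamma> t)" by (simp only: \<gamma>_def D)
      then have "sin ((s * \<phi> - t * \<phi>) / 2) = 0" using st(3) by simp
      then have "sin x = 0" unfolding x_def by (simp add: abs_if)
      then have "x = 0" using sin_gt_zero[of x] \<open>0 \<le> x\<close> \<open>x < pi\<close> by force
      then show "s = t" using xe \<phi>0 by simp
    qed
    ultimately have "arc \<gamma>" by (simp add: arc_def)
    moreover have "pathstart \<gamma> = \<alpha>" "pathfinish \<gamma> = \<beta>" using \<beta> by (simp_all add: \<gamma>_def pathstart_def pathfinish_def)
    moreover have "path_image \<gamma> \<subseteq> sphere 0 1" using n by (auto simp: path_image_def \<gamma>_def norm_mult)
    moreover have "dist \<alpha> \<omega> \<le> dist \<alpha> \<beta> \<and> dist \<omega> \<beta> \<le> dist \<alpha> \<beta> \<and> dist \<alpha> \<omega> + dist \<omega> \<beta> \<le> (1 + \<epsilon>) * dist \<alpha> \<beta>"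
      if \<omega>: "\<omega> \<in> path_image \<gamma>" for \<omega>
    proof -
      obtain s where s: "0 \<le> s" "s \<le> 1" "\<omega> = \<alpha> * cis (s * \<phi>)" using \<omega> by (auto simp: path_image_def \<gamma>_def)
      have 1: "dist \<alpha> \<omega> = 2 * \<bar>sin (s * \<phi> / 2)\<bar>" using D[of 0 "s * \<phi>"] s by simp
      have 2: "dist \<omega> \<beta> = 2 * \<bar>sin ((1 - s) * \<phi> / 2)\<bar>" using D[of \<phi> "s * \<phi>"] s by (simp add: \<beta> dist_commute left_diff_distrib)
      have a: "\<bar>t * \<phi> / 2\<bar> \<le> \<bar>\<phi> / 2\<bar>" if "0 \<le> t" "t \<le> 1" for t
        using that by (simp add: abs_mult mult_left_le_one_le)
      have b: "\<bar>\<phi> / 2\<bar> \<le> pi / 2" using \<phi> by simp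
      have 3: "dist \<alpha> \<omega> \<le> dist \<alpha> \<beta>" unfolding 1 dab using abs_sin_mono[OF a[OF s(1,2)] b] by simp
      have 4: "dist \<omega> \<beta> \<le> dist \<alpha> \<beta>" unfolding 2 dab using abs_sin_mono[OF a[of "1 - s"] b] s by simp
      have le: "\<bar>sin x\<bar> \<le> \<bar>x\<bar>" for x :: real by (rule abs_sin_x_le_abs_x)
      have "dist \<alpha> \<omega> + dist \<omega> \<beta> \<le> 2 * \<bar>s * \<phi> / 2\<bar> + 2 * \<bar>(1 - s) * \<phi> / 2\<bar>"
        unfolding 1 2 using le[of "s * \<phi> / 2"] le[of "(1 - s) * \<phi> / 2"] by linarith
      also have "\<dots> = \<bar>\<phi>\<bar>"
      proof -
        have halves: "\<bar>s * \<phi> / 2\<bar> = s * (\<bar>\<phi>\<bar> / 2)" "\<bar>(1 - s) * \<phi> / 2\<bar> = (1 - s) * (\<bar>\<phi>\<bar> / 2)"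
          using s by (simp_all add: abs_mult)
        have "2 * (s * (y / 2)) + 2 * ((1 - s) * (y / 2)) = y" for y :: real by (simp add: field_simps)
        then show ?thesis unfolding halves .
      qed
      also have "\<dots> \<le> 2 * ((1 + \<epsilon>) * sin (\<bar>\<phi>\<bar> / 2))" using sx[of "\<bar>\<phi>\<bar> / 2"] small \<phi>0 by simp
      also have "sin (\<bar>\<phi>\<bar> / 2) \<le> \<bar>sin (\<phi> / 2)\<bar>" by (auto simp: abs_if)
      finally have "dist \<alpha> \<omega> + dist \<omega> \<beta> \<le> (1 + \<epsilon>) * dist \<alpha> \<beta>" unfolding dab using e by simp
      then show ?thesis using 3 4 by blast
    qed
    ultimately show "\<exists>\<gamma>. arc \<gamma> \<and> pathstart \<gamma> = \<alpha> \<and> pathfinish \<gamma> = \<beta> \<and> path_image \<gamma> \<subseteq> sphere 0 1 \<and>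
       (\<forall>\<omega>\<in>path_image \<gamma>. dist \<alpha> \<omega> \<le> dist \<alpha> \<beta> \<and> dist \<omega> \<beta> \<le> dist \<alpha> \<beta> \<and>
           dist \<alpha> \<omega> + dist \<omega> \<beta> \<le> (1 + \<epsilon>) * dist \<alpha> \<beta>)" by blast
  qed
qed

text \<open>In the definition the scale \<open>\<delta>\<close> depends on the ratio \<open>t\<close>. Rounding up to the grid of multiples of
  \<open>1 / N\<close> costs an additive error but needs only finitely many ratios, hence gives one scale for all
  ratios up to \<open>1\<close>.\<close>
lemma asymptotically_symmetric_additive:
  fixes F :: "'a::metric_space \<Rightarrow> 'b::metric_space"
  assumes AS: "asymptotically_symmetric_on X F" and e: "0 < \<epsilon>"
  obtains \<delta> where "0 < \<delta>" "\<And>x a b. {x, a, b} \<subseteq> X \<Longrightarrow> x \<noteq> b \<Longrightarrow> dist x b < \<delta> \<Longrightarrow> dist x a \<le> dist x b \<Longrightarrow>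
      dist (F x) (F a) \<le> (1 + \<epsilon>) * (dist x a / dist x b + \<epsilon>) * dist (F x) (F b)"
proof -
  obtain N where N: "0 < N" "1 / real N < \<epsilon>" using e by (metis nat_approx_posE zero_less_Suc)
  have "\<exists>\<delta>>0. \<forall>x\<in>X. \<forall>a\<in>X. \<forall>b\<in>X. x \<noteq> a \<and> x \<noteq> b \<and> a \<noteq> b \<and> (\<exists>c\<in>X. {x, a, b} \<subseteq> ball c \<delta>) \<longrightarrow>
        dist x a / dist x b \<le> real (Suc i) / real N \<longrightarrow>
        dist (F x) (F a) / dist (F x) (F b) \<le> (1 + \<epsilon>) * (real (Suc i) / real N)" for i
  proof -
    have "0 < real (Suc i) / real N" using N by simp
    note AS[unfolded asymptotically_symmetric_on_def, THEN conjunct2, rule_format, OF e this]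
    then show ?thesis by blast
  qed
  then obtain \<delta>i where \<delta>i: "\<And>i. 0 < \<delta>i i" "\<And>i x a b. x \<in> X \<Longrightarrow> a \<in> X \<Longrightarrow> b \<in> X \<Longrightarrow>
        x \<noteq> a \<and> x \<noteq> b \<and> a \<noteq> b \<and> (\<exists>c\<in>X. {x, a, b} \<subseteq> ball c (\<delta>i i)) \<Longrightarrow>
        dist x a / dist x b \<le> real (Suc i) / real N \<Longrightarrow>
        dist (F x) (F a) / dist (F x) (F b) \<le> (1 + \<epsilon>) * (real (Suc i) / real N)"
    by metis
  obtain g where g: "homeomorphism X (F ` X) F g" using AS[unfolded asymptotically_symmetric_on_def, THEN conjunct1] by blast
  have injF: "x = y" if "x \<in> X" "y \<in> X" "F x = F y" for x y
    using g that unfolding homeomorphism_def by metis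
  define \<delta> where "\<delta> = Min (\<delta>i ` {..N})"
  have \<delta>: "0 < \<delta>" "\<And>i. i \<le> N \<Longrightarrow> \<delta> \<le> \<delta>i i" using \<delta>i(1) by (auto simp: \<delta>_def)
  show ?thesis
  proof (rule that[OF \<delta>(1)])
    fix x a b assume X: "{x, a, b} \<subseteq> X" and ne: "x \<noteq> b" and d: "dist x b < \<delta>" "dist x a \<le> dist x b"
    define s where "s = dist x a / dist x b"
    have s: "0 \<le> s" "s \<le> 1" using d ne by (auto simp: s_def divide_le_eq)
    show "dist (F x) (F a) \<le> (1 + \<epsilon>) * (dist x a / dist x b + \<epsilon>) * dist (F x) (F b)"
    proof (cases "a = x \<or> a = b")
      case True
      then show ?thesis
      proof
        assume "a = x" then show ?thesis using e by simp
      next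
        assume "a = b"
        have "1 * 1 \<le> (1 + \<epsilon>) * (1 + \<epsilon>)" using e by (intro mult_mono) auto
        then have "1 * dist (F x) (F b) \<le> (1 + \<epsilon>) * (1 + \<epsilon>) * dist (F x) (F b)" by (intro mult_right_mono) auto
        then show ?thesis using \<open>a = b\<close> ne by simp
      qed
    next
      case False
      define i where "i = nat \<lfloor>s * real N\<rfloor>"
      have i0: "real i \<le> s * real N" using s by (simp add: i_def)
      have i1: "s * real N < real (Suc i)" using s by (simp add: i_def) linarith
      have "s * real N \<le> 1 * real N" using s by (intro mult_right_mono) auto
      then have "i \<le> N" using i0 by linarith
      have "dist (F x) (F a) / dist (F x) (F b) \<le> (1 + \<epsilon>) * (real (Suc i) / real N)"
      proof (rule \<delta>i(2))
        have "{x, a, b} \<subseteq> ball x (\<delta>i i)" using d \<delta>(2)[OF \<open>i \<le> N\<close>] \<delta>i(1)[of i] by auto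
        then show "x \<noteq> a \<and> x \<noteq> b \<and> a \<noteq> b \<and> (\<exists>c\<in>X. {x, a, b} \<subseteq> ball c (\<delta>i i))" using False ne X by blast
        show "dist x a / dist x b \<le> real (Suc i) / real N"
          using i1 N(1) by (simp add: le_divide_eq less_imp_le flip: s_def)
      qed (use X in auto)
      also have "\<dots> \<le> (1 + \<epsilon>) * (s + \<epsilon>)"
      proof (rule mult_left_mono)
        have "real (Suc i) / real N = real i / real N + 1 / real N" by (simp add: add_divide_distrib)
        moreover have "real i / real N \<le> s" using i0 N(1) by (simp add: divide_le_eq)
        ultimately show "real (Suc i) / real N \<le> s + \<epsilon>" using N(2) by linarith
      qed (use e in simp)
      finally have "dist (F x) (F a) / dist (F x) (F b) \<le> (1 + \<epsilon>) * (s + \<epsilon>)" .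
      moreover have "0 < dist (F x) (F b)" using injF[of x b] X ne by auto
      ultimately show ?thesis by (simp only: pos_divide_le_eq s_def)
    qed
  qed
qed

context conformal_map_disc
begin

text \<open>For \<open>\<omega>\<close> on the short arc between \<open>\<alpha>\<close> and \<open>\<beta>\<close>, the ratios of \<open>|\<alpha> - \<omega>|\<close> and \<open>|\<omega> - \<beta>|\<close> to
  \<open>|\<alpha> - \<beta>|\<close> add up to nearly \<open>1\<close>, and so do the ratios of the image distances. The image of the short
  arc is the smaller subarc, for otherwise both subarcs and therefore all of \<open>J\<close> would be small.\<close>
proposition boundary_asymptotically_symmetric_imp_symmetric_quasicircle:
  assumes jc: "jordan_curve J" and ext: "homeomorphic_extension f G F"
    and AS: "asymptotically_symmetric_on (sphere 0 1) F"
  shows "symmetric_quasicircle J"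
  unfolding symmetric_quasicircle_iff
proof (intro conjI jc allI impI)
  fix \<epsilon> :: real assume \<epsilon>: "0 < \<epsilon>"
  obtain g where g: "homeomorphism (cball 0 1) (closure G) F g" and Ff: "\<And>z. z \<in> ball 0 1 \<Longrightarrow> F z = f z"
    using ext unfolding homeomorphic_extension_def by blast
  have gF: "g (F z) = z" if "z \<in> cball 0 1" for z using g that by (simp add: homeomorphism_def)
  have Fsphere: "F ` sphere 0 1 = J"
  proof -
    have "sphere 0 1 = cball 0 1 - ball (0::complex) 1" by auto
    then have "F ` sphere 0 1 = F ` cball 0 1 - F ` ball 0 1"
      using inj_on_image_set_diff[of F "cball 0 1" "cball 0 1" "ball 0 1"] inj_on_inverseI[of "cball 0 1" g F] gF by auto
    also have "F ` cball 0 1 = closure G" using g by (simp add: homeomorphism_def)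
    also have "F ` ball 0 1 = G" using image Ff by auto
    finally show ?thesis using open_G by (simp add: frontier_def interior_open)
  qed
  have contF: "continuous_on (sphere 0 1) F"
    using g by (auto simp: homeomorphism_def elim: continuous_on_subset)
  define e where "e = min 1 (\<epsilon> / 8)"
  have e: "0 < e" "e \<le> 1" "8 * e \<le> \<epsilon>" using \<epsilon> by (auto simp: e_def)
  obtain d1 where d1: "0 < d1" and arcs: "\<And>\<alpha> \<beta>. norm \<alpha> = 1 \<Longrightarrow> norm \<beta> = 1 \<Longrightarrow> \<alpha> \<noteq> \<beta> \<Longrightarrow> dist \<alpha> \<beta> < d1 \<Longrightarrow>
     \<exists>\<gamma>. arc \<gamma> \<and> pathstart \<gamma> = \<alpha> \<and> pathfinish \<gamma> = \<beta> \<and> path_image \<gamma> \<subseteq> sphere (0::complex) 1 \<and>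
       (\<forall>\<omega>\<in>path_image \<gamma>. dist \<alpha> \<omega> \<le> dist \<alpha> \<beta> \<and> dist \<omega> \<beta> \<le> dist \<alpha> \<beta> \<and>
           dist \<alpha> \<omega> + dist \<omega> \<beta> \<le> (1 + e) * dist \<alpha> \<beta>)"
    by (rule short_circle_arc[OF e(1)]; (assumption | (rule that; assumption)))
  obtain d2 where d2: "0 < d2" and add: "\<And>x a b. {x, a, b} \<subseteq> sphere 0 1 \<Longrightarrow> x \<noteq> b \<Longrightarrow> dist x b < d2 \<Longrightarrow> dist x a \<le> dist x b \<Longrightarrow>
      dist (F x) (F a) \<le> (1 + e) * (dist x a / dist x b + e) * dist (F x) (F b)"
    by (rule asymptotically_symmetric_additive[OF AS e(1)]; (assumption | (rule that; assumption)))
  have "compact (closure G)" using bounded_G by (simp add: compact_closure)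
  then have "uniformly_continuous_on (closure G) g"
    using g by (intro compact_uniformly_continuous) (auto simp: homeomorphism_def)
  then obtain d3 where d3: "0 < d3" "\<And>x y. x \<in> closure G \<Longrightarrow> y \<in> closure G \<Longrightarrow> dist x y < d3 \<Longrightarrow> dist (g x) (g y) < min d1 d2"
    unfolding uniformly_continuous_on_def using d1 d2 by (metis min_less_iff_conj)
  define m where "m = dist (F 1) (F (- 1))"
  have m: "0 < m"
  proof -
    have "F 1 \<noteq> F (- 1)" using gF[of 1] gF[of "- 1"] by auto
    then show ?thesis by (simp add: m_def)
  qed
  have m_in: "F 1 \<in> J" "F (- 1) \<in> J" using Fsphere by (metis image_eqI mem_sphere_0 norm_one norm_minus_cancel)+
  define \<delta> where "\<delta> = min d3 (m / (4 * (1 + \<epsilon>)))"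
  have "0 < \<delta>" using d3 m \<epsilon> by (simp add: \<delta>_def)
  moreover have "dist a w + dist w b \<le> (1 + \<epsilon>) * dist a b"
    if ab: "a \<in> J" "b \<in> J" "a \<noteq> b" "dist a b < \<delta>" and w: "w \<in> smaller_subarc J a b" for a b w
  proof -
    obtain \<alpha> \<beta> where \<alpha>\<beta>: "norm \<alpha> = 1" "F \<alpha> = a" "norm \<beta> = 1" "F \<beta> = b"
      using ab Fsphere by (metis imageE mem_sphere_0)
    have ne: "\<alpha> \<noteq> \<beta>" using ab \<alpha>\<beta> by auto
    have "dist (g a) (g b) < min d1 d2"
      using d3(2)[of a b] ab by (auto simp: \<delta>_def frontier_def)
    then have dd: "dist \<alpha> \<beta> < d1" "dist \<alpha> \<beta> < d2" using gF[of \<alpha>] gF[of \<beta>] \<alpha>\<beta> by auto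
    obtain \<gamma> where \<gamma>: "arc \<gamma>" "pathstart \<gamma> = \<alpha>" "pathfinish \<gamma> = \<beta>" "path_image \<gamma> \<subseteq> sphere 0 1"
      and \<gamma>d: "\<And>\<omega>. \<omega> \<in> path_image \<gamma> \<Longrightarrow> dist \<alpha> \<omega> \<le> dist \<alpha> \<beta> \<and> dist \<omega> \<beta> \<le> dist \<alpha> \<beta> \<and>
           dist \<alpha> \<omega> + dist \<omega> \<beta> \<le> (1 + e) * dist \<alpha> \<beta>"
      using arcs[OF \<alpha>\<beta>(1,3) ne dd(1)] by blast
    define A where "A = F ` path_image \<gamma>"
    have A_bound: "dist a v + dist v b \<le> (1 + \<epsilon>) * dist a b" if v: "v \<in> A" for v
    proof -
      obtain \<omega> where \<omega>: "\<omega> \<in> path_image \<gamma>" "v = F \<omega>" using v by (auto simp: A_def)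
      define D where "D = dist \<alpha> \<beta>"
      have D0: "0 < D" using ne by (simp add: D_def)
      have "dist a v \<le> (1 + e) * (dist \<alpha> \<omega> / D + e) * dist a b"
        using add[of \<alpha> \<omega> \<beta>] \<gamma>d[OF \<omega>(1)] \<omega> \<gamma>(4) \<alpha>\<beta> ne dd by (auto simp: D_def)
      moreover have "dist v b \<le> (1 + e) * (dist \<omega> \<beta> / D + e) * dist a b"
        using add[of \<beta> \<omega> \<alpha>] \<gamma>d[OF \<omega>(1)] \<omega> \<gamma>(4) \<alpha>\<beta> ne dd by (auto simp: D_def dist_commute)
      ultimately have "dist a v + dist v b \<le> (1 + e) * (dist \<alpha> \<omega> / D + e) * dist a b + (1 + e) * (dist \<omega> \<beta> / D + e) * dist a b"
        by linarith
      also have "\<dots> = (1 + e) * ((dist \<alpha> \<omega> + dist \<omega> \<beta>) / D + 2 * e) * dist a b"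
        by (simp add: algebra_simps add_divide_distrib)
      also have "\<dots> \<le> (1 + e) * ((1 + e) + 2 * e) * dist a b"
      proof -
        have "(dist \<alpha> \<omega> + dist \<omega> \<beta>) / D \<le> 1 + e" using \<gamma>d[OF \<omega>(1)] D0 by (simp add: divide_le_eq D_def)
        then show ?thesis using e by (intro mult_right_mono mult_left_mono) auto
      qed
      also have "\<dots> \<le> (1 + \<epsilon>) * dist a b"
      proof (rule mult_right_mono)
        have "e * e \<le> 1 * e" using e by (intro mult_right_mono) auto
        moreover have "(1 + e) * ((1 + e) + 2 * e) = 1 + 4 * e + 3 * (e * e)" by (simp add: algebra_simps)
        ultimately show "(1 + e) * ((1 + e) + 2 * e) \<le> 1 + \<epsilon>" using e by linarith
      qed simp
      finally show ?thesis .
    qed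
    have "A \<in> subarcs J a b"
    proof -
      have "arc (F \<circ> \<gamma>)"
      proof -
        have "continuous_on (path_image \<gamma>) F" using contF \<gamma>(4) continuous_on_subset by blast
        then have "path (F \<circ> \<gamma>)" using \<gamma>(1) arc_imp_path path_continuous_image by blast
        moreover have "inj_on (F \<circ> \<gamma>) {0..1}"
        proof (rule comp_inj_on)
          show "inj_on \<gamma> {0..1}" using \<gamma>(1) by (simp add: arc_def)
          show "inj_on F (\<gamma> ` {0..1})"
            by (rule inj_on_inverseI[of _ g]) (use gF \<gamma>(4) in \<open>auto simp: path_image_def subset_iff\<close>)
        qed
        ultimately show ?thesis by (simp add: arc_def)
      qed
      moreover have "path_image (F \<circ> \<gamma>) = A" by (simp add: A_def path_image_compose)
      moreover have "A \<subseteq> J" using \<gamma>(4) Fsphere by (auto simp: A_def)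
      moreover have "pathstart (F \<circ> \<gamma>) = a" "pathfinish (F \<circ> \<gamma>) = b" using \<gamma> \<alpha>\<beta> by (simp_all add: pathstart_compose pathfinish_compose)
      ultimately show ?thesis unfolding subarcs_def by blast
    qed
    have "smaller_subarc J a b = A"
    proof (rule ccontr)
      assume neq: "smaller_subarc J a b \<noteq> A"
      define B where "B = smaller_subarc J a b"
      have B: "B \<in> subarcs J a b" "diameter B \<le> diameter A"
        unfolding B_def using smaller_subarc[OF jc ab(1-3)] \<open>A \<in> subarcs J a b\<close> by auto
      obtain \<gamma>0 where \<gamma>0: "simple_path \<gamma>0" "pathfinish \<gamma>0 = pathstart \<gamma>0" "path_image \<gamma>0 = J"
        using jc unfolding jordan_curve_def by blast
      obtain u d where ud: "arc u" "arc d" "pathstart u = a" "pathfinish u = b"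
         "pathstart d = b" "pathfinish d = a"
         "(path_image u) \<inter> (path_image d) = {a,b}"
         "(path_image u) \<union> (path_image d) = path_image \<gamma>0"
        using exists_double_arc[OF \<gamma>0(1,2), of a b] ab \<gamma>0(3) by metis
      have "subarcs J a b = {path_image u, path_image d}"
        by (rule subarcs_of_double_arc) (use ud \<gamma>0 in auto)
      then have AB: "A \<union> B = J" using \<open>A \<in> subarcs J a b\<close> B(1) neq ud(8) \<gamma>0(3) by (auto simp: B_def)
      define K where "K = (1 + \<epsilon>) * dist a b"
      have Aa: "dist a v \<le> K" if "v \<in> A" for v using A_bound[OF that] zero_le_dist[of v b] unfolding K_def by linarith
      have "diameter A \<le> 2 * K"
      proof (rule diameter_le)
        show "A \<noteq> {} \<or> 0 \<le> 2 * K" using \<epsilon> by (simp add: K_def)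
        show "norm (x - y) \<le> 2 * K" if "x \<in> A" "y \<in> A" for x y
          using Aa[OF that(1)] Aa[OF that(2)] dist_triangle3[of x y a] by (simp add: dist_norm)
      qed
      moreover have "bounded B" and "a \<in> B"
      proof -
        obtain \<sigma> where \<sigma>: "arc \<sigma>" "path_image \<sigma> = B" "pathstart \<sigma> = a" using B(1) unfolding subarcs_def by auto
        then show "bounded B" using bounded_arc_image by metis
        show "a \<in> B" using \<sigma> pathstart_in_path_image by metis
      qed
      ultimately have Ba: "dist a v \<le> 2 * K" if "v \<in> B" for v
        using diameter_bounded_bound[of B a v] that B(2) by linarith
      have "0 \<le> K" using \<epsilon> by (simp add: K_def)
      then have Ja: "dist a v \<le> 2 * K" if "v \<in> J" for v using Aa[of v] Ba[of v] AB that by fastforce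
      have "m \<le> 4 * K" using Ja[OF m_in(1)] Ja[OF m_in(2)] dist_triangle3[of "F 1" "F (- 1)" a] by (simp add: m_def)
      moreover have "dist a b * (4 * (1 + \<epsilon>)) < m" using ab(4) \<epsilon> by (simp add: \<delta>_def less_divide_eq)
      ultimately show False by (simp add: K_def algebra_simps)
    qed
    then show ?thesis using A_bound w by simp
  qed
  ultimately show "\<exists>\<delta>>0. \<forall>a\<in>J. \<forall>b\<in>J. a \<noteq> b \<and> dist a b < \<delta> \<longrightarrow>
        (\<forall>w\<in>smaller_subarc J a b. dist a w + dist w b \<le> (1 + \<epsilon>) * dist a b)" by blast
qed

end

section \<open>The equivalence\<close>

theorem theorem1:
  fixes f :: "complex \<Rightarrow> complex" and G :: "complex set"
  assumes "bounded_jordan_domain G"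
    and "conformal_onto f (ball 0 1) G"
  shows "(symmetric_quasicircle (frontier G) \<longleftrightarrow> asymptotically_symmetric_on (ball 0 1) f) \<and>
    (asymptotically_symmetric_on (ball 0 1) f \<longleftrightarrow>
      (\<exists>F. homeomorphic_extension f G F \<and> asymptotically_symmetric_on (sphere 0 1) F))"
proof -
  have jc: "jordan_curve (frontier G)" and bdd: "bounded G"
    using bounded_jordan_domain_frontier[OF assms(1)] by auto
  interpret conformal_map_disc f G
    by unfold_locales (use assms(2) bdd in \<open>auto simp: conformal_onto_def bij_betw_def\<close>)
  have ab: "asymptotically_symmetric_on (ball 0 1) f" if "symmetric_quasicircle (frontier G)"
    by (rule vanishing_pre_schwarzian_imp_asymptotically_symmetric[OF hol inj
          symmetric_quasicircle_imp_vanishing[OF that]])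
  have bc: "\<exists>F. homeomorphic_extension f G F \<and> asymptotically_symmetric_on (sphere 0 1) F"
    if "asymptotically_symmetric_on (ball 0 1) f"
    by (rule asymptotically_symmetric_extension[OF jc that])
  have ca: "symmetric_quasicircle (frontier G)"
    if "\<exists>F. homeomorphic_extension f G F \<and> asymptotically_symmetric_on (sphere 0 1) F"
    using that boundary_asymptotically_symmetric_imp_symmetric_quasicircle[OF jc] by blast
  show ?thesis using ab bc ca by blast
qed

end
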